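(* For fixed $k\ge3$, \[ \mathsf{tr}(k,r)=\frac{2^{(r-1)k}\,r^{k-3}}{\pi}\left(\int_{-\infty}^{\infty}\frac{\sin^k(2u)}{u^{k-2}}\,du\right)\big(1+o(1)\big)\qquad\text{as } r\to\infty. \]
   Context: For integers $k\ge 3$, $r\ge 1$, let $\mathrm{SC}(k,r)$ be a convex $k$-gon in the plane each of whose sides is subdivided by $r-1$ additional points lying on that side ($kr$ points in total). A triangulation of a finite planar point set is a maximal dissection of its convex hull into triangles by non-crossing segments between points of the set (no point lying in the interior of a triangle side). $\mathsf{tr}(k,r)$ is the number of triangulations of $\mathrm{SC}(k,r)$. *)

theory Defs
  imports "HOL-Analysis.Analysis" "HOL-Library.Landau_Symbols"
begin

definition ccw :: "real^2 \<Rightarrow> real^2 \<Rightarrow> real^2 \<Rightarrow> bool" where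
  "ccw a b c \<longleftrightarrow> (b$1 - a$1) * (c$2 - a$2) - (b$2 - a$2) * (c$1 - a$1) > 0"

text \<open>
  \<open>v 0, \<dots>, v (k - 1)\<close> are the corners of a convex \<open>k\<close>-gon in counterclockwise order:
  all remaining corners lie strictly to the left of each directed side. In particular the
  corners are distinct and no three of them are collinear.
\<close>
definition convex_polygon :: "nat \<Rightarrow> (nat \<Rightarrow> real^2) \<Rightarrow> bool" where
  "convex_polygon k v \<longleftrightarrow> k \<ge> 3 \<and>
     (\<forall>i<k. \<forall>j<k. j \<noteq> i \<longrightarrow> j \<noteq> Suc i mod k \<longrightarrow> ccw (v i) (v (Suc i mod k)) (v j))"

text \<open>
  \<open>P\<close> is a realisation of \<open>SC(k,r)\<close>; the positions of the corners, and those of the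
  \<open>r - 1\<close> points inside each side, are arbitrary.
\<close>
definition subdivided_convex_polygon :: "nat \<Rightarrow> nat \<Rightarrow> (real^2) set \<Rightarrow> bool" where
  "subdivided_convex_polygon k r P \<longleftrightarrow> r \<ge> 1 \<and> finite P \<and>
     (\<exists>v. convex_polygon k v \<and> v ` {..<k} \<subseteq> P \<and>
          P \<subseteq> (\<Union>i<k. closed_segment (v i) (v (Suc i mod k))) \<and>
          (\<forall>i<k. card (P \<inter> open_segment (v i) (v (Suc i mod k))) = r - 1))"

text \<open>
  A dissection into triangles is represented by the set of the vertex sets of its triangles.
  The last two conditions concern the sides of the triangles: they do not cross (or overlap),
  and no point of \<open>P\<close> lies in the interior of a side. For \<open>a = b\<close> the open segment is empty.
\<close>
definition triangle_dissection :: "(real^2) set \<Rightarrow> (real^2) set set \<Rightarrow> bool" where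
  "triangle_dissection P T \<longleftrightarrow>
     (\<forall>t\<in>T. t \<subseteq> P \<and> card t = 3 \<and> \<not> collinear t) \<and>
     (\<Union>t\<in>T. convex hull t) = convex hull P \<and>
     (\<forall>t\<in>T. \<forall>t'\<in>T. t \<noteq> t' \<longrightarrow> interior (convex hull t) \<inter> interior (convex hull t') = {}) \<and>
     (\<forall>t\<in>T. \<forall>t'\<in>T. \<forall>a\<in>t. \<forall>b\<in>t. \<forall>c\<in>t'. \<forall>d\<in>t'.
        {a, b} \<noteq> {c, d} \<longrightarrow> open_segment a b \<inter> open_segment c d = {}) \<and>
     (\<forall>t\<in>T. \<forall>a\<in>t. \<forall>b\<in>t. open_segment a b \<inter> P = {})"

definition refines :: "(real^2) set set \<Rightarrow> (real^2) set set \<Rightarrow> bool" where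
  "refines T' T \<longleftrightarrow> (\<forall>t'\<in>T'. \<exists>t\<in>T. convex hull t' \<subseteq> convex hull t)"

text \<open>
  Maximality means that no further segments can be added, i.e. that there is no proper
  refinement; it rules out points of \<open>P\<close> in the interior of a triangle.
\<close>
definition triangulation :: "(real^2) set \<Rightarrow> (real^2) set set \<Rightarrow> bool" where
  "triangulation P T \<longleftrightarrow> triangle_dissection P T \<and>
     (\<forall>T'. triangle_dissection P T' \<longrightarrow> refines T' T \<longrightarrow> T' = T)"

definition num_triangulations :: "(real^2) set \<Rightarrow> nat" where
  "num_triangulations P = card {T. triangulation P T}"

end

theory Submission
  imports Defs
begin

text \<open>
  Since all points lie on the boundary of the hull, every dissection is already maximal. The triangle
  at a fixed boundary segment splits a dissection into two smaller ones. This recursion, in which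
  degenerate triangles are left out, is solved by
  \<open>\<Sum>S. (-1)\<^sup>|S| Cat(kr - 2 - |S|)\<close>, where \<open>S\<close> runs over the sets of pairwise non-adjacent points
  in the interior of the sides: the inclusion-exclusion over degenerate ears. Writing the Catalan
  numbers as moments turns the sum into
  \<open>4/\<pi> \<integral> (2 cos \<theta>)\<^bsup>kr-4\<^esup> sin((r+1)\<theta>)\<^sup>k / sin(\<theta>)\<^bsup>k-2\<^esup> d\<theta>\<close> over \<open>[0, \<pi>/2]\<close>, because the generating
  polynomial of a side is a Chebyshev polynomial. The substitution \<open>\<theta> = 2u/(r+1)\<close> produces the
  integrand of the theorem times a weight that decreases in \<open>u\<close> and tends to \<open>1\<close>; for \<open>k = 3\<close> the limit
  integral converges only conditionally, so the passage to the limit rests on the second mean value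
  theorem instead of dominated convergence.
\<close>

section \<open>Orientation of triples of points\<close>

text \<open>Subdivision points make runs of consecutive vertices collinear, so the points are only
  weakly in convex position. All geometry is carried by \<open>orient\<close>, twice the signed
  area, with weak inequalities: convex position is \<open>0 \<le> orient\<close> on increasing index
  triples, which sub-chains inherit, and separation, crossing and collinearity become polynomial
  identities with sign arguments. The remaining obstacle is the base segment. It lies on the last
  side, whose line also contains point 0, so triples starting at 0 break the rule that degenerate
  triples live inside one run of flat points. The recursion is therefore solved for chains that do
  not join 0 to the inside of the last side, and the closed polygon is treated once, at the cost of
  a correction term. That term is exactly one further step of the coefficient recursion, which
  restores the symmetry between the k sides and makes the generating polynomial a pure k-th power.
  Asymptotic equivalence finally needs a nonzero limit integral; for odd k this is not visible from
  the integrand and gets its own argument.\<close>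

definition orient :: "real^2 \<Rightarrow> real^2 \<Rightarrow> real^2 \<Rightarrow> real" where
  "orient a b c = (b$1 - a$1) * (c$2 - a$2) - (b$2 - a$2) * (c$1 - a$1)"

lemma orient_rotate: "orient b c a = orient a b c"
  by (simp add: orient_def algebra_simps)

lemma orient_rotate2: "orient c a b = orient a b c"
  by (simp add: orient_def algebra_simps)

lemma orient_swap: "orient b a c = - orient a b c" "orient a c b = - orient a b c"
  by (simp_all add: orient_def algebra_simps)

lemma orient_same [simp]: "orient a a c = 0" "orient a b a = 0" "orient a b b = 0"
  by (simp_all add: orient_def algebra_simps)

lemma orient_affine:
  "orient a b ((1 - u) *\<^sub>R c + u *\<^sub>R d) = (1 - u) * orient a b c + u * orient a b d"
  by (simp add: orient_def algebra_simps)

text \<open>Here \<open>n\<close> is \<open>b - a\<close> turned by a quarter. Writing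
  \<open>orient a b\<close> as an affine functional transfers the library facts on convexity,
  interiors and faces of half-planes to orientations.\<close>

lemma orient_halfspace:
  obtains n c where "a \<noteq> b \<Longrightarrow> n \<noteq> 0" "\<And>x. orient a b x = n \<bullet> x - c"
proof
  let ?n = "vector [a$2 - b$2, b$1 - a$1] :: real^2"
  show "?n \<noteq> 0" if "a \<noteq> b"
    using that by (auto simp: vec_eq_iff forall_2)
  show "orient a b x = ?n \<bullet> x - ?n \<bullet> a" for x
    by (simp add: orient_def inner_vec_def sum_2 algebra_simps)
qed

lemma convex_orient_ge: "convex {x. 0 \<le> orient a b x}"
proof -
  obtain n c where "\<And>x. orient a b x = n \<bullet> x - c" using orient_halfspace by metis
  then have "{x. 0 \<le> orient a b x} = {x. n \<bullet> x \<ge> c}" by simp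
  then show ?thesis using convex_halfspace_ge by metis
qed

lemma convex_orient_le: "convex {x. orient a b x \<le> 0}"
  using convex_orient_ge[of b a] by (simp add: orient_swap(1)[of b a])

lemma hull_orient_ge:
  assumes "\<And>x. x \<in> S \<Longrightarrow> 0 \<le> orient a b x" "x \<in> convex hull S"
  shows "0 \<le> orient a b x"
  using hull_minimal[of S "{x. 0 \<le> orient a b x}" convex] convex_orient_ge assms by blast

lemma hull_orient_le:
  assumes "\<And>x. x \<in> S \<Longrightarrow> orient a b x \<le> 0" "x \<in> convex hull S"
  shows "orient a b x \<le> 0"
  using hull_minimal[of S "{x. orient a b x \<le> 0}" convex] convex_orient_le assms by blast

lemma interior_orient_le:
  assumes "a \<noteq> b" "\<And>x. x \<in> S \<Longrightarrow> orient a b x \<le> 0" "x \<in> interior S"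
  shows "orient a b x < 0"
proof -
  obtain n c where n: "n \<noteq> 0" "\<And>x. orient a b x = n \<bullet> x - c"
    using orient_halfspace assms(1) by metis
  have "S \<subseteq> {x. n \<bullet> x \<le> c}" using assms(2) n by auto
  then have "interior S \<subseteq> {x. n \<bullet> x < c}"
    using interior_mono interior_halfspace_le[OF n(1)] by metis
  then show ?thesis using assms(3) n by auto
qed

lemma interior_orient_ge:
  assumes "a \<noteq> b" "\<And>x. x \<in> S \<Longrightarrow> 0 \<le> orient a b x" "x \<in> interior S"
  shows "0 < orient a b x"
  using interior_orient_le[of b a S x] assms by (auto simp: orient_swap(1)[of b a])

lemma on_line:
  assumes "orient a b x = 0" "a \<noteq> b"
  obtains t where "x = (1 - t) *\<^sub>R a + t *\<^sub>R b"
proof (cases "a$1 = b$1")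
  case False
  show ?thesis
  proof (rule that[of "(x$1 - a$1) / (b$1 - a$1)"])
    show "x = (1 - (x$1 - a$1) / (b$1 - a$1)) *\<^sub>R a + ((x$1 - a$1) / (b$1 - a$1)) *\<^sub>R b"
      using assms False
      by (simp add: vec_eq_iff forall_2 orient_def divide_simps) (simp add: algebra_simps)
  qed
next
  case True
  then have ne: "a$2 \<noteq> b$2" using assms by (simp add: vec_eq_iff forall_2)
  show ?thesis
  proof (rule that[of "(x$2 - a$2) / (b$2 - a$2)"])
    show "x = (1 - (x$2 - a$2) / (b$2 - a$2)) *\<^sub>R a + ((x$2 - a$2) / (b$2 - a$2)) *\<^sub>R b"
      using assms True ne
      by (simp add: vec_eq_iff forall_2 orient_def divide_simps) (simp add: algebra_simps)
  qed
qed

lemma collinear_line: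
  assumes "\<And>x. x \<in> S \<Longrightarrow> orient a b x = 0" "a \<noteq> b"
  shows "collinear S"
  unfolding collinear_def
proof (rule exI[of _ "b - a"], intro ballI)
  fix x y assume "x \<in> S" "y \<in> S"
  obtain s where s: "x = (1 - s) *\<^sub>R a + s *\<^sub>R b" using on_line assms \<open>x \<in> S\<close> by metis
  obtain t where t: "y = (1 - t) *\<^sub>R a + t *\<^sub>R b" using on_line assms \<open>y \<in> S\<close> by metis
  show "\<exists>c. x - y = c *\<^sub>R (b - a)"
    by (rule exI[of _ "s - t"]) (simp add: s t algebra_simps)
qed

lemma collinear_orient: "collinear {a, b, c} \<longleftrightarrow> orient a b c = 0"
proof
  assume "collinear {a, b, c}"
  then obtain u s t where "b - a = s *\<^sub>R u" "c - a = t *\<^sub>R u"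
    unfolding collinear_def by blast
  then have "b = a + s *\<^sub>R u" "c = a + t *\<^sub>R u" by (simp_all add: algebra_simps)
  then show "orient a b c = 0" by (simp add: orient_def)
next
  assume *: "orient a b c = 0"
  show "collinear {a, b, c}"
  proof (cases "a = b")
    case True then show ?thesis by simp
  next
    case False
    then show ?thesis by (intro collinear_line[of _ a b]) (auto simp: *)
  qed
qed

lemma orient_open_segment:
  assumes "x \<in> open_segment c d"
  obtains u where "0 < u" "u < 1" "\<And>a b. orient a b x = (1 - u) * orient a b c + u * orient a b d"
  using assms that by (force simp: in_segment orient_affine)

lemma orient_open_segment_le:
  assumes "x \<in> open_segment c d" "orient a b c \<le> 0" "orient a b d \<le> 0"
  shows "orient a b x \<le> 0" "0 \<le> orient a b x \<Longrightarrow> orient a b c = 0 \<and> orient a b d = 0"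
proof -
  obtain u where u: "0 < u" "u < 1" "orient a b x = (1 - u) * orient a b c + u * orient a b d"
    using orient_open_segment[OF assms(1)] by metis
  have 1: "(1 - u) * orient a b c \<le> 0" "u * orient a b d \<le> 0"
    using u assms by (simp_all add: mult_nonneg_nonpos)
  then show "orient a b x \<le> 0" using u by linarith
  assume "0 \<le> orient a b x"
  then have "(1 - u) * orient a b c = 0" "u * orient a b d = 0" using 1 u by linarith+
  then show "orient a b c = 0 \<and> orient a b d = 0" using u by auto
qed

lemma orient_open_segment_ge:
  assumes "x \<in> open_segment c d" "0 \<le> orient a b c" "0 \<le> orient a b d"
  shows "0 \<le> orient a b x" "orient a b x \<le> 0 \<Longrightarrow> orient a b c = 0 \<and> orient a b d = 0"
  using orient_open_segment_le[OF assms(1), of b a] assms(2,3) by (auto simp: orient_swap(1)[of b a])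

lemma open_segment_line: "x \<in> open_segment a b \<Longrightarrow> orient a b x = 0"
  by (rule orient_open_segment) auto

text \<open>The four sign conditions say that x, y, z, w is a weakly convex quadrilateral. If y has
  parameter t on the line xz, the triangles yzw and wxy have areas 1 - t and t times that of zwx;
  one positive area makes zwx positive, and then the signs force 0 \<le> t \<le> 1.\<close>

lemma quad_between:
  assumes "0 \<le> orient x y z" "0 \<le> orient y z w" "0 \<le> orient z w x" "0 \<le> orient w x y"
    and "orient x y z = 0" "x \<noteq> y" "y \<noteq> z" "x \<noteq> z"
    and "0 < orient y z w \<or> 0 < orient z w x \<or> 0 < orient w x y"
  shows "y \<in> open_segment x z"
proof -
  have "orient x z y = 0" using assms(5) by (simp add: orient_swap(2)[of x y z])
  then obtain t where t: "y = (1 - t) *\<^sub>R x + t *\<^sub>R z" using on_line assms(8) by metis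
  have a: "orient y z w = (1 - t) * orient z w x" "orient w x y = t * orient z w x"
    by (simp_all add: t orient_def algebra_simps)
  have p: "0 < orient z w x" using a assms(3,9) by (cases "orient z w x = 0") auto
  have "0 \<le> t" "t \<le> 1" using assms(2,4) p unfolding a by (auto simp: zero_le_mult_iff)
  moreover have "t \<noteq> 0" "t \<noteq> 1" using t assms(6,7) by auto
  ultimately show ?thesis using t assms(8) by (auto simp: in_segment intro!: exI[of _ t])
qed

text \<open>Each diagonal cuts the quadrilateral abcd into two triangles, and the two area sums
  agree. The crossing point is the combination of b and d, and equally of a and c, whose weights are
  these areas over the total. Strict signs for the triangles at ac put it strictly inside bd; weak
  ones at bd only give the closed segment ac.\<close>

lemma quad_cross:
  assumes "0 < orient a b c" "0 < orient a c d" "0 \<le> orient d a b" "0 \<le> orient b c d"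
  obtains x where "x \<in> open_segment b d" "x \<in> closed_segment a c"
proof -
  define s where "s = orient a b c + orient a c d"
  have s: "s = orient d a b + orient b c d" "0 < s"
    using assms by (simp_all add: s_def) (simp add: orient_def algebra_simps)
  have e1: "1 - orient a b c / s = orient a c d / s" using s by (simp add: s_def divide_simps)
  have e2: "1 - orient d a b / s = orient b c d / s" using s by (simp add: s(1) divide_simps)
  define x where "x = (orient a c d / s) *\<^sub>R b + (orient a b c / s) *\<^sub>R d"
  have x': "x = (orient b c d / s) *\<^sub>R a + (orient d a b / s) *\<^sub>R c"
  proof -
    have "orient a c d * b$1 + orient a b c * d$1 = orient b c d * a$1 + orient d a b * c$1"
      "orient a c d * b$2 + orient a b c * d$2 = orient b c d * a$2 + orient d a b * c$2"
      by (simp_all add: orient_def algebra_simps)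
    then have "orient a c d *\<^sub>R b + orient a b c *\<^sub>R d = orient b c d *\<^sub>R a + orient d a b *\<^sub>R c"
      by (simp add: vec_eq_iff forall_2)
    then have "(1 / s) *\<^sub>R (orient a c d *\<^sub>R b + orient a b c *\<^sub>R d)
        = (1 / s) *\<^sub>R (orient b c d *\<^sub>R a + orient d a b *\<^sub>R c)" by simp
    then show ?thesis by (simp add: x_def scaleR_add_right)
  qed
  have "b \<noteq> d" using assms(1,2) orient_swap(2)[of a b c] by auto
  show ?thesis
  proof
    have "0 < orient a b c / s" "orient a b c / s < 1"
      using assms by (simp_all add: s_def)
    then show "x \<in> open_segment b d"
      unfolding in_segment using \<open>b \<noteq> d\<close> e1 x_def by metis
    have "0 \<le> orient d a b / s" "orient d a b / s \<le> 1"
      using assms s by simp_all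
    then show "x \<in> closed_segment a c"
      unfolding in_segment using e2 x' by metis
  qed
qed

section \<open>Dissections of weakly convex point sequences\<close>

text \<open>In the parameter of the line ab with a at 0 and b at 1, the second segment is an
  interval that meets the open unit interval and has no end in it, so it contains it; since neither
  0 nor 1 is interior to it, the two agree.\<close>

lemma segments_eq:
  assumes "x \<in> open_segment a b" "x \<in> open_segment c d" "orient a b c = 0" "orient a b d = 0"
    and "a \<notin> open_segment c d" "b \<notin> open_segment c d" "c \<notin> open_segment a b" "d \<notin> open_segment a b"
  shows "{a, b} = {c, d}"
proof -
  obtain t where t: "a \<noteq> b" "0 < t" "t < 1" "x = (1 - t) *\<^sub>R a + t *\<^sub>R b"
    using assms(1) by (auto simp: in_segment)
  have line_eq: "s = u" if "(1 - s) *\<^sub>R a + s *\<^sub>R b = (1 - u) *\<^sub>R a + u *\<^sub>R b" for s u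
  proof -
    have "(s - u) *\<^sub>R (b - a) = 0" using that by (simp add: algebra_simps)
    then show ?thesis using t(1) by simp
  qed
  \<comment> \<open>The case that the first end comes before the second in the parameter; the other
    order follows by exchanging c and d.\<close>
  have *: "a = c' \<and> b = d'"
    if H: "s \<le> u" "c' = (1 - s) *\<^sub>R a + s *\<^sub>R b" "d' = (1 - u) *\<^sub>R a + u *\<^sub>R b"
      "x \<in> open_segment c' d'" "a \<notin> open_segment c' d'" "b \<notin> open_segment c' d'"
      "c' \<notin> open_segment a b" "d' \<notin> open_segment a b" for s u c' d'
  proof -
    obtain w where w: "c' \<noteq> d'" "0 < w" "w < 1" "x = (1 - w) *\<^sub>R c' + w *\<^sub>R d'"
      using H(4) by (auto simp: in_segment)
    have "s \<noteq> u" using H w(1) by auto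
    then have su: "s < u" using H(1) by simp
    have eq: "(1 - q) *\<^sub>R c' + q *\<^sub>R d' = (1 - (s + q * (u - s))) *\<^sub>R a + (s + q * (u - s)) *\<^sub>R b" for q
      by (simp add: H(2,3) algebra_simps)
    have "t = s + w * (u - s)" using line_eq t(4) w(4) eq by metis
    moreover have "0 < w * (u - s)" "w * (u - s) < u - s" using w su by simp_all
    ultimately have st: "s < t" "t < u" by linarith+
    have "\<not> (0 < s \<and> s < 1)" using H(2,7) t(1) by (auto simp: in_segment)
    moreover have "\<not> (0 < u \<and> u < 1)" using H(3,8) t(1) by (auto simp: in_segment)
    ultimately have s: "s \<le> 0" "1 \<le> u" using st t by linarith+
    have mem: "(1 - v) *\<^sub>R a + v *\<^sub>R b \<in> open_segment c' d'" if "s < v" "v < u" for v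
    proof -
      have "s + (v - s) / (u - s) * (u - s) = v" using su by simp
      then have "(1 - v) *\<^sub>R a + v *\<^sub>R b = (1 - (v - s) / (u - s)) *\<^sub>R c' + ((v - s) / (u - s)) *\<^sub>R d'"
        using eq by metis
      moreover have "0 < (v - s) / (u - s)" "(v - s) / (u - s) < 1" using that by simp_all
      ultimately show ?thesis unfolding in_segment using w(1) by blast
    qed
    have "s = 0" using mem[of 0] H(5) s by fastforce
    moreover have "u = 1" using mem[of 1] H(6) s by fastforce
    ultimately show ?thesis using H(2,3) by simp
  qed
  obtain s where s: "c = (1 - s) *\<^sub>R a + s *\<^sub>R b" using on_line assms(3) t(1) by metis
  obtain u where u: "d = (1 - u) *\<^sub>R a + u *\<^sub>R b" using on_line assms(4) t(1) by metis
  show ?thesis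
  proof (cases "s \<le> u")
    case True
    then show ?thesis using *[OF _ s u] assms by auto
  next
    case False
    then show ?thesis using *[OF _ u s] assms by (auto simp: open_segment_commute)
  qed
qed

lemma line_orient_eq_0:
  assumes "orient x y a = 0" "orient x y b = 0" "orient x y c = 0" "x \<noteq> y"
  shows "orient a b c = 0"
  using collinear_line[of "{a, b, c}" x y] assms collinear_orient by auto

text \<open>Each membership contracts towards x by a factor below 1, so z - x would equal u v (z -
  x) with u v < 1.\<close>

lemma open_segment_not_both: "\<not> (y \<in> open_segment x z \<and> z \<in> open_segment x y)"
proof
  assume *: "y \<in> open_segment x z \<and> z \<in> open_segment x y"
  obtain u v where u: "u < 1" "0 < u" "y = (1 - u) *\<^sub>R x + u *\<^sub>R z" "x \<noteq> z"
    and v: "v < 1" "0 < v" "z = (1 - v) *\<^sub>R x + v *\<^sub>R y"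
    using * unfolding in_segment by blast
  have "(1 - u * v) *\<^sub>R (z - x) = z - x - v *\<^sub>R (u *\<^sub>R (z - x))"
    by (simp add: algebra_simps)
  also have "u *\<^sub>R (z - x) = y - x" by (simp add: u(3) algebra_simps)
  also have "v *\<^sub>R (y - x) = z - x" by (subst v(3)) (simp add: algebra_simps)
  finally have "1 = u * v" using u(4) by simp
  moreover have "u * v < 1 * 1" using u v by (intro mult_strict_mono) auto
  ultimately show False by simp
qed

text \<open>The line supports the hull, so it cuts out a face, and a face of the hull of a finite
  set is the hull of some of its points, necessarily points on the line.\<close>

lemma hull_on_line:
  assumes "x \<in> convex hull S" "finite S" "\<And>y. y \<in> S \<Longrightarrow> orient a b y \<le> 0" "orient a b x = 0"
  shows "x \<in> convex hull {y \<in> S. orient a b y = 0}"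
proof -
  obtain n c where n: "\<And>x. orient a b x = n \<bullet> x - c" using orient_halfspace by metis
  have "(convex hull S \<inter> {x. n \<bullet> x = c}) face_of convex hull S"
    using hull_orient_le[of S a b] assms(3)
    by (intro face_of_Int_supporting_hyperplane_le) (auto simp: n)
  then obtain S' where S': "S' \<subseteq> S" "convex hull S \<inter> {x. n \<bullet> x = c} = convex hull S'"
    using face_of_convex_hull_subset assms(2) finite_imp_compact by metis
  have "S' \<subseteq> {y \<in> S. orient a b y = 0}" using S' hull_subset[of S' convex] by (auto simp: n)
  then have "convex hull S' \<subseteq> convex hull {y \<in> S. orient a b y = 0}" by (rule hull_mono)
  then show ?thesis using S'(2) assms(1,4) by (auto simp: n)
qed

text \<open>The barycentric coordinates of x are the areas of the triangles that x spans with the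
  three sides, divided by the total area.\<close>

lemma in_triangle:
  assumes "0 < orient a b c" "0 \<le> orient a b x" "0 \<le> orient b c x" "0 \<le> orient c a x"
  shows "x \<in> convex hull {a, b, c}"
proof -
  define s where "s = orient a b c"
  have s: "0 < s" "s = orient b c x + orient c a x + orient a b x"
    using assms(1) by (simp_all add: s_def) (simp add: orient_def algebra_simps)
  have "orient a b c * x$1 = orient b c x * a$1 + orient c a x * b$1 + orient a b x * c$1"
    "orient a b c * x$2 = orient b c x * a$2 + orient c a x * b$2 + orient a b x * c$2"
    by (simp_all add: orient_def algebra_simps)
  then have "s *\<^sub>R x = orient b c x *\<^sub>R a + orient c a x *\<^sub>R b + orient a b x *\<^sub>R c"
    by (simp add: vec_eq_iff forall_2 s_def)
  then have "(1 / s) *\<^sub>R (s *\<^sub>R x) = (1 / s) *\<^sub>R (orient b c x *\<^sub>R a + orient c a x *\<^sub>R b + orient a b x *\<^sub>R c)"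
    by simp
  then have "x = (orient b c x / s) *\<^sub>R a + (orient c a x / s) *\<^sub>R b + (orient a b x / s) *\<^sub>R c"
    using s(1) by (simp add: scaleR_add_right)
  moreover have "orient b c x / s + orient c a x / s + orient a b x / s = 1"
    using s by (simp add: add_divide_distrib[symmetric])
  ultimately show ?thesis unfolding convex_hull_3 using assms s(1)
    by (intro CollectI exI[of _ "orient b c x / s"] exI[of _ "orient c a x / s"] exI[of _ "orient a b x / s"])
       simp
qed

lemma triangle_sides_disjoint:
  assumes "orient x y z \<noteq> 0" "a \<in> {x, y, z}" "b \<in> {x, y, z}" "c \<in> {x, y, z}" "d \<in> {x, y, z}"
    "{a, b} \<noteq> {c, d}"
  shows "open_segment a b \<inter> open_segment c d = {}"
proof -
  \<comment> \<open>Any two distinct sides share a vertex, and a rotation of the triangle brings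
    them to this form.\<close>
  have *: "open_segment x y \<inter> open_segment y z = {}" if "orient x y z \<noteq> 0" for x y z
  proof -
    have False if "w \<in> open_segment x y" "w \<in> open_segment y z" for w
    proof -
      obtain u where "0 < u" "orient x y w = (1 - u) * orient x y y + u * orient x y z"
        using orient_open_segment[OF \<open>w \<in> open_segment y z\<close>] by metis
      then show False using open_segment_line[OF \<open>w \<in> open_segment x y\<close>] \<open>orient x y z \<noteq> 0\<close> by simp
    qed
    then show ?thesis by blast
  qed
  have "orient y z x \<noteq> 0" "orient z x y \<noteq> 0" using assms(1) orient_rotate by metis+
  note * = *[OF assms(1)] *[OF this(1)] *[OF this(2)]
  have **: "w \<notin> open_segment y z" "w \<notin> open_segment x z" if "w \<in> open_segment x y" for w
    using * that by (auto simp: open_segment_commute[of z x])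
  have ***: "w \<notin> open_segment x z" if "w \<in> open_segment y z" for w
    using * that by (auto simp: open_segment_commute[of z x])
  have c: "open_segment a b = open_segment c d" if "{a, b} = {c, d}" for a b c d :: "real^2"
    using that open_segment_commute[of a b] by (auto simp: doubleton_eq_iff)
  have "False" if w: "w \<in> open_segment a b" "w \<in> open_segment c d" for w
  proof -
    have "a \<noteq> b" "c \<noteq> d" using w by auto
    then have ab: "{a, b} = {x, y} \<or> {a, b} = {y, z} \<or> {a, b} = {x, z}"
      and cd: "{c, d} = {x, y} \<or> {c, d} = {y, z} \<or> {c, d} = {x, z}"
      using assms(2-5) by fast+
    show False
      using ab
    proof (elim disjE)
      assume e: "{a, b} = {x, y}"
      then have "w \<in> open_segment x y" using c w by metis
      then show False using cd w(2) c **[of w] assms(6) e by metis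
    next
      assume e: "{a, b} = {y, z}"
      then have "w \<in> open_segment y z" using c w by metis
      then show False using cd w(2) c **[of w] ***[of w] assms(6) e by metis
    next
      assume e: "{a, b} = {x, z}"
      then have "w \<in> open_segment x z" using c w by metis
      then show False using cd w(2) c **[of w] ***[of w] assms(6) e by metis
    qed
  qed
  then show ?thesis by blast
qed

lemma triangle_dissectionD:
  assumes "triangle_dissection P T"
  shows "t \<in> T \<Longrightarrow> t \<subseteq> P" "t \<in> T \<Longrightarrow> card t = 3" "t \<in> T \<Longrightarrow> \<not> collinear t"
    and "(\<Union>t\<in>T. convex hull t) = convex hull P"
    and "t \<in> T \<Longrightarrow> t' \<in> T \<Longrightarrow> t \<noteq> t' \<Longrightarrow> interior (convex hull t) \<inter> interior (convex hull t') = {}"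
    and "t \<in> T \<Longrightarrow> t' \<in> T \<Longrightarrow> a \<in> t \<Longrightarrow> b \<in> t \<Longrightarrow> c \<in> t' \<Longrightarrow> d \<in> t' \<Longrightarrow> {a, b} \<noteq> {c, d}
      \<Longrightarrow> open_segment a b \<inter> open_segment c d = {}"
    and "t \<in> T \<Longrightarrow> a \<in> t \<Longrightarrow> b \<in> t \<Longrightarrow> open_segment a b \<inter> P = {}"
proof -
  note * = assms[unfolded triangle_dissection_def]
  show "t \<in> T \<Longrightarrow> t \<subseteq> P" "t \<in> T \<Longrightarrow> card t = 3" "t \<in> T \<Longrightarrow> \<not> collinear t"
    using * by simp_all
  show "(\<Union>t\<in>T. convex hull t) = convex hull P" using * by (elim conjE)
  show "t \<in> T \<Longrightarrow> t' \<in> T \<Longrightarrow> t \<noteq> t' \<Longrightarrow> interior (convex hull t) \<inter> interior (convex hull t') = {}"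
    using * by (elim conjE) meson
  show "t \<in> T \<Longrightarrow> t' \<in> T \<Longrightarrow> a \<in> t \<Longrightarrow> b \<in> t \<Longrightarrow> c \<in> t' \<Longrightarrow> d \<in> t' \<Longrightarrow> {a, b} \<noteq> {c, d}
      \<Longrightarrow> open_segment a b \<inter> open_segment c d = {}"
    using * by (elim conjE) meson
  show "t \<in> T \<Longrightarrow> a \<in> t \<Longrightarrow> b \<in> t \<Longrightarrow> open_segment a b \<inter> P = {}"
    using * by (elim conjE) meson
qed

text \<open>The sign \<open>s = \<plusminus> 1\<close> makes the lemma applicable to a configuration and to its mirror image.\<close>

lemma cross_segment:
  fixes s :: real
  assumes x: "x = (1 - u) *\<^sub>R y + u *\<^sub>R z" "0 \<le> u" "u \<le> 1" "s * orient a b x < 0"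
    and z: "0 \<le> s * orient a b z"
    and c: "0 < s * orient c a b" "0 \<le> s * orient c a y" "0 \<le> s * orient c a z"
    and m: "0 \<le> s * orient y b z"
  obtains w where "w \<in> closed_segment a b" "x \<in> closed_segment y w"
proof -
  define f where "f = - s * orient a b y"
  define g where "g = s * orient a b z"
  have sx: "s * orient a b x = u * g - (1 - u) * f"
    unfolding x(1) orient_affine f_def g_def by (simp add: algebra_simps)
  have g: "0 \<le> g" using z by (simp add: g_def)
  have "0 \<le> u * g" using x g by simp
  then have "0 < (1 - u) * f" using sx x(4) by linarith
  then have f: "0 < f" using x by (simp add: zero_less_mult_iff)
  \<comment> \<open>Parameter at which the segment from y to z meets the line ab; up to a common
    factor, f and g are the distances of y and z from that line, on opposite sides.\<close>
  define v where "v = f / (f + g)"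
  have v: "0 < v" "v \<le> 1" "(1 - v) * f = v * g" using f g by (simp_all add: v_def field_simps)
  have "u * (f + g) < f" using sx x(4) by (simp add: algebra_simps)
  then have uv: "u < v" using f g by (simp add: v_def field_simps)
  define w where "w = (1 - v) *\<^sub>R y + v *\<^sub>R z"
  have "s * orient a b w = v * g - (1 - v) * f"
    unfolding w_def orient_affine f_def g_def by (simp add: algebra_simps)
  then have "orient a b w = 0" using v c(1) by auto
  moreover have "a \<noteq> b" using c(1) by auto
  ultimately obtain t where t: "w = (1 - t) *\<^sub>R a + t *\<^sub>R b" using on_line by metis
  have "0 \<le> (1 - v) * (s * orient c a y) + v * (s * orient c a z)"
    by (rule add_nonneg_nonneg) (rule mult_nonneg_nonneg; use v c in simp)+
  also have "\<dots> = s * orient c a w" unfolding w_def orient_affine by (simp add: algebra_simps)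
  also have "\<dots> = t * (s * orient c a b)" unfolding t orient_affine by simp
  finally have "0 \<le> t" using c(1) by (simp add: zero_le_mult_iff)
  have "0 \<le> v * (s * orient y b z)" using v m by simp
  also have "\<dots> = s * orient y b w" unfolding w_def orient_affine by simp
  also have "\<dots> = (1 - t) * f" by (simp add: t f_def orient_def algebra_simps)
  finally have "t \<le> 1" using f by (simp add: zero_le_mult_iff)
  show ?thesis
  proof
    show "w \<in> closed_segment a b" using t \<open>0 \<le> t\<close> \<open>t \<le> 1\<close> by (auto simp: in_segment)
    have "x = (1 - u / v) *\<^sub>R y + (u / v) *\<^sub>R w"
      using v by (simp add: x(1) w_def algebra_simps)
    moreover have "0 \<le> u / v" "u / v \<le> 1" using uv v x by auto
    ultimately show "x \<in> closed_segment y w" unfolding in_segment by blast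
  qed
qed

lemma triangle_dissectionI:
  assumes "\<And>t. t \<in> T \<Longrightarrow> t \<subseteq> P \<and> card t = 3 \<and> \<not> collinear t"
    and "(\<Union>t\<in>T. convex hull t) = convex hull P"
    and "\<And>t t'. t \<in> T \<Longrightarrow> t' \<in> T \<Longrightarrow> t \<noteq> t'
      \<Longrightarrow> interior (convex hull t) \<inter> interior (convex hull t') = {}"
    and "\<And>t t' a b c d. t \<in> T \<Longrightarrow> t' \<in> T \<Longrightarrow> a \<in> t \<Longrightarrow> b \<in> t \<Longrightarrow> c \<in> t' \<Longrightarrow> d \<in> t'
      \<Longrightarrow> {a, b} \<noteq> {c, d} \<Longrightarrow> open_segment a b \<inter> open_segment c d = {}"
    and "\<And>t a b. t \<in> T \<Longrightarrow> a \<in> t \<Longrightarrow> b \<in> t \<Longrightarrow> open_segment a b \<inter> P = {}"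
  shows "triangle_dissection P T"
  unfolding triangle_dissection_def
proof (intro conjI)
  show "\<forall>t\<in>T. t \<subseteq> P \<and> card t = 3 \<and> \<not> collinear t" using assms(1) by (intro ballI)
  show "\<forall>t\<in>T. \<forall>t'\<in>T. t \<noteq> t' \<longrightarrow> interior (convex hull t) \<inter> interior (convex hull t') = {}"
    using assms(3) by (intro ballI impI)
  show "\<forall>t\<in>T. \<forall>t'\<in>T. \<forall>a\<in>t. \<forall>b\<in>t. \<forall>c\<in>t'. \<forall>d\<in>t'.
    {a, b} \<noteq> {c, d} \<longrightarrow> open_segment a b \<inter> open_segment c d = {}"
    using assms(4) by (intro ballI impI)
  show "\<forall>t\<in>T. \<forall>a\<in>t. \<forall>b\<in>t. open_segment a b \<inter> P = {}"
    using assms(5) by (intro ballI)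
qed (rule assms(2))

text \<open>A chain of two points bounds nothing. It gets exactly one dissection, the empty one, as
  the unit of the product recursion; \<open>triangle_dissection\<close> would admit none, because
  the empty union is not the segment between the points.\<close>

definition dissections :: "(nat \<Rightarrow> real^2) \<Rightarrow> nat \<Rightarrow> nat \<Rightarrow> (real^2) set set set" where
  "dissections p i j = (if j = Suc i then {{}} else {T. triangle_dissection (p ` {i..j}) T})"

lemma dissectionsD:
  assumes "T \<in> dissections p i j"
  shows "t \<in> T \<Longrightarrow> t \<subseteq> p ` {i..j}" "t \<in> T \<Longrightarrow> card t = 3" "t \<in> T \<Longrightarrow> \<not> collinear t"
    and "t \<in> T \<Longrightarrow> t' \<in> T \<Longrightarrow> t \<noteq> t' \<Longrightarrow> interior (convex hull t) \<inter> interior (convex hull t') = {}"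
    and "t \<in> T \<Longrightarrow> t' \<in> T \<Longrightarrow> a \<in> t \<Longrightarrow> b \<in> t \<Longrightarrow> c \<in> t' \<Longrightarrow> d \<in> t' \<Longrightarrow> {a, b} \<noteq> {c, d}
      \<Longrightarrow> open_segment a b \<inter> open_segment c d = {}"
    and "t \<in> T \<Longrightarrow> a \<in> t \<Longrightarrow> b \<in> t \<Longrightarrow> open_segment a b \<inter> p ` {i..j} = {}"
  using assms triangle_dissectionD[of "p ` {i..j}" T]
  unfolding dissections_def by (auto split: if_splits simp del: Int_iff)

lemma dissections_cover:
  assumes "T \<in> dissections p i j" "j \<noteq> Suc i"
  shows "(\<Union>t\<in>T. convex hull t) = convex hull (p ` {i..j})"
  using assms triangle_dissectionD(4) by (auto simp: dissections_def)

text \<open>Counterclockwise order in index form. The inequality is weak because the points of one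
  side are collinear, and it involves only increasing triples, so every sub-chain closed by its
  chord has the same property.\<close>

locale weakly_convex =
  fixes p :: "nat \<Rightarrow> real^2" and N :: nat
  assumes inj: "inj_on p {..<N}"
    and pos: "\<And>a b c. a < b \<Longrightarrow> b < c \<Longrightarrow> c < N \<Longrightarrow> 0 \<le> orient (p a) (p b) (p c)"
begin

lemma pos_le: "a \<le> b \<Longrightarrow> b \<le> c \<Longrightarrow> c < N \<Longrightarrow> 0 \<le> orient (p a) (p b) (p c)"
  using pos[of a b c] by (cases "a = b \<or> b = c") auto

lemma neg_le: "a \<le> b \<Longrightarrow> b \<le> c \<Longrightarrow> c < N \<Longrightarrow> orient (p a) (p c) (p b) \<le> 0"
  using pos_le[of a b c] orient_swap(2)[of "p a" "p b" "p c"] by simp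

lemma neq: "a < N \<Longrightarrow> b < N \<Longrightarrow> p a = p b \<longleftrightarrow> a = b"
  using inj by (auto simp: inj_on_def)

text \<open>Weak convexity of i, a, j puts \<open>p a\<close> on one side of the chord. Since
  \<open>p m\<close> is a combination of the chord ends, the triple a, m, j or i, m, a yields a
  multiple of the same orientation with the opposite sign.\<close>

lemma segment_collinear:
  assumes "i < m" "m < j" "j < N" "p m \<in> open_segment (p i) (p j)" "i \<le> a" "a \<le> j"
  shows "orient (p i) (p j) (p a) = 0"
proof -
  obtain t where t: "0 < t" "t < 1" "p m = (1 - t) *\<^sub>R p i + t *\<^sub>R p j"
    using assms(4) by (auto simp: in_segment)
  have 1: "orient x (p m) y = (1 - t) * orient x (p i) y + t * orient x (p j) y" for x y
    by (simp add: t(3) orient_def algebra_simps)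
  have 2: "orient (p m) x y = (1 - t) * orient (p i) x y + t * orient (p j) x y" for x y
    by (simp add: t(3) orient_def algebra_simps)
  have "0 \<le> orient (p i) (p j) (p a)"
  proof (cases "a \<le> m")
    case True
    have "0 \<le> orient (p a) (p m) (p j)" using True assms by (intro pos_le) auto
    also have "\<dots> = (1 - t) * orient (p i) (p j) (p a)" using orient_rotate by (simp add: 1)
    finally show ?thesis using t by (simp add: zero_le_mult_iff)
  next
    case False
    have "0 \<le> orient (p i) (p m) (p a)" using False assms by (intro pos_le) auto
    also have "\<dots> = t * orient (p i) (p j) (p a)" by (simp add: 1)
    finally show ?thesis using t by (simp add: zero_le_mult_iff)
  qed
  then show ?thesis using neg_le[of i a j] assms by simp
qed

text \<open>The hull is nonempty, so a dissection has at least one triangle, and its vertices cannot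
  all lie on one line.\<close>

lemma dissection_noncollinear:
  assumes "triangle_dissection (p ` {i..j}) T" "i \<le> j" "j < N" "x \<noteq> y"
  obtains a where "a \<in> {i..j}" "orient x y (p a) \<noteq> 0"
proof -
  have "p i \<in> convex hull (p ` {i..j})" using assms(2) by (intro hull_inc) auto
  then obtain t where "t \<in> T" using triangle_dissectionD(4)[OF assms(1)] by blast
  then have t: "t \<subseteq> p ` {i..j}" "\<not> collinear t" using triangle_dissectionD[OF assms(1)] by auto
  have "\<exists>a\<in>{i..j}. orient x y (p a) \<noteq> 0"
  proof (rule ccontr)
    assume "\<not> ?thesis"
    then have "orient x y z = 0" if "z \<in> t" for z using t(1) that by auto
    then show False using collinear_line assms(4) t(2) by metis
  qed
  then show ?thesis using that by blast
qed

text \<open>A point inside the base would make the whole chain collinear, and a collinear chain of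
  more than two points has no dissection.\<close>

lemma dissections_free:
  assumes "T \<in> dissections p i j" "i < j" "j < N" "a \<in> {i..j}"
  shows "p a \<notin> open_segment (p i) (p j)"
proof
  assume *: "p a \<in> open_segment (p i) (p j)"
  then have "a \<noteq> i" "a \<noteq> j" by (auto simp: open_segment_def)
  then have a: "i < a" "a < j" using assms by auto
  then have "triangle_dissection (p ` {i..j}) T" using assms(1) by (auto simp: dissections_def)
  then show False
    using dissection_noncollinear[of i j T "p i" "p j"] segment_collinear[OF a assms(3) *] assms neq
    by (metis atLeastAtMost_iff less_imp_le order_less_trans less_irrefl)
qed

lemma edge_triangle:
  assumes T: "T \<in> dissections p i j" "Suc i < j" "j < N"
  obtains m where "i < m" "m < j" "0 < orient (p i) (p m) (p j)" "{p i, p m, p j} \<in> T"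
proof -
  have dis: "triangle_dissection (p ` {i..j}) T" using T by (auto simp: dissections_def)
  have ij: "p i \<noteq> p j" using neq[of i j] T by auto
  define x where "x = midpoint (p i) (p j)"
  have x: "x \<in> open_segment (p i) (p j)" using ij by (simp add: x_def)
  have "x \<in> convex hull {p i, p j}" using x by (auto simp: segment_convex_hull[symmetric] open_segment_def)
  also have "\<dots> \<subseteq> convex hull (p ` {i..j})" using T by (intro hull_mono) auto
  finally obtain t where t: "t \<in> T" "x \<in> convex hull t" "t \<subseteq> p ` {i..j}" "card t = 3" "\<not> collinear t"
    using triangle_dissectionD(4)[OF dis, symmetric] triangle_dissectionD(1-3)[OF dis] by auto
  have fin: "finite t" using t(4) by (intro card_ge_0_finite) simp
  define S where "S = {y \<in> t. orient (p i) (p j) y = 0}"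
  have "x \<in> convex hull S" unfolding S_def
    using t(2) fin
  proof (rule hull_on_line)
    fix y assume "y \<in> t"
    then obtain a where "y = p a" "i \<le> a" "a \<le> j" using t(3) by auto
    then show "orient (p i) (p j) y \<le> 0" using neg_le T(3) by simp
  next
    show "orient (p i) (p j) x = 0" using x by (rule open_segment_line)
  qed
  have xP: "x \<notin> p ` {i..j}" using dissections_free[OF T(1) _ T(3)] x T(2) by auto
  have "S \<noteq> t" using t(5) collinear_line[of t "p i" "p j"] ij by (auto simp: S_def)
  then have "S \<subset> t" by (auto simp: S_def)
  then have "card S < 3" using t(4) fin psubset_card_mono by metis
  moreover have "S \<noteq> {}" using \<open>x \<in> convex hull S\<close> by auto
  then have "card S \<noteq> 0" using fin by (simp add: S_def)
  moreover have "card S \<noteq> 1"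
  proof
    assume "card S = 1"
    then obtain y where "S = {y}" using card_1_singletonE by blast
    then have "x \<in> S" using \<open>x \<in> convex hull S\<close> by simp
    then have "x \<in> t" by (simp add: S_def)
    then show False using xP t(3) by auto
  qed
  ultimately have "card S = 2" by linarith
  then obtain y z where yz: "S = {y, z}" "y \<noteq> z" by (auto simp: card_2_iff)
  then have yzt: "y \<in> t" "z \<in> t" "orient (p i) (p j) y = 0" "orient (p i) (p j) z = 0"
    by (auto simp: S_def)
  have "x \<in> closed_segment y z" using \<open>x \<in> convex hull S\<close> yz by (simp add: segment_convex_hull)
  then have "x \<in> open_segment y z" using xP yzt t(3) by (auto simp: open_segment_def)
  have yzP: "open_segment y z \<inter> p ` {i..j} = {}"
    using triangle_dissectionD(7)[OF dis t(1)] yzt by simp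
  have ijP: "open_segment (p i) (p j) \<inter> p ` {i..j} = {}"
    using dissections_free[OF T(1) _ T(3)] T(2) by auto
  have "{p i, p j} = {y, z}"
    using x \<open>x \<in> open_segment y z\<close> yzt(3,4)
  proof (rule segments_eq)
    show "p i \<notin> open_segment y z" "p j \<notin> open_segment y z" using T(2) yzP by auto
    show "y \<notin> open_segment (p i) (p j)" "z \<notin> open_segment (p i) (p j)"
      using ijP yzt(1,2) t(3) by auto
  qed
  then have pt: "p i \<in> t" "p j \<in> t" using yzt by auto
  have "card (t - {p i, p j}) = 1" using pt fin t(4) ij by (simp add: card_Diff_subset)
  then obtain w where w: "t - {p i, p j} = {w}" using card_1_singletonE by blast
  then obtain m where m: "w = p m" "m \<in> {i..j}" using t(3) by blast
  then have teq: "t = {p i, p m, p j}" and ne: "m \<noteq> i" "m \<noteq> j" using w pt by auto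
  then have "i < m" "m < j" using m by auto
  moreover have "orient (p i) (p m) (p j) \<noteq> 0" using t(5) teq collinear_orient by metis
  ultimately show ?thesis using that pos T t(1) teq by (metis less_le)
qed

end

section \<open>Geometry around a triangle erected on the base\<close>

locale weakly_convex_split = weakly_convex +
  fixes i m j :: nat
  assumes im: "i < m" and mj: "m < j" and jN: "j < N"
    and proper: "0 < orient (p i) (p m) (p j)"
begin

abbreviation "L \<equiv> p ` {i..m}"
abbreviation "R \<equiv> p ` {m..j}"
abbreviation "P \<equiv> p ` {i..j}"
abbreviation "\<Delta> \<equiv> {p i, p m, p j}"

lemma ne: "p i \<noteq> p m" "p m \<noteq> p j" "p i \<noteq> p j"
  using im mj jN by (auto simp: neq)

lemma P_eq: "P = L \<union> R"
  using im mj by (auto simp flip: image_Un simp: ivl_disj_un)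

lemma \<Delta>_sub: "\<Delta> \<subseteq> P"
  using im mj by auto

text \<open>An instance of \<open>quad_between\<close> whose nondegeneracy comes from the positive
  triangle i, m, j; the three lemmas after it are its variants for other positions of the fourth
  point.\<close>

lemma inner_left:
  assumes "i < a" "a < m" "orient (p i) (p a) (p m) = 0"
  shows "p a \<in> open_segment (p i) (p m)"
  using assms im mj jN pos[of i a m] pos[of a m j] pos[of i m j] pos[of i a j] proper
  by (intro quad_between[of _ _ _ "p j"]) (auto simp: neq orient_rotate[of "p m" "p j" "p i"] orient_rotate2[of "p j" "p i" "p a"])

lemma inner_right:
  assumes "m < a" "a < j" "orient (p m) (p a) (p j) = 0"
  shows "p a \<in> open_segment (p m) (p j)"
  using assms im mj jN pos[of m a j] pos[of i a j] pos[of i m j] pos[of i m a] proper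
  by (intro quad_between[of _ _ _ "p i"]) (auto simp: neq orient_rotate[of "p a" "p j" "p i"] orient_rotate2[of "p j" "p i" "p m"])

lemma outer_right:
  assumes "m < b" "b < j" "orient (p i) (p m) (p b) = 0"
  shows "p m \<in> open_segment (p i) (p b)"
  using assms im mj jN pos[of i m b] pos[of m b j] pos[of i b j] pos[of i m j] proper
  by (intro quad_between[of _ _ _ "p j"]) (auto simp: neq orient_rotate[of "p b" "p j" "p i"] orient_rotate2[of "p j" "p i" "p m"])

lemma outer_left:
  assumes "i < b" "b < m" "orient (p b) (p m) (p j) = 0"
  shows "p m \<in> open_segment (p b) (p j)"
  using assms im mj jN pos[of b m j] pos[of i m j] pos[of i b j] pos[of i b m] proper
  by (intro quad_between[of _ _ _ "p i"]) (auto simp: neq orient_rotate[of "p m" "p j" "p i"] orient_rotate2[of "p j" "p i" "p b"])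


text \<open>Only the points of the chain from a to b are tested. For the sides im and mj,
  \<open>free_R\<close> and \<open>free_L\<close> exclude the points of the opposite chain.\<close>

definition free where "free a b = (\<forall>c\<in>{a..b}. p c \<notin> open_segment (p a) (p b))"

lemma strict_left:
  assumes "free i m" "i < a" "a < m"
  shows "0 < orient (p i) (p a) (p m)"
  using inner_left[of a] pos[of i a m] assms mj jN by (force simp: free_def less_le)

lemma strict_right:
  assumes "free m j" "m < a" "a < j"
  shows "0 < orient (p m) (p a) (p j)"
  using inner_right[of a] pos[of m a j] assms im jN by (force simp: free_def less_le)

text \<open>If \<open>p b\<close> were on the line im, then \<open>p m\<close> would lie inside the
  chord from i to b and the whole chain from i to b would be collinear, against strictness at the
  inner point a of the left chain.\<close>

lemma strict_cross_left:
  assumes "free i m" "i < a" "a < m" "m < b" "b \<le> j"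
  shows "0 < orient (p i) (p m) (p b)"
proof (cases "b = j")
  case False
  have "orient (p i) (p m) (p b) \<noteq> 0"
  proof
    assume "orient (p i) (p m) (p b) = 0"
    then have m: "p m \<in> open_segment (p i) (p b)" using outer_right assms False by simp
    have bN: "b < N" using assms jN by simp
    have "orient (p i) (p b) (p a) = 0" "orient (p i) (p b) (p m) = 0"
      using segment_collinear[OF im assms(4) bN m] assms im by auto
    then have "orient (p i) (p a) (p m) = 0"
      using assms neq[of i b] bN by (subst line_orient_eq_0[of "p i" "p b"]) auto
    then show False using strict_left assms by fastforce
  qed
  then show ?thesis using pos[of i m b] assms im jN by auto
qed (simp add: proper)

lemma strict_cross_right:
  assumes "free m j" "m < b" "b < j" "i \<le> a" "a < m"
  shows "0 < orient (p a) (p m) (p j)"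
proof (cases "a = i")
  case False
  have "orient (p a) (p m) (p j) \<noteq> 0"
  proof
    assume "orient (p a) (p m) (p j) = 0"
    then have m: "p m \<in> open_segment (p a) (p j)" using outer_left assms False by simp
    have "orient (p a) (p j) (p b) = 0" "orient (p a) (p j) (p m) = 0"
      using segment_collinear[OF assms(5) mj jN m] assms by auto
    then have "orient (p m) (p b) (p j) = 0"
      using assms neq[of a j] jN by (subst line_orient_eq_0[of "p a" "p j"]) auto
    then show False using strict_right assms by fastforce
  qed
  then show ?thesis using pos[of a m j] assms mj jN by auto
qed (simp add: proper)

text \<open>The left chain lies weakly beyond the side im and on the inner side of the other two
  lines. Together with \<open>R_hull\<close> and \<open>\<Delta>_hull\<close>, the signs relative to
  the lines im and mj separate the three regions.\<close>

lemma L_hull: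
  assumes "x \<in> convex hull L"
  shows "orient (p i) (p m) x \<le> 0" "0 \<le> orient (p m) (p j) x" "0 \<le> orient (p j) (p i) x"
proof -
  show "orient (p i) (p m) x \<le> 0"
    using assms mj jN by (intro hull_orient_le[OF _ assms]) (auto intro!: neg_le)
  show "0 \<le> orient (p m) (p j) x"
    using assms mj jN by (intro hull_orient_ge[OF _ assms]) (auto simp: orient_rotate[of "p m" "p j"] intro!: pos_le)
  show "0 \<le> orient (p j) (p i) x"
    using assms mj jN by (intro hull_orient_ge[OF _ assms]) (auto simp: orient_rotate2[of "p j" "p i"] intro!: pos_le)
qed

lemma R_hull:
  assumes "x \<in> convex hull R"
  shows "0 \<le> orient (p i) (p m) x" "orient (p m) (p j) x \<le> 0" "0 \<le> orient (p j) (p i) x"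
proof -
  show "0 \<le> orient (p i) (p m) x"
    using assms im jN by (intro hull_orient_ge[OF _ assms]) (auto intro!: pos_le)
  show "orient (p m) (p j) x \<le> 0"
    using assms im jN by (intro hull_orient_le[OF _ assms]) (auto intro!: neg_le)
  show "0 \<le> orient (p j) (p i) x"
    using assms im jN by (intro hull_orient_ge[OF _ assms]) (auto simp: orient_rotate2[of "p j" "p i"] intro!: pos_le)
qed

lemma \<Delta>_hull:
  assumes "x \<in> convex hull \<Delta>"
  shows "0 \<le> orient (p i) (p m) x" "0 \<le> orient (p m) (p j) x" "0 \<le> orient (p j) (p i) x"
proof -
  have "0 < orient (p m) (p j) (p i)" "0 < orient (p j) (p i) (p m)"
    using proper orient_rotate orient_rotate2 by metis+
  then show "0 \<le> orient (p i) (p m) x" "0 \<le> orient (p m) (p j) x" "0 \<le> orient (p j) (p i) x"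
    using proper by (intro hull_orient_ge[OF _ assms]; auto)+
qed


text \<open>For a point of the right chain collinear with i and m, the point m lies between it and
  i, so it cannot itself lie between i and m.\<close>

lemma free_R:
  assumes "b \<in> {m..j}"
  shows "p b \<notin> open_segment (p i) (p m)"
proof
  assume *: "p b \<in> open_segment (p i) (p m)"
  then have 0: "orient (p i) (p m) (p b) = 0" by (rule open_segment_line)
  then have "b \<noteq> m" "b \<noteq> j" using * proper by (auto simp: open_segment_def)
  then show False using outer_right[OF _ _ 0] assms * open_segment_not_both by auto
qed

lemma free_L:
  assumes "b \<in> {i..m}"
  shows "p b \<notin> open_segment (p m) (p j)"
proof
  assume *: "p b \<in> open_segment (p m) (p j)"
  then have 0: "orient (p b) (p m) (p j) = 0"
    using open_segment_line orient_rotate by metis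
  then have "b \<noteq> m" "b \<noteq> i" using * proper by (auto simp: open_segment_def)
  then show False using outer_left[OF _ _ 0] assms * open_segment_not_both[of "p m" "p j" "p b"]
    by (auto simp: open_segment_commute)
qed

text \<open>A point inside the base would force the apex onto the base line.\<close>

lemma free_base: "free i j"
  unfolding free_def
proof
  fix c assume c: "c \<in> {i..j}"
  show "p c \<notin> open_segment (p i) (p j)"
  proof
    assume *: "p c \<in> open_segment (p i) (p j)"
    then have "c \<noteq> i" "c \<noteq> j" by (auto simp: open_segment_def)
    then have "orient (p i) (p j) (p m) = 0"
      using segment_collinear[of i c j m] c * im mj jN by auto
    then show False using proper orient_swap(2)[of "p i" "p j" "p m"] by simp
  qed
qed

lemma line_left:
  assumes "free i m" "x \<in> L" "orient (p i) (p m) x = 0"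
  shows "x \<in> {p i, p m}"
proof -
  obtain a where a: "x = p a" "a \<in> {i..m}" using assms(2) by blast
  have "\<not> (i < a \<and> a < m)"
    using strict_left[OF assms(1), of a] assms(3) a orient_swap(2)[of "p i" "p a" "p m"] by auto
  then show ?thesis using a by auto
qed

lemma line_right:
  assumes "free m j" "x \<in> R" "orient (p m) (p j) x = 0"
  shows "x \<in> {p m, p j}"
proof -
  obtain a where a: "x = p a" "a \<in> {m..j}" using assms(2) by blast
  have "\<not> (m < a \<and> a < j)"
    using strict_right[OF assms(1), of a] assms(3) a orient_swap(2)[of "p m" "p a" "p j"] by auto
  then show ?thesis using a by auto
qed

text \<open>A point of the hull is on a segment from some y in the hull of L to some z in the hull
  of R. If it is beyond the line im, that segment meets the side im on the way to z, so the point
  lies between y and a point of the side, inside the hull of L; the line mj is symmetric. Otherwise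
  all three sign conditions of the triangle hold.\<close>

lemma hull_P: "convex hull P \<subseteq> convex hull L \<union> convex hull \<Delta> \<union> convex hull R"
proof
  fix x assume "x \<in> convex hull P"
  also have "\<dots> \<subseteq> convex hull (convex hull L \<union> convex hull R)"
    unfolding P_eq by (intro hull_mono Un_mono hull_subset)
  finally obtain y z u v where y: "y \<in> convex hull L" and z: "z \<in> convex hull R"
    and u: "0 \<le> u" "0 \<le> v" "u + v = 1" and x: "x = u *\<^sub>R y + v *\<^sub>R z"
    using convex_hull_union_two[OF convex_convex_hull _ convex_convex_hull, of L R] im mj by auto
  have u': "u = 1 - v" using u by simp
  \<comment> \<open>The path turns left at \<open>p m\<close> on its way from L to R; this keeps the
    meeting point on the near side of \<open>p m\<close>.\<close>
  have yz: "0 \<le> orient y (p m) z"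
  proof -
    have 1: "0 \<le> orient (p m) z c" if "c \<in> L" for c
    proof -
      have "0 \<le> orient c (p m) z"
        using that jN by (intro hull_orient_ge[OF _ z]) (auto intro!: pos_le)
      then show ?thesis using orient_rotate by simp
    qed
    have "0 \<le> orient (p m) z y" by (rule hull_orient_ge[OF 1 y])
    then show ?thesis using orient_rotate by simp
  qed
  note pr = proper orient_rotate2[of "p j" "p i" "p m"]
  note Ly = L_hull[OF y]
  note Rz = R_hull[OF z]
  have rev: "orient b a w = - orient a b w" for a b w by (rule orient_swap)
  consider "orient (p i) (p m) x < 0" | "orient (p m) (p j) x < 0"
    | "0 \<le> orient (p i) (p m) x" "0 \<le> orient (p m) (p j) x" by linarith
  then show "x \<in> convex hull L \<union> convex hull \<Delta> \<union> convex hull R"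
  proof cases
    case 1
    obtain w where w: "w \<in> closed_segment (p i) (p m)" "x \<in> closed_segment y w"
      by (rule cross_segment[of x v y z 1 "p i" "p m" "p j"]) (use x u u' 1 pr Ly Rz yz in auto)
    have "closed_segment (p i) (p m) \<subseteq> convex hull L"
      using im by (intro closed_segment_subset_convex_hull hull_inc) auto
    then have "x \<in> convex hull L" using w y closed_segment_subset_convex_hull by blast
    then show ?thesis by simp
  next
    case 2
    have "orient z (p m) y = - orient y (p m) z" by (simp add: orient_def algebra_simps)
    \<comment> \<open>A reflection exchanges the roles of L and R and reverses all orientations,
      hence the sign \<open>-1\<close>.\<close>
    then obtain w where w: "w \<in> closed_segment (p j) (p m)" "x \<in> closed_segment z w"
      by (rule_tac cross_segment[of x u z y "-1" "p j" "p m" "p i"])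
         (use x u u' 2 pr Ly Rz yz rev[of "p j" "p m"] rev[of "p i" "p j"] orient_swap(2)[of "p i" "p j" "p m"] in auto)
    have "closed_segment (p j) (p m) \<subseteq> convex hull R"
      using mj by (intro closed_segment_subset_convex_hull hull_inc) auto
    then have "x \<in> convex hull R" using w z closed_segment_subset_convex_hull by blast
    then show ?thesis by simp
  next
    case 3
    have "0 \<le> u * orient (p j) (p i) y + v * orient (p j) (p i) z"
      using u Ly Rz by (intro add_nonneg_nonneg mult_nonneg_nonneg) auto
    also have "\<dots> = orient (p j) (p i) x" unfolding x u' orient_affine by simp
    finally have "x \<in> convex hull \<Delta>" using 3 proper by (intro in_triangle)
    then show ?thesis by simp
  qed
qed

text \<open>A segment of the left part that reaches the line im inside lies entirely on it, and
  freeness leaves only the two ends of that side.\<close>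

lemma segment_left_base:
  assumes "free i m" "c \<in> L" "d \<in> L" "x \<in> open_segment c d" "0 \<le> orient (p i) (p m) x"
  shows "{c, d} = {p i, p m}"
proof -
  have "orient (p i) (p m) c = 0 \<and> orient (p i) (p m) d = 0"
    using orient_open_segment_le(2)[OF assms(4) _ _ assms(5)] L_hull(1) assms(2,3) by (simp add: hull_inc)
  then have "c \<in> {p i, p m}" "d \<in> {p i, p m}" using line_left assms by auto
  moreover have "c \<noteq> d" using assms(4) by auto
  ultimately show ?thesis by auto
qed

lemma segment_right_base:
  assumes "free m j" "c \<in> R" "d \<in> R" "x \<in> open_segment c d" "0 \<le> orient (p m) (p j) x"
  shows "{c, d} = {p m, p j}"
proof -
  have "orient (p m) (p j) c = 0 \<and> orient (p m) (p j) d = 0"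
    using orient_open_segment_le(2)[OF assms(4) _ _ assms(5)] R_hull(2) assms(2,3) by (simp add: hull_inc)
  then have "c \<in> {p m, p j}" "d \<in> {p m, p j}" using line_right assms by auto
  moreover have "c \<noteq> d" using assms(4) by auto
  ultimately show ?thesis by auto
qed

lemma segment_\<Delta>_base:
  assumes "a \<in> \<Delta>" "b \<in> \<Delta>" "x \<in> open_segment a b"
  shows "orient (p i) (p m) x \<le> 0 \<Longrightarrow> {a, b} = {p i, p m}"
    and "orient (p m) (p j) x \<le> 0 \<Longrightarrow> {a, b} = {p m, p j}"
proof -
  have ab: "a \<noteq> b" using assms(3) by auto
  have "0 < orient (p m) (p j) (p i)" using proper orient_rotate by metis
  note pr = proper this
  assume "orient (p i) (p m) x \<le> 0"
  then have "orient (p i) (p m) a = 0 \<and> orient (p i) (p m) b = 0"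
    using orient_open_segment_ge(2)[OF assms(3)] \<Delta>_hull(1) assms(1,2) by (simp add: hull_inc)
  then show "{a, b} = {p i, p m}" using assms(1,2) ab pr by auto
next
  have ab: "a \<noteq> b" using assms(3) by auto
  have "0 < orient (p m) (p j) (p i)" using proper orient_rotate by metis
  note pr = proper this
  assume "orient (p m) (p j) x \<le> 0"
  then have "orient (p m) (p j) a = 0 \<and> orient (p m) (p j) b = 0"
    using orient_open_segment_ge(2)[OF assms(3)] \<Delta>_hull(2) assms(1,2) by (simp add: hull_inc)
  then show "{a, b} = {p m, p j}" using assms(1,2) ab pr by auto
qed

section \<open>Gluing two dissections to the triangle\<close>

context
  fixes A B
  assumes A: "A \<in> dissections p i m" and B: "B \<in> dissections p m j"
begin

lemma free_parts: "free i m" "free m j"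
  using dissections_free[OF A im] dissections_free[OF B mj jN] mj jN by (auto simp: free_def)

lemma hull_A: "s \<in> A \<Longrightarrow> x \<in> convex hull s \<Longrightarrow> x \<in> convex hull L"
  using hull_mono dissectionsD(1)[OF A] by blast

lemma hull_B: "s \<in> B \<Longrightarrow> x \<in> convex hull s \<Longrightarrow> x \<in> convex hull R"
  using hull_mono dissectionsD(1)[OF B] by blast

text \<open>The chains share only \<open>p m\<close>, so a triangle lies in at most one of them;
  this makes both parts recoverable from the union.\<close>

lemma parts_not_both: "s \<in> A \<Longrightarrow> \<not> s \<subseteq> R" "s \<in> B \<Longrightarrow> \<not> s \<subseteq> L"
proof -
  have LR: "L \<inter> R \<subseteq> {p m}" using im mj jN by (auto simp: neq)
  have *: "\<not> s \<subseteq> L \<inter> R" if "card s = 3" for s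
  proof
    assume "s \<subseteq> L \<inter> R"
    then have "card s \<le> card {p m}" using LR by (intro card_mono) auto
    then show False using that by simp
  qed
  show "s \<in> A \<Longrightarrow> \<not> s \<subseteq> R" using * dissectionsD(1,2)[OF A] by blast
  show "s \<in> B \<Longrightarrow> \<not> s \<subseteq> L" using * dissectionsD(1,2)[OF B] by blast
qed

lemma \<Delta>_not_part: "\<not> \<Delta> \<subseteq> L" "\<not> \<Delta> \<subseteq> R"
  using im mj jN by (auto simp: neq)

lemma parts_interior:
  assumes "s \<in> insert \<Delta> (A \<union> B)" "t \<in> insert \<Delta> (A \<union> B)" "s \<noteq> t"
  shows "interior (convex hull s) \<inter> interior (convex hull t) = {}"
proof -
  have iA: "orient (p i) (p m) x < 0" if "s \<in> A" "x \<in> interior (convex hull s)" for s x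
    using interior_orient_le[OF ne(1) _ that(2)] hull_A that L_hull by blast
  have iB: "0 < orient (p i) (p m) x" "orient (p m) (p j) x < 0"
    if "s \<in> B" "x \<in> interior (convex hull s)" for s x
    using interior_orient_ge[OF ne(1) _ that(2)] interior_orient_le[OF ne(2) _ that(2)]
      hull_B that R_hull by blast+
  have iD: "0 < orient (p i) (p m) x" "0 < orient (p m) (p j) x"
    if "x \<in> interior (convex hull \<Delta>)" for x
    using interior_orient_ge[OF ne(1) _ that] interior_orient_ge[OF ne(2) _ that] \<Delta>_hull by blast+
  show ?thesis
    using assms
  proof (elim insertE UnE; intro equals0I; elim IntE)
    fix x assume "s \<in> A" "t \<in> A" "x \<in> interior (convex hull s)" "x \<in> interior (convex hull t)"
    then show False using dissectionsD(4)[OF A] assms(3) by blast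
  next
    fix x assume "s \<in> B" "t \<in> B" "x \<in> interior (convex hull s)" "x \<in> interior (convex hull t)"
    then show False using dissectionsD(4)[OF B] assms(3) by blast
  next
    fix x assume "s = \<Delta>" "t \<in> A" "x \<in> interior (convex hull s)" "x \<in> interior (convex hull t)"
    then show False using iD(1)[of x] iA[of t x] by simp
  next
    fix x assume "s = \<Delta>" "t \<in> B" "x \<in> interior (convex hull s)" "x \<in> interior (convex hull t)"
    then show False using iD(2)[of x] iB(2)[of t x] by simp
  next
    fix x assume "s \<in> A" "t = \<Delta>" "x \<in> interior (convex hull s)" "x \<in> interior (convex hull t)"
    then show False using iD(1)[of x] iA[of s x] by simp
  next
    fix x assume "s \<in> B" "t = \<Delta>" "x \<in> interior (convex hull s)" "x \<in> interior (convex hull t)"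
    then show False using iD(2)[of x] iB(2)[of s x] by simp
  next
    fix x assume "s \<in> A" "t \<in> B" "x \<in> interior (convex hull s)" "x \<in> interior (convex hull t)"
    then show False using iA[of s x] iB(1)[of t x] by simp
  next
    fix x assume "s \<in> B" "t \<in> A" "x \<in> interior (convex hull s)" "x \<in> interior (convex hull t)"
    then show False using iA[of t x] iB(1)[of s x] by simp
  qed (use assms(3) in simp_all)
qed

text \<open>A common point of sides from two different regions lies on a separating line. Against
  the middle triangle this forces both to be the shared side, hence equal. For a side on the left
  and one on the right, the forced sides are im and mj, which have no interior point in
  common.\<close>

lemma parts_sides:
  assumes s: "s \<in> insert \<Delta> (A \<union> B)" "t \<in> insert \<Delta> (A \<union> B)"
    and ab: "a \<in> s" "b \<in> s" "c \<in> t" "d \<in> t" and neq: "{a, b} \<noteq> {c, d}"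
  shows "open_segment a b \<inter> open_segment c d = {}"
proof -
  note base = segment_left_base[OF free_parts(1)] segment_right_base[OF free_parts(2)] segment_\<Delta>_base
  have A': "orient (p i) (p m) x \<le> 0 \<and> 0 \<le> orient (p m) (p j) x \<and> a \<in> L \<and> b \<in> L"
    if "s \<in> A" "a \<in> s" "b \<in> s" "x \<in> open_segment a b" for s a b x
  proof -
    have "x \<in> convex hull s"
      using closed_segment_subset_convex_hull[of a s b] that by (auto simp: hull_inc open_segment_def)
    then show ?thesis using hull_A L_hull dissectionsD(1)[OF A] that by blast
  qed
  have B': "0 \<le> orient (p i) (p m) x \<and> orient (p m) (p j) x \<le> 0 \<and> a \<in> R \<and> b \<in> R"
    if "s \<in> B" "a \<in> s" "b \<in> s" "x \<in> open_segment a b" for s a b x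
  proof -
    have "x \<in> convex hull s"
      using closed_segment_subset_convex_hull[of a s b] that by (auto simp: hull_inc open_segment_def)
    then show ?thesis using hull_B R_hull dissectionsD(1)[OF B] that by blast
  qed
  have D': "0 \<le> orient (p i) (p m) x \<and> 0 \<le> orient (p m) (p j) x"
    if "a \<in> \<Delta>" "b \<in> \<Delta>" "x \<in> open_segment a b" for a b x
  proof -
    have "x \<in> convex hull \<Delta>"
      using closed_segment_subset_convex_hull[of a \<Delta> b] that by (auto simp: hull_inc open_segment_def)
    then show ?thesis using \<Delta>_hull by blast
  qed
  have AD: "False" if "s \<in> A" "a \<in> s" "b \<in> s" "c \<in> \<Delta>" "d \<in> \<Delta>" "{a, b} \<noteq> {c, d}"
    "x \<in> open_segment a b" "x \<in> open_segment c d" for s a b c d x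
  proof -
    note 1 = A'[OF that(1-3,7)] and 2 = D'[OF that(4,5,8)]
    have "{a, b} = {p i, p m}" using base(1) 1 2 that(7) by blast
    moreover have "{c, d} = {p i, p m}" using base(3) 1 2 that(4,5,8) by blast
    ultimately show False using that(6) by simp
  qed
  have BD: "False" if "s \<in> B" "a \<in> s" "b \<in> s" "c \<in> \<Delta>" "d \<in> \<Delta>" "{a, b} \<noteq> {c, d}"
    "x \<in> open_segment a b" "x \<in> open_segment c d" for s a b c d x
  proof -
    note 1 = B'[OF that(1-3,7)] and 2 = D'[OF that(4,5,8)]
    have "{a, b} = {p m, p j}" using base(2) 1 2 that(7) by blast
    moreover have "{c, d} = {p m, p j}" using base(4) 1 2 that(4,5,8) by blast
    ultimately show False using that(6) by simp
  qed
  have AB: "False" if "s \<in> A" "a \<in> s" "b \<in> s" "t \<in> B" "c \<in> t" "d \<in> t"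
    "x \<in> open_segment a b" "x \<in> open_segment c d" for s t a b c d x
  proof -
    note 1 = A'[OF that(1-3,7)] and 2 = B'[OF that(4-6,8)]
    have "{a, b} = {p i, p m}" using base(1) 1 2 that(7) by blast
    then have x1: "orient (p i) (p m) a = 0 \<and> orient (p i) (p m) b = 0" by (auto simp: doubleton_eq_iff)
    have "{c, d} = {p m, p j}" using base(2) 1 2 that(8) by blast
    then have "orient (p i) (p m) c = 0 \<and> orient (p i) (p m) d = orient (p i) (p m) (p j)
        \<or> orient (p i) (p m) d = 0 \<and> orient (p i) (p m) c = orient (p i) (p m) (p j)"
      by (auto simp: doubleton_eq_iff)
    then show False
      using orient_open_segment_ge(2)[OF that(8), of "p i" "p m"] 1 proper by auto
  qed
  have DD: "orient (p i) (p m) (p j) \<noteq> 0" using proper by simp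
  show ?thesis
    using s
  proof (elim insertE UnE)
    assume "s = \<Delta>" "t = \<Delta>"
    then show ?thesis using triangle_sides_disjoint[OF DD _ _ _ _ neq] ab by simp
  next
    assume "s \<in> A" "t \<in> A"
    then show ?thesis using dissectionsD(5)[OF A _ _ ab neq] by simp
  next
    assume "s \<in> B" "t \<in> B"
    then show ?thesis using dissectionsD(5)[OF B _ _ ab neq] by simp
  next
    assume "s = \<Delta>" "t \<in> A"
    then show ?thesis using AD[OF _ ab(3,4) _ _ neq[symmetric]] ab by blast
  next
    assume "s = \<Delta>" "t \<in> B"
    then show ?thesis using BD[OF _ ab(3,4) _ _ neq[symmetric]] ab by blast
  next
    assume "s \<in> A" "t = \<Delta>"
    then show ?thesis using AD[OF _ ab(1,2) _ _ neq] ab by blast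
  next
    assume "s \<in> B" "t = \<Delta>"
    then show ?thesis using BD[OF _ ab(1,2) _ _ neq] ab by blast
  next
    assume "s \<in> A" "t \<in> B"
    then show ?thesis using AB ab by blast
  next
    assume "s \<in> B" "t \<in> A"
    then show ?thesis using AB ab by blast
  qed
qed

lemma parts_free:
  assumes s: "s \<in> insert \<Delta> (A \<union> B)" and ab: "a \<in> s" "b \<in> s"
  shows "open_segment a b \<inter> P = {}"
proof -
  have c: "open_segment a b = open_segment c d" if "{a, b} = {c, d}" for a b c d :: "real^2"
    using that open_segment_commute[of a b] by (auto simp: doubleton_eq_iff)
  have im_free: "open_segment (p i) (p m) \<inter> P = {}"
    using free_parts(1) free_R unfolding P_eq by (auto simp: free_def)
  have mj_free: "open_segment (p m) (p j) \<inter> P = {}"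
    using free_parts(2) free_L unfolding P_eq by (auto simp: free_def)
  have ij_free: "open_segment (p i) (p j) \<inter> P = {}"
    using free_base by (auto simp: free_def)
  show ?thesis
    using s
  proof (elim insertE UnE)
    assume "s = \<Delta>"
    then have "a = b \<or> {a, b} = {p i, p m} \<or> {a, b} = {p m, p j} \<or> {a, b} = {p i, p j}"
      using ab by auto
    then show ?thesis using im_free mj_free ij_free c by (metis open_segment_idem Int_empty_left)
  next
    assume sA: "s \<in> A"
    have "x \<notin> open_segment a b" if "x \<in> R" for x
    proof
      assume x: "x \<in> open_segment a b"
      have "{a, b} = {p i, p m}"
        using segment_left_base[OF free_parts(1) _ _ x] dissectionsD(1)[OF A sA] ab R_hull(1) that
        by (auto simp: hull_inc)
      then show False using x that im_free c unfolding P_eq by blast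
    qed
    then show ?thesis using dissectionsD(6)[OF A sA ab] unfolding P_eq by blast
  next
    assume sB: "s \<in> B"
    have "x \<notin> open_segment a b" if "x \<in> L" for x
    proof
      assume x: "x \<in> open_segment a b"
      have "{a, b} = {p m, p j}"
        using segment_right_base[OF free_parts(2) _ _ x] dissectionsD(1)[OF B sB] ab L_hull(2) that
        by (auto simp: hull_inc)
      then show False using x that mj_free c unfolding P_eq by blast
    qed
    then show ?thesis using dissectionsD(6)[OF B sB ab] unfolding P_eq by blast
  qed
qed

lemma parts_cover: "(\<Union>s\<in>insert \<Delta> (A \<union> B). convex hull s) = convex hull P"
proof
  have sub: "s \<subseteq> P" if "s \<in> insert \<Delta> (A \<union> B)" for s
    using that \<Delta>_sub dissectionsD(1)[OF A] dissectionsD(1)[OF B] unfolding P_eq by blast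
  then show "(\<Union>s\<in>insert \<Delta> (A \<union> B). convex hull s) \<subseteq> convex hull P"
    by (intro UN_least hull_mono)
  have "convex hull L \<subseteq> (\<Union>s\<in>insert \<Delta> A. convex hull s)"
  \<comment> \<open>A chain of two points contributes no triangle, but its hull is a side of the
    middle triangle.\<close>
  proof (cases "m = Suc i")
    case True
    then have "{i..m} = {i, m}" by auto
    then have "convex hull L \<subseteq> convex hull \<Delta>" by (intro hull_mono) auto
    then show ?thesis by blast
  qed (use dissections_cover[OF A] in blast)
  moreover have "convex hull R \<subseteq> (\<Union>s\<in>insert \<Delta> B. convex hull s)"
  proof (cases "j = Suc m")
    case True
    then have "{m..j} = {m, j}" by auto
    then have "convex hull R \<subseteq> convex hull \<Delta>" by (intro hull_mono) auto
    then show ?thesis by blast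
  qed (use dissections_cover[OF B] in blast)
  moreover have "(\<Union>s\<in>insert \<Delta> (A \<union> B). convex hull s)
      = (\<Union>s\<in>insert \<Delta> A. convex hull s) \<union> convex hull \<Delta> \<union> (\<Union>s\<in>insert \<Delta> B. convex hull s)"
    by (simp only: UN_insert UN_Un) blast
  ultimately have "convex hull L \<union> convex hull \<Delta> \<union> convex hull R
      \<subseteq> (\<Union>s\<in>insert \<Delta> (A \<union> B). convex hull s)"
    by (simp only: Un_mono order_refl)
  then show "convex hull P \<subseteq> (\<Union>s\<in>insert \<Delta> (A \<union> B). convex hull s)"
    by (rule order_trans[OF hull_P])
qed

text \<open>One direction of the correspondence; the two equations recover the parts and later give
  injectivity.\<close>

lemma dissection_of_parts:
  shows "insert \<Delta> (A \<union> B) \<in> dissections p i j"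
    and "{s \<in> insert \<Delta> (A \<union> B). s \<subseteq> L} = A" and "{s \<in> insert \<Delta> (A \<union> B). s \<subseteq> R} = B"
proof -
  have "card \<Delta> = 3" using ne by simp
  moreover have "\<not> collinear \<Delta>" using collinear_orient proper by simp
  moreover have LP: "L \<subseteq> P" and RP: "R \<subseteq> P" using P_eq by simp_all
  ultimately have 1: "s \<subseteq> P \<and> card s = 3 \<and> \<not> collinear s" if "s \<in> insert \<Delta> (A \<union> B)" for s
    using that
  proof (elim insertE UnE)
    assume "s \<in> A"
    then show ?thesis using dissectionsD(1-3)[OF A] subset_trans[OF _ LP] by simp
  next
    assume "s \<in> B"
    then show ?thesis using dissectionsD(1-3)[OF B] subset_trans[OF _ RP] by simp
  qed (use \<Delta>_sub in simp)
  have "triangle_dissection P (insert \<Delta> (A \<union> B))"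
    by (rule triangle_dissectionI[OF 1 parts_cover parts_interior parts_sides parts_free])
  then show "insert \<Delta> (A \<union> B) \<in> dissections p i j"
    using im mj by (auto simp: dissections_def)
  show "{s \<in> insert \<Delta> (A \<union> B). s \<subseteq> L} = A" "{s \<in> insert \<Delta> (A \<union> B). s \<subseteq> R} = B"
    using dissectionsD(1)[OF A] dissectionsD(1)[OF B] parts_not_both \<Delta>_not_part by blast+
qed

end

section \<open>Cutting a dissection along the triangle on the base\<close>

lemma free_of_triangle:
  assumes T: "T \<in> dissections p i j" and "\<Delta> \<in> T"
  shows "free i m" "free m j"
  using dissectionsD(6)[OF T \<open>\<Delta> \<in> T\<close>, of "p i" "p m"]
    dissectionsD(6)[OF T \<open>\<Delta> \<in> T\<close>, of "p m" "p j"] im mj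
  by (auto simp: free_def disjoint_iff)

text \<open>A triangle with vertices strictly before and strictly after m has a side that crosses im
  or mj, by \<open>quad_cross\<close>. The exception is the base itself, but then the third vertex,
  different from m, gives another such side.\<close>

lemma dissection_triangle_cases:
  assumes T: "T \<in> dissections p i j" and "\<Delta> \<in> T" "s \<in> T" "s \<noteq> \<Delta>"
  shows "s \<subseteq> L \<or> s \<subseteq> R"
proof -
  have seg: "open_segment a b \<inter> P = {}" if "t \<in> T" "a \<in> t" "b \<in> t" for t a b
    using dissectionsD(6)[OF T that] .
  note f = free_of_triangle[OF assms(1,2)]
  \<comment> \<open>A chord other than the base has an end that is an inner point of one of the two
    chains; this is what makes the strict inequalities for that chain applicable.\<close>
  have no: False if H: "t \<in> T" "p a \<in> t" "p b \<in> t" "i \<le> a" "a < m" "m < b" "b \<le> j" "a \<noteq> i \<or> b \<noteq> j" for t a b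
    using H(8)
  proof
    assume "a \<noteq> i"
    then have a: "i < a" using H by simp
    have "0 \<le> orient (p b) (p i) (p a)" "0 \<le> orient (p a) (p m) (p b)"
      using pos[of i a b] pos[of a m b] a H jN orient_rotate2[of "p b" "p i" "p a"] by auto
    then obtain x where x: "x \<in> open_segment (p a) (p b)" "x \<in> closed_segment (p i) (p m)"
      using quad_cross[OF strict_left[OF f(1) a H(5)] strict_cross_left[OF f(1) a H(5-7)]] by metis
    \<comment> \<open>The crossing point is no end of im, because the open chord from a to b
      contains no point of the set.\<close>
    have "p i \<in> P" "p m \<in> P" using im mj by auto
    then have "x \<in> open_segment (p i) (p m)"
      using x seg[OF H(1-3)] unfolding open_segment_def by blast
    moreover have "a \<noteq> m" "b \<noteq> m" "a < N" "b < N" "m < N" using H jN by auto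
    then have "{p i, p m} \<noteq> {p a, p b}" by (auto simp: doubleton_eq_iff neq)
    ultimately show False
      using dissectionsD(5)[OF T \<open>\<Delta> \<in> T\<close> H(1) _ _ H(2,3), of "p i" "p m"] x(1) by auto
  next
    assume "b \<noteq> j"
    then have b: "b < j" using H by simp
    have "0 \<le> orient (p a) (p m) (p b)" "0 \<le> orient (p b) (p j) (p a)" "0 < orient (p m) (p j) (p a)"
      using pos[of a b j] pos[of a m b] b H jN orient_rotate[of "p b" "p j" "p a"]
        orient_rotate[of "p m" "p j" "p a"] strict_cross_right[OF f(2) H(6) b H(4,5)] by auto
    then obtain x where x: "x \<in> open_segment (p b) (p a)" "x \<in> closed_segment (p m) (p j)"
      using quad_cross[OF strict_right[OF f(2) H(6) b]] by metis
    have "p m \<in> P" "p j \<in> P" using im mj by auto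
    then have "x \<in> open_segment (p m) (p j)"
      using x seg[OF H(1,3,2)] unfolding open_segment_def by blast
    moreover have "a \<noteq> m" "b \<noteq> m" "a < N" "b < N" "m < N" using H jN by auto
    then have "{p m, p j} \<noteq> {p b, p a}" by (auto simp: doubleton_eq_iff neq)
    ultimately show False
      using dissectionsD(5)[OF T \<open>\<Delta> \<in> T\<close> H(1) _ _ H(3,2), of "p m" "p j"] x(1) by auto
  qed
  have sP: "s \<subseteq> P" "card s = 3" using dissectionsD(1,2)[OF T] assms(3) by auto
  show ?thesis
  proof (rule ccontr)
    assume "\<not> ?thesis"
    then obtain x y where xy: "x \<in> s" "x \<notin> L" "y \<in> s" "y \<notin> R" by blast
    then obtain b where b: "x = p b" "i \<le> b" "b \<le> j" using sP by auto
    obtain a where a: "y = p a" "i \<le> a" "a \<le> j" using xy sP by auto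
    have "a < m" "m < b" using xy a b by (auto simp: not_le[symmetric])
    then have ab: "a = i" "b = j" using no[OF assms(3), of a b] xy a b by auto
    have "p i \<in> s" "p j \<in> s" using xy a b ab by auto
    moreover have "finite s" using sP(2) by (intro card_ge_0_finite) simp
    ultimately have "card (s - {p i, p j}) = 1" using sP(2) ne by (simp add: card_Diff_subset)
    then obtain w where w: "s - {p i, p j} = {w}" using card_1_singletonE by blast
    then obtain c where c: "w = p c" "c \<in> {i..j}" using sP(1) by blast
    have s: "s = {p i, p c, p j}" and ne': "c \<noteq> i" "c \<noteq> j"
      using w c \<open>p i \<in> s\<close> \<open>p j \<in> s\<close> by auto
    have "c \<noteq> m" using s assms(4) by auto
    then consider "c < m" | "m < c" by linarith
    then show False
    proof cases
      case 1
      then show False using no[OF assms(3), of c j] s ne' c mj by auto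
    next
      case 2
      then show False using no[OF assms(3), of i c] s ne' c im by auto
    qed
  qed
qed

lemma in_closed_if_open_segment_subset:
  fixes x y :: "'a::euclidean_space"
  assumes "closed C" "open_segment x y \<subseteq> C" "x \<noteq> y"
  shows "x \<in> C"
  using closure_minimal[OF assms(2,1)] assms(3) by auto

lemma orient_open_segment_neg:
  assumes "z \<in> open_segment x y" "orient a b x \<le> 0" "orient a b y < 0"
  shows "orient a b z < 0"
  using orient_open_segment_le[OF assms(1,2)] assms(3) by force

text \<open>Points of the hull of Q strictly beyond the line are covered only by triangles of Q. A
  point on the line is a limit of such points along the segment to y, and a finite union of
  triangles is closed. The separating line is a parameter, so that both chains are
  instances.\<close>

lemma part_dissection:
  assumes T: "T \<in> dissections p i j" and Q: "Q \<subseteq> P" and ab: "\<And>x. x \<in> convex hull Q \<Longrightarrow> orient a b x \<le> 0"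
    and y: "y \<in> Q" "orient a b y < 0"
    and other: "\<And>s x. s \<in> T \<Longrightarrow> \<not> s \<subseteq> Q \<Longrightarrow> x \<in> convex hull s \<Longrightarrow> 0 \<le> orient a b x"
  shows "triangle_dissection Q {s \<in> T. s \<subseteq> Q}"
proof (rule triangle_dissectionI)
  define C where "C = (\<Union>t\<in>{s \<in> T. s \<subseteq> Q}. convex hull t)"
  have "finite (Pow P)" by simp
  moreover have "T \<subseteq> Pow P" using dissectionsD(1)[OF T] by blast
  ultimately have finT: "finite T" by (rule rev_finite_subset)
  have "closed (convex hull t)" if "t \<in> T" for t
    using dissectionsD(2)[OF T that]
    by (intro compact_imp_closed finite_imp_compact_convex_hull card_ge_0_finite) simp
  then have C: "closed C" unfolding C_def using finT by (intro closed_UN) auto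
  have neg: "x \<in> C" if "x \<in> convex hull Q" "orient a b x < 0" for x
  proof -
    have "x \<in> convex hull P" using that(1) hull_mono[OF Q] by blast
    moreover have "j \<noteq> Suc i" using im mj by simp
    ultimately obtain s where s: "s \<in> T" "x \<in> convex hull s"
      using dissections_cover[OF T] by blast
    then have "s \<subseteq> Q" using other[OF s(1) _ s(2)] that(2) by force
    then show ?thesis using s by (auto simp: C_def)
  qed
  have "convex hull Q \<subseteq> C"
  proof
    fix x assume x: "x \<in> convex hull Q"
    show "x \<in> C"
    proof (cases "orient a b x < 0")
      case False
      have "open_segment x y \<subseteq> C"
      proof
        fix z assume z: "z \<in> open_segment x y"
        then have "z \<in> convex hull Q"
          using closed_segment_subset_convex_hull[OF x hull_inc[OF y(1)]] segment_open_subset_closed by blast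
        then show "z \<in> C" using neg orient_open_segment_neg[OF z ab[OF x] y(2)] by blast
      qed
      then show ?thesis using in_closed_if_open_segment_subset[OF C] False y(2) by blast
    qed (rule neg[OF x])
  qed
  moreover have "C \<subseteq> convex hull Q" unfolding C_def by (intro UN_least hull_mono) simp
  ultimately show "(\<Union>t\<in>{s \<in> T. s \<subseteq> Q}. convex hull t) = convex hull Q" by (simp add: C_def)
  show "t \<subseteq> Q \<and> card t = 3 \<and> \<not> collinear t" if "t \<in> {s \<in> T. s \<subseteq> Q}" for t
    using that dissectionsD(2,3)[OF T] by simp
  show "interior (convex hull t) \<inter> interior (convex hull t') = {}"
    if "t \<in> {s \<in> T. s \<subseteq> Q}" "t' \<in> {s \<in> T. s \<subseteq> Q}" "t \<noteq> t'" for t t'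
    using dissectionsD(4)[OF T _ _ that(3)] that(1,2) by simp
  show "open_segment c d \<inter> open_segment e f = {}"
    if "t \<in> {s \<in> T. s \<subseteq> Q}" "t' \<in> {s \<in> T. s \<subseteq> Q}" "c \<in> t" "d \<in> t" "e \<in> t'" "f \<in> t'" "{c, d} \<noteq> {e, f}"
    for t t' c d e f
    using dissectionsD(5)[OF T _ _ that(3-7)] that(1,2) by simp
  show "open_segment c d \<inter> Q = {}" if "t \<in> {s \<in> T. s \<subseteq> Q}" "c \<in> t" "d \<in> t" for t c d
    using dissectionsD(6)[OF T _ that(2,3)] that(1) Q by blast
qed

text \<open>The line im, respectively mj, separates the chain from all triangles outside it. A chain
  of two points is treated apart, because no triangle fits into it.\<close>

lemma parts_of_dissection:
  assumes T: "T \<in> dissections p i j" and "\<Delta> \<in> T"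
  shows "{s \<in> T. s \<subseteq> L} \<in> dissections p i m" "{s \<in> T. s \<subseteq> R} \<in> dissections p m j"
    and "insert \<Delta> ({s \<in> T. s \<subseteq> L} \<union> {s \<in> T. s \<subseteq> R}) = T"
proof -
  note cases = dissection_triangle_cases[OF assms]
  show "insert \<Delta> ({s \<in> T. s \<subseteq> L} \<union> {s \<in> T. s \<subseteq> R}) = T"
    using cases assms(2) by blast
  note f = free_of_triangle[OF assms]
  have small: "{s \<in> T. s \<subseteq> {x, y}} = {}" for x y
  proof -
    have False if "s \<in> T" "s \<subseteq> {x, y}" for s
    proof -
      have "card s \<le> card {x, y}" by (rule card_mono) (use that in auto)
      also have "\<dots> \<le> 2" by (simp add: card_insert_if)
      finally show False using dissectionsD(2)[OF T that(1)] by simp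
    qed
    then show ?thesis by blast
  qed
  show "{s \<in> T. s \<subseteq> L} \<in> dissections p i m"
  proof (cases "m = Suc i")
    case True
    then have "{i..m} = {i, m}" by auto
    then have "L = {p i, p m}" by simp
    then show ?thesis using small True by (simp add: dissections_def)
  next
    case False
    then have Si: "Suc i < m" using im by simp
    have "triangle_dissection L {s \<in> T. s \<subseteq> L}"
    proof (rule part_dissection[OF T _ L_hull(1)])
      show "L \<subseteq> P" using P_eq by simp
      show "p (Suc i) \<in> L" using Si by auto
      show "orient (p i) (p m) (p (Suc i)) < 0"
        using strict_left[OF f(1) _ Si] orient_swap(2)[of "p i" "p (Suc i)" "p m"] by simp
      show "0 \<le> orient (p i) (p m) x" if "s \<in> T" "\<not> s \<subseteq> L" "x \<in> convex hull s" for s x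
      proof (cases "s = \<Delta>")
        case True
        then show ?thesis using \<Delta>_hull(1) that(3) by simp
      next
        case False
        then have "s \<subseteq> R" using cases that by blast
        then show ?thesis using R_hull(1) that(3) hull_mono by blast
      qed
    qed
    then show ?thesis using False by (simp add: dissections_def)
  qed
  show "{s \<in> T. s \<subseteq> R} \<in> dissections p m j"
  proof (cases "j = Suc m")
    case True
    then have "{m..j} = {m, j}" by auto
    then have "R = {p m, p j}" by simp
    then show ?thesis using small True by (simp add: dissections_def)
  next
    case False
    then have Sm: "Suc m < j" using mj by simp
    have "triangle_dissection R {s \<in> T. s \<subseteq> R}"
    proof (rule part_dissection[OF T _ R_hull(2)])
      show "R \<subseteq> P" using P_eq by simp
      show "p (Suc m) \<in> R" using Sm by auto
      show "orient (p m) (p j) (p (Suc m)) < 0"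
        using strict_right[OF f(2) _ Sm] orient_swap(2)[of "p m" "p (Suc m)" "p j"] by simp
      show "0 \<le> orient (p m) (p j) x" if "s \<in> T" "\<not> s \<subseteq> R" "x \<in> convex hull s" for s x
      proof (cases "s = \<Delta>")
        case True
        then show ?thesis using \<Delta>_hull(2) that(3) by simp
      next
        case False
        then have "s \<subseteq> L" using cases that by blast
        then show ?thesis using L_hull(2) that(3) hull_mono by blast
      qed
    qed
    then show ?thesis using False by (simp add: dissections_def)
  qed
qed

end

section \<open>Recursive count of dissections\<close>

context weakly_convex
begin

lemma finite_dissections: "finite (dissections p i j)"
proof (cases "j = Suc i")
  case False
  then have "dissections p i j \<subseteq> Pow (Pow (p ` {i..j}))"
    using dissectionsD(1)[of _ p i j] by blast
  then show ?thesis by (rule finite_subset) simp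
qed (simp add: dissections_def)

text \<open>An apex together with dissections of the two chains that it cuts off corresponds
  bijectively to a dissection: one triangle sits on the base, and gluing inverts cutting. Only
  apexes off the base line occur.\<close>

lemma card_dissections:
  assumes ij: "Suc i < j" and jN: "j < N"
  shows "card (dissections p i j) =
    (\<Sum>m | i < m \<and> m < j \<and> 0 < orient (p i) (p m) (p j). card (dissections p i m) * card (dissections p m j))"
proof -
  define M where "M = {m. i < m \<and> m < j \<and> 0 < orient (p i) (p m) (p j)}"
  have split: "weakly_convex_split p N i m j" if "m \<in> M" for m
    using that jN weakly_convex_axioms
    by (simp add: M_def weakly_convex_split_def weakly_convex_split_axioms_def)
  define D where "D = (SIGMA m:M. dissections p i m \<times> dissections p m j)"
  define f where "f = (\<lambda>(m, A, B). insert {p i, p m, p j} (A \<union> B))"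
  have f_in: "f (m, A, B) \<in> dissections p i j"
    if "m \<in> M" "A \<in> dissections p i m" "B \<in> dissections p m j" for m A B
    using weakly_convex_split.dissection_of_parts(1)[OF split[OF that(1)] that(2,3)] by (simp add: f_def)
  have "inj_on f D"
  proof (rule inj_onI)
    fix x y assume x: "x \<in> D" and y: "y \<in> D" and eq: "f x = f y"
    obtain m A B where X: "x = (m, A, B)" by (cases x) auto
    obtain m' A' B' where Y: "y = (m', A', B')" by (cases y) auto
    note m = x[unfolded X D_def] and m' = y[unfolded Y D_def]
    interpret s: weakly_convex_split p N i m j using split m by auto
    interpret s': weakly_convex_split p N i m' j using split m' by auto
    \<comment> \<open>Two different triangles on the base cannot belong to one dissection: the
      second would have to lie in one of the two chains, but it contains both ends of the
      base.\<close>
    have "m = m'"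
    proof (rule ccontr)
      assume "m \<noteq> m'"
      have T: "f x \<in> dissections p i j" using f_in m X by auto
      have 1: "{p i, p m, p j} \<in> f x" by (simp add: f_def X)
      have 2: "{p i, p m', p j} \<in> f x" by (simp add: eq) (simp add: f_def Y)
      have "m < N" "m' < N" "i < N" using s.mj s'.mj s.im jN by auto
      then have "{p i, p m', p j} \<noteq> {p i, p m, p j}"
        using \<open>m \<noteq> m'\<close> s.im s.mj s'.im s'.mj jN neq
        by (metis insertI1 insertI2 insertE singletonD less_irrefl)
      then have "{p i, p m', p j} \<subseteq> p ` {i..m} \<or> {p i, p m', p j} \<subseteq> p ` {m..j}"
        by (rule s.dissection_triangle_cases[OF T 1 2])
      moreover have "p j \<notin> p ` {i..m}" "p i \<notin> p ` {m..j}"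
        using s.im s.mj jN by (auto simp: neq)
      ultimately show False by simp
    qed
    have "A = {s \<in> f x. s \<subseteq> p ` {i..m}}" "B = {s \<in> f x. s \<subseteq> p ` {m..j}}"
      using s.dissection_of_parts(2,3)[of A B] m by (simp_all add: f_def X)
    moreover have "A' = {s \<in> f x. s \<subseteq> p ` {i..m}}" "B' = {s \<in> f x. s \<subseteq> p ` {m..j}}"
      using s'.dissection_of_parts(2,3)[of A' B'] m' unfolding eq \<open>m = m'\<close> by (simp_all add: f_def Y)
    ultimately have "A = A'" "B = B'" by simp_all
    then show "x = y" using \<open>m = m'\<close> X Y by simp
  qed
  moreover have "f ` D = dissections p i j"
  proof
    show "f ` D \<subseteq> dissections p i j" using f_in by (auto simp: D_def)
    show "dissections p i j \<subseteq> f ` D"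
    proof
      fix T assume T: "T \<in> dissections p i j"
      obtain m where m: "i < m" "m < j" "0 < orient (p i) (p m) (p j)" "{p i, p m, p j} \<in> T"
        using edge_triangle[OF T ij jN] .
      then have M: "m \<in> M" by (simp add: M_def)
      note parts = weakly_convex_split.parts_of_dissection[OF split[OF M] T m(4)]
      have "T = f (m, {s \<in> T. s \<subseteq> p ` {i..m}}, {s \<in> T. s \<subseteq> p ` {m..j}})"
        using parts(3) by (simp add: f_def)
      moreover have "(m, {s \<in> T. s \<subseteq> p ` {i..m}}, {s \<in> T. s \<subseteq> p ` {m..j}}) \<in> D"
        using parts M by (simp add: D_def)
      ultimately show "T \<in> f ` D" by (rule image_eqI)
    qed
  qed
  ultimately have "card (dissections p i j) = card D" using card_image by metis
  also have "\<dots> = (\<Sum>m\<in>M. card (dissections p i m \<times> dissections p m j))"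
    unfolding D_def using finite_dissections by (intro card_SigmaI) (auto simp: M_def)
  finally show ?thesis by (simp add: card_cartesian_product M_def)
qed

end

section \<open>Catalan numbers and the dissection recursion\<close>

text \<open>Defined by the ratio of consecutive values, because the convolution identity and the
  moment integrals are both proved from this two-term recurrence.\<close>

primrec catalan :: "nat \<Rightarrow> real" where
  "catalan 0 = 1"
| "catalan (Suc n) = 2 * (2 * real n + 1) / (real n + 2) * catalan n"

lemma catalan_Suc: "(real n + 2) * catalan (Suc n) = 2 * (2 * real n + 1) * catalan n"
  by (simp add: field_simps)

declare catalan.simps(2) [simp del]

lemma sum_rev: "(\<Sum>i\<le>n. f (n - i)) = (\<Sum>i\<le>(n::nat). f i :: real)"
  by (rule sum.reindex_bij_witness[of _ "\<lambda>i. n - i" "\<lambda>i. n - i"]) auto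

text \<open>
  Summing the two-term recurrence of the Catalan numbers against the convolution turns it into a
  first-order recurrence for the convolution itself, by the symmetry \<open>i \<mapsto> n - i\<close>.
\<close>
lemma catalan_convolution: "(\<Sum>i\<le>n. catalan i * catalan (n - i)) = catalan (Suc n)"
proof (induction n)
  case (Suc n)
  define S where "S = (\<lambda>n. \<Sum>i\<le>n. catalan i * catalan (n - i))"
  define T where "T = (\<lambda>n. \<Sum>i\<le>n. real i * (catalan i * catalan (n - i)))"
  have T: "2 * T n = real n * S n" for n
  proof -
    have "T n = (\<Sum>i\<le>n. real (n - i) * (catalan (n - i) * catalan (n - (n - i))))"
      unfolding T_def by (rule sum_rev[symmetric])
    also have "\<dots> = (\<Sum>i\<le>n. (real n - real i) * (catalan i * catalan (n - i)))"
      by (intro sum.cong) (auto simp: of_nat_diff)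
    also have "\<dots> = real n * S n - T n"
      by (simp add: S_def T_def algebra_simps sum_subtractf sum_distrib_left)
    finally show ?thesis by simp
  qed
  have "(2 * real n + 2) * S n = 4 * T n + 2 * S n" using T[of n] by (simp add: algebra_simps)
  also have "\<dots> = (\<Sum>i\<le>n. 2 * (2 * real i + 1) * catalan i * catalan (n - i))"
    by (simp add: S_def T_def sum_distrib_left sum.distrib algebra_simps)
  also have "\<dots> = (\<Sum>i\<le>n. (real (Suc i) + 1) * catalan (Suc i) * catalan (n - i))"
    using catalan_Suc by (intro sum.cong) (auto simp: algebra_simps)
  also have "\<dots> = (\<Sum>i\<le>Suc n. (real i + 1) * catalan i * catalan (Suc n - i)) - catalan (Suc n)"
    by (subst sum.atMost_Suc_shift) simp
  also have "(\<Sum>i\<le>Suc n. (real i + 1) * catalan i * catalan (Suc n - i)) = T (Suc n) + S (Suc n)"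
    unfolding S_def T_def sum.distrib[symmetric] by (intro sum.cong) (auto simp: algebra_simps)
  finally have "(2 * real n + 2) * S n = T (Suc n) + S (Suc n) - catalan (Suc n)" .
  moreover have "S n = catalan (Suc n)" using Suc by (simp add: S_def)
  ultimately have "(real n + 3) * S (Suc n) = 2 * ((2 * real n + 3) * catalan (Suc n))"
    using T[of "Suc n"] by (simp add: algebra_simps)
  also have "\<dots> = (real n + 3) * catalan (Suc (Suc n))"
    using catalan_Suc[of "Suc n"] by (simp add: algebra_simps)
  finally show ?case by (simp add: S_def)
qed (simp add: catalan.simps(2))

text \<open>
  \<open>chain_coeff fl i d n\<close> is the coefficient of \<open>x\<^sup>n\<close> in \<open>\<Sum>S. (-1)\<^sup>|S| x\<^bsup>d - |S|\<^esup>\<close>,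
  where \<open>S\<close> runs through the sets of flat points strictly between \<open>i\<close> and \<open>i + d\<close> of which no two
  are adjacent: by inclusion-exclusion, \<open>S\<close> is a set of tips of forbidden degenerate ears.
\<close>
fun chain_coeff :: "(nat \<Rightarrow> bool) \<Rightarrow> nat \<Rightarrow> nat \<Rightarrow> nat \<Rightarrow> real" where
  "chain_coeff fl i 0 n = of_bool (n = 0)"
| "chain_coeff fl i (Suc 0) n = of_bool (n = 1)"
| "chain_coeff fl i (Suc (Suc d)) 0 = 0"
| "chain_coeff fl i (Suc (Suc d)) (Suc n) =
     chain_coeff fl i (Suc d) n - of_bool (fl (i + Suc d)) * chain_coeff fl i d n"

lemma chain_coeff_0 [simp]: "0 < d \<Longrightarrow> chain_coeff fl i d 0 = 0"
  by (cases "(fl, i, d, 0 :: nat)" rule: chain_coeff.cases) auto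

lemma chain_coeff_0_Suc [simp]: "chain_coeff fl i d (Suc 0) = (if d = 1 then 1 else if d = 2 then - of_bool (fl (Suc i)) else 0)"
  by (cases "(fl, i, d, Suc 0)" rule: chain_coeff.cases) (auto simp: numeral_2_eq_2 elim: less_SucE)

lemma chain_coeff_eq_0: "d < n \<Longrightarrow> chain_coeff fl i d n = 0"
  by (induction fl i d n rule: chain_coeff.induct) auto

text \<open>The coefficient is a signed count of walks from i to i + d in n steps of length 1 or 2,
  where a step of length 2 must skip a flat point and carries the sign -1. A walk of a + b steps is
  cut after step a, at i + e. The induction removes the last step.\<close>

lemma chain_coeff_convolution:
  assumes "0 < a" "0 < b" "0 < d"
  shows "(\<Sum>e\<in>{0<..<d}. chain_coeff fl i e a * chain_coeff fl (i + e) (d - e) b) = chain_coeff fl i d (a + b)"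
  using assms(2,3)
proof (induction d arbitrary: b rule: less_induct)
  case (less d)
  show ?case
  proof (cases "d = 1")
    case True
    then have "{0<..<d} = {}" by auto
    then show ?thesis using True less.prems assms(1) by simp
  next
    case False
    then obtain d' where d: "d = Suc (Suc d')" using less.prems by (metis One_nat_def old.nat.exhaust less_numeral_extra(3))
    obtain b' where b: "b = Suc b'" using less.prems by (cases b) auto
    let ?c = "chain_coeff fl"
    define F :: real where "F = of_bool (fl (i + Suc d'))"
    have split: "{0<..<d} = insert (Suc d') {0<..<Suc d'}" by (auto simp: d)
    have "(\<Sum>e\<in>{0<..<d}. ?c i e a * ?c (i + e) (d - e) b) =
        ?c i (Suc d') a * of_bool (b' = 0) + (\<Sum>e\<in>{0<..<Suc d'}. ?c i e a * ?c (i + e) (d - e) b)"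
      unfolding split by (simp add: d b)
    also have "(\<Sum>e\<in>{0<..<Suc d'}. ?c i e a * ?c (i + e) (d - e) b) =
       (\<Sum>e\<in>{0<..<Suc d'}. ?c i e a * (?c (i + e) (Suc d' - e) b' - F * ?c (i + e) (d' - e) b'))"
    proof (intro sum.cong refl arg_cong2[of _ _ _ _ "(*)"])
      fix e assume "e \<in> {0<..<Suc d'}"
      then obtain q where q: "d' = e + q" using le_Suc_ex[of e d'] by auto
      have 1: "d - e = Suc (Suc q)" "Suc d' - e = Suc q" "d' - e = q" using q d by auto
      show "?c (i + e) (d - e) b = ?c (i + e) (Suc d' - e) b' - F * ?c (i + e) (d' - e) b'"
        unfolding 1 by (simp add: b F_def q add.assoc)
    qed
    also have "\<dots> = (\<Sum>e\<in>{0<..<Suc d'}. ?c i e a * ?c (i + e) (Suc d' - e) b')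
        - F * (\<Sum>e\<in>{0<..<Suc d'}. ?c i e a * ?c (i + e) (d' - e) b')"
      by (simp add: algebra_simps sum_subtractf sum_distrib_left)
    also have "(\<Sum>e\<in>{0<..<Suc d'}. ?c i e a * ?c (i + e) (d' - e) b')
       = ?c i d' a * of_bool (b' = 0) + (\<Sum>e\<in>{0<..<d'}. ?c i e a * ?c (i + e) (d' - e) b')"
    proof (cases d')
      case 0
      then have "{0<..<Suc d'} = {}" by auto
      then show ?thesis using assms(1) 0 by simp
    next
      case (Suc q)
      then have "{0<..<Suc d'} = insert d' {0<..<d'}" by auto
      then show ?thesis by simp
    qed
    finally have eq: "(\<Sum>e\<in>{0<..<d}. ?c i e a * ?c (i + e) (d - e) b) =
        ?c i (Suc d') a * of_bool (b' = 0) + ((\<Sum>e\<in>{0<..<Suc d'}. ?c i e a * ?c (i + e) (Suc d' - e) b')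
        - F * (?c i d' a * of_bool (b' = 0) + (\<Sum>e\<in>{0<..<d'}. ?c i e a * ?c (i + e) (d' - e) b')))" .
    show ?thesis
    proof (cases "b' = 0")
      case True
      then have "(\<Sum>e\<in>{0<..<Suc d'}. ?c i e a * ?c (i + e) (Suc d' - e) b') = 0"
        "(\<Sum>e\<in>{0<..<d'}. ?c i e a * ?c (i + e) (d' - e) b') = 0"
        by (auto intro!: sum.neutral)
      then show ?thesis unfolding eq using True by (simp add: d b F_def)
    next
      case False
      have 1: "(\<Sum>e\<in>{0<..<Suc d'}. ?c i e a * ?c (i + e) (Suc d' - e) b') = ?c i (Suc d') (a + b')"
        using False by (intro less.IH) (auto simp: d)
      have 2: "(\<Sum>e\<in>{0<..<d'}. ?c i e a * ?c (i + e) (d' - e) b') = ?c i d' (a + b')"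
        using False assms(1) less.IH[of d' b'] by (cases "d' = 0") (auto simp: d)
      show ?thesis unfolding eq 1 2 using False by (simp add: d b F_def)
    qed
  qed
qed

text \<open>The n steps of a walk and the base bound a polygon with n + 1 corners, which has
  \<open>catalan (n - 1)\<close> triangulations. The truncated difference at n = 0 matters only for
  d = 0.\<close>

definition chain_count :: "(nat \<Rightarrow> bool) \<Rightarrow> nat \<Rightarrow> nat \<Rightarrow> real" where
  "chain_count fl i d = (\<Sum>n\<le>d. chain_coeff fl i d n * catalan (n - 1))"

lemma chain_count_eq:
  assumes "0 < d" "d \<le> D"
  shows "chain_count fl i d = (\<Sum>a<D. chain_coeff fl i d (Suc a) * catalan a)"
proof -
  have "chain_count fl i d = (\<Sum>n\<le>D. chain_coeff fl i d n * catalan (n - 1))"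
    unfolding chain_count_def using assms(2) by (intro sum.mono_neutral_left) (auto simp: chain_coeff_eq_0)
  also have "\<dots> = (\<Sum>n<Suc D. chain_coeff fl i d n * catalan (n - 1))" by (simp add: lessThan_Suc_atMost)
  also have "\<dots> = (\<Sum>a<D. chain_coeff fl i d (Suc a) * catalan a)"
    using assms(1) by (subst sum.lessThan_Suc_shift) simp
  finally show ?thesis .
qed

lemma chain_count_1 [simp]: "chain_count fl i (Suc 0) = 1"
  by (simp add: chain_count_def)

text \<open>The recursion of the dissections, but summed over all apexes, degenerate or not. The
  defect is the coefficient of x, which is 1 for a single edge, -1 for a flat ear of two edges and 0
  otherwise: it supplies the initial value and removes the degenerate ear.\<close>

lemma chain_count_rec:
  assumes "0 < d"
  shows "(\<Sum>e\<in>{0<..<d}. chain_count fl i e * chain_count fl (i + e) (d - e))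
    = chain_count fl i d - chain_coeff fl i d 1"
proof -
  let ?c = "chain_coeff fl"
  have "(\<Sum>e\<in>{0<..<d}. chain_count fl i e * chain_count fl (i + e) (d - e))
     = (\<Sum>e\<in>{0<..<d}. \<Sum>a<d. \<Sum>b<d. ?c i e (Suc a) * catalan a * (?c (i + e) (d - e) (Suc b) * catalan b))"
    by (intro sum.cong refl) (simp add: chain_count_eq[where D = d] sum_product)
  also have "\<dots> = (\<Sum>a<d. \<Sum>b<d. \<Sum>e\<in>{0<..<d}. ?c i e (Suc a) * catalan a * (?c (i + e) (d - e) (Suc b) * catalan b))"
    unfolding sum.swap[of _ _ "{0<..<d}"] ..
  also have "\<dots> = (\<Sum>a<d. \<Sum>b<d. ?c i d (Suc (Suc (a + b))) * (catalan a * catalan b))"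
  proof (intro sum.cong refl)
    fix a b
    have "(\<Sum>e\<in>{0<..<d}. ?c i e (Suc a) * catalan a * (?c (i + e) (d - e) (Suc b) * catalan b))
      = (\<Sum>e\<in>{0<..<d}. ?c i e (Suc a) * ?c (i + e) (d - e) (Suc b)) * (catalan a * catalan b)"
      unfolding sum_distrib_right by (simp add: mult_ac)
    then show "(\<Sum>e\<in>{0<..<d}. ?c i e (Suc a) * catalan a * (?c (i + e) (d - e) (Suc b) * catalan b))
      = ?c i d (Suc (Suc (a + b))) * (catalan a * catalan b)"
      using chain_coeff_convolution[of "Suc a" "Suc b" d fl i] assms by simp
  qed
  also have "\<dots> = (\<Sum>(a, b)\<in>{..<d} \<times> {..<d}. ?c i d (Suc (Suc (a + b))) * (catalan a * catalan b))"
    by (rule sum.cartesian_product)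
  \<comment> \<open>Terms with a + b \<ge> d vanish, since a walk has no more steps than edges; the
    rest is summed along a + b = n, where the Catalan convolution applies.\<close>
  also have "\<dots> = (\<Sum>(a, b)\<in>{(a, b). a + b < d}. ?c i d (Suc (Suc (a + b))) * (catalan a * catalan b))"
  proof (rule sum.mono_neutral_right)
    show "\<forall>x\<in>{..<d} \<times> {..<d} - {(a, b). a + b < d}.
        (case x of (a, b) \<Rightarrow> ?c i d (Suc (Suc (a + b))) * (catalan a * catalan b)) = 0"
    proof
      fix x assume x: "x \<in> {..<d} \<times> {..<d} - {(a, b). a + b < d}"
      obtain a b where ab: "x = (a, b)" by (cases x)
      then have "?c i d (Suc (Suc (a + b))) = 0" using x by (intro chain_coeff_eq_0) auto
      then show "(case x of (a, b) \<Rightarrow> ?c i d (Suc (Suc (a + b))) * (catalan a * catalan b)) = 0"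
        by (simp add: ab)
    qed
  qed auto
  also have "\<dots> = (\<Sum>n<d. \<Sum>a\<le>n. ?c i d (Suc (Suc (a + (n - a)))) * (catalan a * catalan (n - a)))"
    by (rule sum.triangle_reindex)
  also have "\<dots> = (\<Sum>n<d. ?c i d (Suc (Suc n)) * catalan (Suc n))"
    unfolding catalan_convolution[symmetric] by (intro sum.cong refl) (simp add: sum_distrib_left)
  also have "\<dots> = (\<Sum>n<Suc d. ?c i d (Suc n) * catalan n) - ?c i d 1"
    by (subst sum.lessThan_Suc_shift) simp
  also have "(\<Sum>n<Suc d. ?c i d (Suc n) * catalan n) = chain_count fl i d"
    using assms by (intro chain_count_eq[symmetric]) auto
  finally show ?thesis .
qed

text \<open>A split of a flat chain of more than two edges always leaves a flat part of at least two
  edges, and for two edges the defect cancels the single split. Hence the degenerate apexes in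
  \<open>chain_count_rec\<close> cost nothing beyond the defect.\<close>

lemma chain_count_flat:
  assumes "2 \<le> d" "\<And>e. 0 < e \<Longrightarrow> e < d \<Longrightarrow> fl (i + e)"
  shows "chain_count fl i d = 0"
  using assms
proof (induction d arbitrary: i rule: less_induct)
  case (less d)
  have "(\<Sum>e\<in>{0<..<d}. chain_count fl i e * chain_count fl (i + e) (d - e)) = - chain_coeff fl i d 1"
  proof (cases "d = 2")
    case True
    then have "{0<..<d} = {1}" by auto
    then show ?thesis using less.prems(2)[of 1] True by simp
  next
    case False
    have "chain_count fl i e * chain_count fl (i + e) (d - e) = 0" if "e \<in> {0<..<d}" for e
    proof (cases "e = 1")
      case True
      have "chain_count fl (i + e) (d - e) = 0"
        using that False less.prems True less.prems(2)[of "_ + 1"] by (intro less.IH) auto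
      then show ?thesis by simp
    next
      case False
      then have "chain_count fl i e = 0"
        using that less.prems by (intro less.IH) auto
      then show ?thesis by simp
    qed
    then have "(\<Sum>e\<in>{0<..<d}. chain_count fl i e * chain_count fl (i + e) (d - e)) = 0"
      by (rule sum.neutral[OF ballI])
    then show ?thesis using False less.prems(1) by simp
  qed
  then show ?case using chain_count_rec[of d fl i] less.prems(1) by simp
qed

section \<open>Generating polynomials of chains and sides\<close>

definition chain_poly :: "(nat \<Rightarrow> bool) \<Rightarrow> nat \<Rightarrow> real \<Rightarrow> real" where
  "chain_poly fl d x = (\<Sum>n\<le>d. chain_coeff fl 0 d n * x ^ n)"

lemma chain_poly_eq: "d \<le> D \<Longrightarrow> chain_poly fl d x = (\<Sum>n\<le>D. chain_coeff fl 0 d n * x ^ n)"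
  unfolding chain_poly_def by (intro sum.mono_neutral_left) (auto simp: chain_coeff_eq_0)

lemma chain_poly_simps:
  "chain_poly fl 0 x = 1" "chain_poly fl (Suc 0) x = x"
  "chain_poly fl (Suc (Suc d)) x = x * chain_poly fl (Suc d) x - of_bool (fl (Suc d)) * x * chain_poly fl d x"
proof -
  show "chain_poly fl 0 x = 1" "chain_poly fl (Suc 0) x = x" by (simp_all add: chain_poly_def)
  have "chain_poly fl (Suc (Suc d)) x = (\<Sum>n\<le>Suc d. chain_coeff fl 0 (Suc (Suc d)) (Suc n) * x ^ Suc n)"
    unfolding chain_poly_def by (subst sum.atMost_Suc_shift) simp
  also have "\<dots> = x * (\<Sum>n\<le>Suc d. chain_coeff fl 0 (Suc d) n * x ^ n)
      - of_bool (fl (Suc d)) * x * (\<Sum>n\<le>Suc d. chain_coeff fl 0 d n * x ^ n)"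
    by (simp add: sum_distrib_left sum_subtractf[symmetric] algebra_simps del: sum.atMost_Suc)
  finally show "chain_poly fl (Suc (Suc d)) x = x * chain_poly fl (Suc d) x - of_bool (fl (Suc d)) * x * chain_poly fl d x"
    using chain_poly_eq[of d "Suc d" fl x] chain_poly_eq[of "Suc d" "Suc d" fl x] by simp
qed

text \<open>In terms of the Chebyshev polynomials of the second kind, the value at 4 c^2 is (2 c)^t
  U_t(c).\<close>

fun side_poly :: "nat \<Rightarrow> real \<Rightarrow> real" where
  "side_poly 0 x = 1"
| "side_poly (Suc 0) x = x"
| "side_poly (Suc (Suc t)) x = x * side_poly (Suc t) x - x * side_poly t x"

text \<open>At a corner the negative term of the recursion is absent, so it starts afresh with a
  factor x: the polynomial is multiplicative over the sides. Letting t run up to r itself makes the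
  end of one side the start of the next.\<close>

lemma chain_poly_sides:
  assumes r: "2 \<le> r" and "t \<le> r"
  shows "chain_poly (\<lambda>x. \<not> r dvd x) (s * r + t) x = side_poly r x ^ s * side_poly t x"
  using assms(2)
proof (induction s arbitrary: t x)
  case 0
  then show ?case
  proof (induction t x rule: side_poly.induct)
    case (3 t x)
    then have "\<not> r dvd Suc t" by (auto dest: dvd_imp_le)
    then show ?case using 3 by (simp add: chain_poly_simps)
  qed (simp_all add: chain_poly_simps)
next
  case (Suc s)
  obtain q where q: "r = Suc q" using r by (cases r) auto
  have base: "chain_poly (\<lambda>x. \<not> r dvd x) (Suc s * r) x = side_poly r x ^ Suc s" for x
    using Suc.IH[of r x] by (simp add: add.commute mult.commute)
  from Suc.prems show ?case
  proof (induction t x rule: side_poly.induct)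
    case (1 x)
    then show ?case using base by simp
  next
    case (2 x)
    have 1: "Suc s * r + Suc 0 = Suc (Suc (q + s * r))" "Suc (q + s * r) = Suc s * r" by (simp_all add: q)
    have "r dvd Suc (q + s * r)" unfolding 1(2) by simp
    moreover have "chain_poly (\<lambda>x. \<not> r dvd x) (Suc (q + s * r)) x = side_poly r x ^ Suc s"
      unfolding 1(2) by (rule base)
    ultimately show ?case unfolding 1(1) chain_poly_simps(3) by simp
  next
    case (3 t x)
    have 1: "Suc s * r + Suc (Suc t) = Suc (Suc (Suc s * r + t))" by simp
    have "\<not> r dvd Suc t" using 3 by (auto dest: dvd_imp_le)
    then have "\<not> r dvd Suc (Suc s * r + t)"
      by (metis add_Suc_right dvd_add_right_iff dvd_triv_right)
    then show ?case unfolding 1 chain_poly_simps(3) using 3 by (simp add: algebra_simps)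
  qed
qed

text \<open>In the intended instance \<open>fl\<close> marks the points inside the sides and K is
  the last corner. All points strictly between the extremes of a degenerate triple are flat, except
  for triples from 0 to a point beyond K: the last side ends in point 0.\<close>

locale flat_weakly_convex = weakly_convex +
  fixes fl :: "nat \<Rightarrow> bool" and K :: nat
  assumes between_flat: "\<And>a b c x. a < b \<Longrightarrow> b < c \<Longrightarrow> c < N \<Longrightarrow> 0 < a \<or> c \<le> K \<Longrightarrow>
      orient (p a) (p b) (p c) = 0 \<Longrightarrow> a < x \<Longrightarrow> x < c \<Longrightarrow> fl x"
    and flat_collinear: "\<And>a. Suc (Suc a) < N \<Longrightarrow> fl (Suc a) \<Longrightarrow> orient (p a) (p (Suc a)) (p (Suc (Suc a))) = 0"
begin

text \<open>For a degenerate apex all inner points of the chain are flat, so one of the two parts is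
  a flat chain of at least two edges and the product vanishes; the sum may be extended to all
  apexes. The chain of two edges, where both parts are single edges, is computed directly.\<close>

lemma card_dissections_chain_count:
  assumes "0 < d" "i + d < N" "0 < i \<or> i + d \<le> K"
  shows "real (card (dissections p i (i + d))) = chain_count fl i d"
  using assms
proof (induction d arbitrary: i rule: less_induct)
  case (less d)
  show ?case
  proof (cases "d = 1")
    case True
    then show ?thesis by (simp add: dissections_def)
  next
    case False
    define E where "E = {e. 0 < e \<and> e < d \<and> 0 < orient (p i) (p (i + e)) (p (i + d))}"
    have "real (card (dissections p i (i + d))) = (\<Sum>m | i < m \<and> m < i + d \<and> 0 < orient (p i) (p m) (p (i + d)).
        real (card (dissections p i m)) * real (card (dissections p m (i + d))))"
      using less.prems False by (subst card_dissections) auto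
    also have "\<dots> = (\<Sum>e\<in>E. real (card (dissections p i (i + e))) * real (card (dissections p (i + e) (i + e + (d - e)))))"
      by (rule sum.reindex_bij_witness[of _ "\<lambda>e. i + e" "\<lambda>m. m - i"]) (auto simp: E_def add.commute[of d i])
    also have "\<dots> = (\<Sum>e\<in>E. chain_count fl i e * chain_count fl (i + e) (d - e))"
      using less.prems by (intro sum.cong refl arg_cong2[of _ _ _ _ "(*)"] less.IH) (auto simp: E_def)
    finally have eq: "real (card (dissections p i (i + d))) = (\<Sum>e\<in>E. chain_count fl i e * chain_count fl (i + e) (d - e))" .
    have flat: "fl (i + x)" if "e \<in> {0<..<d} - E" "0 < x" "x < d" for e x
    proof -
      have "0 \<le> orient (p i) (p (i + e)) (p (i + d))"
        using that less.prems by (intro pos) auto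
      then have "orient (p i) (p (i + e)) (p (i + d)) = 0" using that by (auto simp: E_def)
      then show ?thesis using between_flat[of i "i + e" "i + d" "i + x"] that less.prems by auto
    qed
    show ?thesis
    proof (cases "d = 2")
      case True
      have 1: "{0<..<d} = {1}" "i + d = Suc (Suc i)" using True by auto
      have rec: "chain_count fl i d = 1 - of_bool (fl (Suc i))"
        using chain_count_rec[of d fl i] 1(1) True by simp
      have "E = {e \<in> {0<..<d}. 0 < orient (p i) (p (i + e)) (p (i + d))}"
        by (auto simp: E_def)
      then have E: "E = (if 0 < orient (p i) (p (Suc i)) (p (Suc (Suc i))) then {1} else {})"
        unfolding 1 by auto
      show ?thesis
      proof (cases "fl (Suc i)")
        case True
        then have "orient (p i) (p (Suc i)) (p (Suc (Suc i))) = 0"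
          using less.prems 1 by (intro flat_collinear) auto
        then have "E = {}" unfolding E by simp
        then show ?thesis unfolding eq rec using True by simp
      next
        case False
        then have "1 \<in> E" using flat[of 1 1] 1 \<open>d = 2\<close> by auto
        then have "E = {1}" using E by (auto split: if_splits)
        then show ?thesis unfolding eq rec using False by (simp add: \<open>d = 2\<close>)
      qed
    next
      case d2: False
      have "(\<Sum>e\<in>E. chain_count fl i e * chain_count fl (i + e) (d - e))
         = (\<Sum>e\<in>{0<..<d}. chain_count fl i e * chain_count fl (i + e) (d - e))"
      proof (rule sum.mono_neutral_left)
        show "\<forall>e\<in>{0<..<d} - E. chain_count fl i e * chain_count fl (i + e) (d - e) = 0"
        proof
          fix e assume e: "e \<in> {0<..<d} - E"
          show "chain_count fl i e * chain_count fl (i + e) (d - e) = 0"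
          proof (cases "e = 1")
            case True
            have "chain_count fl (i + e) (d - e) = 0"
              using flat[OF e, of "e + _"] d2 False e True by (intro chain_count_flat) (auto simp: add.assoc)
            then show ?thesis by simp
          next
            case False
            have "chain_count fl i e = 0"
              using flat[OF e] False e by (intro chain_count_flat) auto
            then show ?thesis by simp
          qed
        qed
      qed (auto simp: E_def)
      then show ?thesis using chain_count_rec[of d fl i] less.prems(1) False d2 by (simp add: eq)
    qed
  qed
qed

text \<open>The base lies on the last side, so apexes from K on are degenerate. In the unrestricted
  sum their terms vanish because the chain from the apex to the end is flat, except for the apex
  next to the end, where this chain is one edge: its term is the chain count that is
  subtracted.\<close>

lemma card_dissections_closed:
  assumes N: "Suc (Suc K) \<le> N" "4 \<le> N"
    and closing: "\<And>m. 0 < m \<Longrightarrow> Suc m < N \<Longrightarrow> orient (p 0) (p m) (p (N - 1)) = 0 \<longleftrightarrow> K \<le> m"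
    and flat: "\<And>x. K < x \<Longrightarrow> x < N \<Longrightarrow> fl x"
  shows "real (card (dissections p 0 (N - 1))) = chain_count fl 0 (N - 1) - chain_count fl 0 (N - 2)"
proof -
  define n where "n = N - 1"
  have n: "N = Suc n" "Suc K \<le> n" "3 \<le> n" using N by (auto simp: n_def)
  define c where "c = (\<lambda>e. chain_count fl 0 e * chain_count fl e (n - e))"
  have "real (card (dissections p 0 n)) = (\<Sum>m | 0 < m \<and> m < n \<and> 0 < orient (p 0) (p m) (p n).
        real (card (dissections p 0 m)) * real (card (dissections p m n)))"
    using n by (subst card_dissections) auto
  also have "{m. 0 < m \<and> m < n \<and> 0 < orient (p 0) (p m) (p n)} = {0<..<K}"
  proof -
    have "0 < orient (p 0) (p m) (p n) \<longleftrightarrow> m < K" if "0 < m" "m < n" for m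
      using closing[of m] pos[of 0 m n] that n by auto
    then show ?thesis using n by auto
  qed
  also have "(\<Sum>m\<in>{0<..<K}. real (card (dissections p 0 m)) * real (card (dissections p m n))) = (\<Sum>m\<in>{0<..<K}. c m)"
  proof (rule sum.cong[OF refl])
    fix m assume m: "m \<in> {0<..<K}"
    have "m + (n - m) = n" using m n by auto
    then show "real (card (dissections p 0 m)) * real (card (dissections p m n)) = c m"
      using card_dissections_chain_count[of m 0] card_dissections_chain_count[of "n - m" m] m n
      by (simp add: c_def)
  qed
  finally have eq: "real (card (dissections p 0 n)) = (\<Sum>m\<in>{0<..<K}. c m)" .
  have "chain_count fl 0 n = (\<Sum>m\<in>{0<..<n}. c m)"
    using chain_count_rec[of n fl 0] n by (simp add: c_def)
  also have "\<dots> = (\<Sum>m\<in>insert (n - 1) {0<..<K}. c m)"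
  proof (rule sum.mono_neutral_right)
    show "\<forall>m\<in>{0<..<n} - insert (n - 1) {0<..<K}. c m = 0"
    proof
      fix m assume m: "m \<in> {0<..<n} - insert (n - 1) {0<..<K}"
      then have "chain_count fl m (n - m) = 0"
        using n by (intro chain_count_flat flat) auto
      then show "c m = 0" by (simp add: c_def)
    qed
  qed (use n in auto)
  also have "\<dots> = chain_count fl 0 (n - 1) + (\<Sum>m\<in>{0<..<K}. c m)"
    using n by (subst sum.insert) (auto simp: c_def)
  finally show ?thesis using eq n by (simp add: numeral_2_eq_2)
qed

end

section \<open>Subdivided convex polygons\<close>

lemma ccw_orient: "ccw a b c \<longleftrightarrow> 0 < orient a b c"
  by (simp add: ccw_def orient_def)

text \<open>
  Seen from \<open>v a\<close>, all other corners lie in the half-plane to the left of the side starting there,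
  so that the counterclockwise turns from each corner to the next one can be composed.
\<close>
lemma convex_polygon_orient:
  assumes poly: "convex_polygon k v" and abc: "a < b" "b < c" "c < k"
  shows "0 < orient (v a) (v b) (v c)"
proof -
  have side: "0 < orient (v i) (v (Suc i)) (v j)" if "Suc i < k" "j < k" "j \<noteq> i" "j \<noteq> Suc i" for i j
    using poly that unfolding convex_polygon_def ccw_orient by (metis Suc_lessD mod_less)
  \<comment> \<open>Three-term Pluecker relation for the vectors from p to u, x, y, z. With the
    successor of a as u, all factors but the wanted one have known signs.\<close>
  have id: "orient p u y * orient p x z = orient p u x * orient p y z + orient p u z * orient p x y"
    for p u x y z :: "real^2"
    by (simp add: orient_def algebra_simps)
  from abc(2,3) show ?thesis
  proof (induction c rule: less_induct)
    case (less c)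
    show ?case
    proof (cases "c = Suc b")
      case True
      then show ?thesis using side[of b a] orient_rotate less.prems abc(1) by simp
    next
      case False
      then obtain d where d: "c = Suc d" "b < d" using less.prems by (cases c) auto
      have 1: "0 < orient (v a) (v b) (v d)" using less.IH[of d] d less.prems by simp
      have 2: "0 < orient (v a) (v d) (v c)"
        using side[of d a] d less.prems abc(1) orient_rotate by simp
      have u: "0 < orient (v a) (v (Suc a)) (v d)" "0 < orient (v a) (v (Suc a)) (v c)"
        using side[of a d] side[of a c] d less.prems abc(1) by simp_all
      have b: "0 \<le> orient (v a) (v (Suc a)) (v b)"
      proof (cases "b = Suc a")
        case False
        then show ?thesis using side[of a b] less.prems abc(1) by simp
      qed simp
      have "0 < orient (v a) (v (Suc a)) (v d) * orient (v a) (v b) (v c)"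
        unfolding id[of "v a" "v (Suc a)" "v d" "v b" "v c"] using 1 2 u b
        by (intro add_nonneg_pos mult_nonneg_nonneg mult_pos_pos) auto
      then show ?thesis using u(1) by (simp add: zero_less_mult_iff)
    qed
  qed
qed

lemma orient_affine1: "orient ((1 - u) *\<^sub>R c + u *\<^sub>R d) a b = (1 - u) * orient c a b + u * orient d a b"
  by (simp add: orient_def algebra_simps)

lemma orient_affine2: "orient a ((1 - u) *\<^sub>R c + u *\<^sub>R d) b = (1 - u) * orient a c b + u * orient a d b"
  by (simp add: orient_def algebra_simps)

lemma orient_on_line:
  "orient ((1 - s) *\<^sub>R a + s *\<^sub>R b) ((1 - t) *\<^sub>R a + t *\<^sub>R b) c = (t - s) * orient a b c"
  "orient c ((1 - s) *\<^sub>R a + s *\<^sub>R b) ((1 - t) *\<^sub>R a + t *\<^sub>R b) = (t - s) * orient c a b"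
  by (simp_all add: orient_def algebra_simps)

text \<open>Index k is a second name of corner 0, so that the last side is written like the others;
  strictness therefore excludes triples with both 0 and k. The number \<open>\<tau> s t\<close> is
  the parameter on side s of its point t, where t = 0 is the corner itself.\<close>

locale subdivided_polygon =
  fixes V :: "nat \<Rightarrow> real^2" and \<tau> :: "nat \<Rightarrow> nat \<Rightarrow> real" and k r :: nat
  assumes k3: "3 \<le> k" and r2: "2 \<le> r"
    and V_k: "V k = V 0"
    and V_nonneg: "\<And>x y z. x \<le> y \<Longrightarrow> y \<le> z \<Longrightarrow> z \<le> k \<Longrightarrow> 0 \<le> orient (V x) (V y) (V z)"
    and V_pos: "\<And>x y z. x < y \<Longrightarrow> y < z \<Longrightarrow> z \<le> k \<Longrightarrow> 0 < x \<or> z < k \<Longrightarrow> 0 < orient (V x) (V y) (V z)"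
    and \<tau>_0: "\<And>s. \<tau> s 0 = 0"
    and \<tau>_mono: "\<And>s t t'. s < k \<Longrightarrow> t < t' \<Longrightarrow> t' < r \<Longrightarrow> \<tau> s t < \<tau> s t'"
    and \<tau>_less_1: "\<And>s t. s < k \<Longrightarrow> t < r \<Longrightarrow> \<tau> s t < 1"
begin

definition pt :: "nat \<Rightarrow> real^2" where
  "pt b = (1 - \<tau> (b div r) (b mod r)) *\<^sub>R V (b div r) + \<tau> (b div r) (b mod r) *\<^sub>R V (Suc (b div r))"

lemma \<tau>_nonneg: "s < k \<Longrightarrow> t < r \<Longrightarrow> 0 \<le> \<tau> s t"
  using \<tau>_mono[of s 0 t] \<tau>_0[of s] by (cases "t = 0") auto

lemma side_less: "b < k * r \<Longrightarrow> b div r < k"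
  by (simp add: less_mult_imp_div_less)

lemma V_ne: "s < k \<Longrightarrow> V s \<noteq> V (Suc s)"
  using V_pos[of s "Suc s" "Suc (Suc s)"] V_pos[of "s - 1" s "Suc s"] k3
  by (cases "s = 0"; cases "Suc s = k") auto

text \<open>The point is a combination of two corners weakly to the left of side s, and one with
  positive weight is strictly to the left. The excluded index is the far corner of side s.\<close>

lemma side_line_pos:
  assumes "s < b div r" "b < k * r" "b \<noteq> Suc s * r"
  shows "0 < orient (V s) (V (Suc s)) (pt b)"
proof -
  define u w where "u = b div r" and "w = \<tau> (b div r) (b mod r)"
  have u: "s < u" "u < k" using assms side_less by (auto simp: u_def)
  have w: "0 \<le> w" "w < 1" using \<tau>_nonneg \<tau>_less_1 u r2 by (auto simp: w_def u_def)
  have eq: "orient (V s) (V (Suc s)) (pt b) = (1 - w) * orient (V s) (V (Suc s)) (V u) + w * orient (V s) (V (Suc s)) (V (Suc u))"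
    by (simp add: pt_def orient_affine u_def w_def)
  have 1: "0 \<le> orient (V s) (V (Suc s)) (V u)" "0 \<le> orient (V s) (V (Suc s)) (V (Suc u))"
    using u by (auto intro: V_nonneg)
  show ?thesis
  proof (cases "u = Suc s")
    case True
    have "b mod r \<noteq> 0"
      using assms(3) True by (metis add.right_neutral div_mult_mod_eq u_def)
    then have "0 < w" using \<tau>_mono[of u 0 "b mod r"] \<tau>_0 u r2 by (simp add: w_def u_def)
    moreover have "0 < orient (V s) (V (Suc s)) (V (Suc u))" using u True k3 by (intro V_pos) auto
    ultimately show ?thesis unfolding eq using 1 w by (intro add_nonneg_pos mult_nonneg_nonneg mult_pos_pos) auto
  next
    case False
    then have "0 < orient (V s) (V (Suc s)) (V u)" using u by (intro V_pos) auto
    then show ?thesis unfolding eq using 1 w by (intro add_pos_nonneg mult_nonneg_nonneg mult_pos_pos) auto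
  qed
qed

lemma pt_corner: "pt (s * r) = V s"
  using r2 by (simp add: pt_def \<tau>_0)

lemma pt_inj: "inj_on pt {..<k * r}"
proof (rule linorder_inj_onI)
  fix a b assume ab: "a < b" "a \<in> {..<k * r}" "b \<in> {..<k * r}"
  define s where "s = a div r"
  have s: "s \<le> b div r" using ab by (simp add: s_def div_le_mono)
  have sk: "s < k" using ab side_less by (auto simp: s_def)
  have t: "a mod r < r" using r2 by simp
  show "pt a \<noteq> pt b"
  proof (cases "s = b div r")
    case True
    have "a mod r < b mod r" using ab(1) True
      by (metis s_def div_mult_mod_eq add_less_cancel_left)
    then have "\<tau> s (a mod r) < \<tau> s (b mod r)" using sk r2 by (intro \<tau>_mono) auto
    moreover have "pt b - pt a = (\<tau> s (b mod r) - \<tau> s (a mod r)) *\<^sub>R (V (Suc s) - V s)"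
      using True by (simp add: pt_def s_def[symmetric] algebra_simps)
    ultimately show ?thesis using V_ne[OF sk] by auto
  next
    case False
    then have sb: "s < b div r" using s by simp
    have a0: "orient (V s) (V (Suc s)) (pt a) = 0" by (simp add: pt_def s_def orient_affine)
    show ?thesis
    proof (cases "b = Suc s * r")
      case True
      have "pt b - pt a = (1 - \<tau> s (a mod r)) *\<^sub>R (V (Suc s) - V s)"
        unfolding True pt_corner by (simp add: pt_def s_def[symmetric] algebra_simps)
      then show ?thesis using V_ne[OF sk] \<tau>_less_1[OF sk t] by auto
    next
      case False
      then show ?thesis using side_line_pos[OF sb] a0 ab by auto
    qed
  qed
qed auto

text \<open>Degenerate triples lie on one side, whose far corner counts as part of it. The second
  alternative is the last side, whose far corner is point 0 and so comes first in the index
  order.\<close>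

lemma pt_orient:
  assumes abc: "a < b" "b < c" "c < k * r"
  shows "0 \<le> orient (pt a) (pt b) (pt c)"
    and "orient (pt a) (pt b) (pt c) = 0 \<longleftrightarrow>
      (a div r = b div r \<and> c \<le> Suc (a div r) * r) \<or> (a = 0 \<and> b div r = k - 1)"
proof -
  define s\<^sub>a s\<^sub>b s\<^sub>c where s: "s\<^sub>a = a div r" "s\<^sub>b = b div r" "s\<^sub>c = c div r"
  define \<alpha> \<beta> \<gamma> where w: "\<alpha> = \<tau> s\<^sub>a (a mod r)" "\<beta> = \<tau> s\<^sub>b (b mod r)" "\<gamma> = \<tau> s\<^sub>c (c mod r)"
  have le: "s\<^sub>a \<le> s\<^sub>b" "s\<^sub>b \<le> s\<^sub>c" "s\<^sub>c < k" using abc side_less by (auto simp: s div_le_mono)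
  then have lek: "s\<^sub>a < k" "s\<^sub>b < k" by auto
  have mr: "a mod r < r" "b mod r < r" "c mod r < r" using r2 by auto
  have p: "pt a = (1 - \<alpha>) *\<^sub>R V s\<^sub>a + \<alpha> *\<^sub>R V (Suc s\<^sub>a)"
    "pt b = (1 - \<beta>) *\<^sub>R V s\<^sub>b + \<beta> *\<^sub>R V (Suc s\<^sub>b)"
    "pt c = (1 - \<gamma>) *\<^sub>R V s\<^sub>c + \<gamma> *\<^sub>R V (Suc s\<^sub>c)"
    by (simp_all add: pt_def s w)
  have wr: "0 \<le> \<alpha>" "\<alpha> < 1" "0 \<le> \<beta>" "\<beta> < 1" "0 \<le> \<gamma>" "\<gamma> < 1"
    using \<tau>_nonneg \<tau>_less_1 le lek mr by (auto simp: w)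
  have abr: "s\<^sub>a * r \<le> a" "s\<^sub>b * r \<le> b" "c < Suc s\<^sub>c * r"
    using r2 by (auto simp: s dividend_less_div_times)
  consider "s\<^sub>a < s\<^sub>b" "s\<^sub>b < s\<^sub>c" | "s\<^sub>a = s\<^sub>b" "s\<^sub>b < s\<^sub>c" | "s\<^sub>a < s\<^sub>b" "s\<^sub>b = s\<^sub>c" | "s\<^sub>a = s\<^sub>b" "s\<^sub>b = s\<^sub>c"
    using le by linarith
  then have "0 \<le> orient (pt a) (pt b) (pt c) \<and> (orient (pt a) (pt b) (pt c) = 0 \<longleftrightarrow>
      (s\<^sub>a = s\<^sub>b \<and> c \<le> Suc s\<^sub>a * r) \<or> (a = 0 \<and> s\<^sub>b = k - 1))"
  proof cases
    case 1
    have nn: "0 \<le> orient (V x) (V y) (pt c)"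
      if "x \<le> y" "y \<le> s\<^sub>c" for x y
      unfolding p orient_affine using wr that le
      by (intro add_nonneg_nonneg mult_nonneg_nonneg V_nonneg) auto
    have "0 < (1 - \<gamma>) * orient (V s\<^sub>a) (V s\<^sub>b) (V s\<^sub>c)" using wr 1 le by (simp add: V_pos)
    moreover have "0 \<le> \<gamma> * orient (V s\<^sub>a) (V s\<^sub>b) (V (Suc s\<^sub>c))"
      using wr 1 le by (intro mult_nonneg_nonneg V_nonneg) auto
    ultimately have "0 < orient (V s\<^sub>a) (V s\<^sub>b) (pt c)" unfolding p orient_affine by linarith
    then have "0 < (1 - \<beta>) * orient (V s\<^sub>a) (V s\<^sub>b) (pt c)" using wr by simp
    moreover have "0 \<le> \<beta> * orient (V s\<^sub>a) (V (Suc s\<^sub>b)) (pt c)"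
      using wr 1 by (intro mult_nonneg_nonneg nn) auto
    ultimately have "0 < orient (V s\<^sub>a) (pt b) (pt c)" unfolding p(2) orient_affine2 by linarith
    then have "0 < (1 - \<alpha>) * orient (V s\<^sub>a) (pt b) (pt c)" using wr by simp
    moreover have "0 \<le> \<alpha> * orient (V (Suc s\<^sub>a)) (pt b) (pt c)"
      unfolding p(2) orient_affine2 using wr 1
      by (intro mult_nonneg_nonneg add_nonneg_nonneg nn) auto
    ultimately have "0 < orient (pt a) (pt b) (pt c)" unfolding p(1) orient_affine1 by linarith
    moreover have "s\<^sub>b \<noteq> k - 1" using 1 le by linarith
    ultimately show ?thesis using 1 by simp
  next
    case 2
    have "a mod r < b mod r" using abc(1) 2(1) by (metis s(1,2) div_mult_mod_eq add_less_cancel_left)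
    then have "\<alpha> < \<beta>" using lek mr 2(1) by (simp add: w \<tau>_mono)
    moreover have "orient (pt a) (pt b) (pt c) = (\<beta> - \<alpha>) * orient (V s\<^sub>a) (V (Suc s\<^sub>a)) (pt c)"
      unfolding p(1,2) 2(1)[symmetric] by (rule orient_on_line)
    moreover have "s\<^sub>b \<noteq> k - 1" using 2 le by linarith
    moreover have "Suc s\<^sub>a * r \<le> c"
    proof -
      have "Suc s\<^sub>a * r \<le> s\<^sub>c * r" using 2 by (intro mult_le_mono1) simp
      also have "\<dots> \<le> c" by (simp add: s)
      finally show ?thesis .
    qed
    moreover have "orient (V s\<^sub>a) (V (Suc s\<^sub>a)) (pt c) = 0" if "c = Suc s\<^sub>a * r"
      unfolding that pt_corner by simp
    moreover have "0 < orient (V s\<^sub>a) (V (Suc s\<^sub>a)) (pt c)" if "c \<noteq> Suc s\<^sub>a * r"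
      using side_line_pos[of s\<^sub>a c] that 2 abc by (simp add: s)
    ultimately show ?thesis using 2 by (cases "c = Suc s\<^sub>a * r") auto
  next
    case 3
    have "b mod r < c mod r" using abc(2) 3(2) by (metis s(2,3) div_mult_mod_eq add_less_cancel_left)
    then have bc: "\<beta> < \<gamma>" using lek mr 3(2) by (simp add: w \<tau>_mono)
    have eq: "orient (pt a) (pt b) (pt c) = (\<gamma> - \<beta>) * orient (pt a) (V s\<^sub>b) (V (Suc s\<^sub>b))"
      unfolding p(2,3) 3(2)[symmetric] by (rule orient_on_line)
    have eq': "orient (pt a) (V s\<^sub>b) (V (Suc s\<^sub>b)) = (1 - \<alpha>) * orient (V s\<^sub>a) (V s\<^sub>b) (V (Suc s\<^sub>b))
        + \<alpha> * orient (V (Suc s\<^sub>a)) (V s\<^sub>b) (V (Suc s\<^sub>b))"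
      unfolding p(1) by (rule orient_affine1)
    have nn: "0 \<le> (1 - \<alpha>) * orient (V s\<^sub>a) (V s\<^sub>b) (V (Suc s\<^sub>b))"
      "0 \<le> \<alpha> * orient (V (Suc s\<^sub>a)) (V s\<^sub>b) (V (Suc s\<^sub>b))"
      using wr 3 lek by (auto intro!: mult_nonneg_nonneg V_nonneg)
    show ?thesis
    \<comment> \<open>The last side ends in corner 0, so the corner triple degenerates here and only
      a positive distance of \<open>pt a\<close> from corner 0 makes the orientation strict.\<close>
    proof (cases "s\<^sub>a = 0 \<and> s\<^sub>b = k - 1")
      case False
      then have "0 < (1 - \<alpha>) * orient (V s\<^sub>a) (V s\<^sub>b) (V (Suc s\<^sub>b))"
        using wr 3 lek by (auto intro!: mult_pos_pos V_pos)
      then have "0 < orient (pt a) (V s\<^sub>b) (V (Suc s\<^sub>b))" using eq' nn by linarith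
      then show ?thesis using eq bc 3 False by (auto simp: s)
    next
      case True
      then have sk: "Suc s\<^sub>b = k" using k3 by simp
      show ?thesis
      proof (cases "a = 0")
        case a0: True
        then have "\<alpha> = 0" using \<tau>_0 by (simp add: w)
        moreover have "orient (V s\<^sub>a) (V s\<^sub>b) (V (Suc s\<^sub>b)) = 0" using True sk V_k by simp
        ultimately show ?thesis using eq eq' True a0 by simp
      next
        case a0: False
        then have "0 < a mod r" using True div_mult_mod_eq[of a r] by (simp add: s)
        then have "0 < \<alpha>" using \<tau>_mono[of s\<^sub>a 0 "a mod r"] \<tau>_0 lek mr by (simp add: w)
        moreover have "0 < orient (V (Suc s\<^sub>a)) (V s\<^sub>b) (V (Suc s\<^sub>b))" using True k3 by (intro V_pos) auto
        ultimately have "0 < \<alpha> * orient (V (Suc s\<^sub>a)) (V s\<^sub>b) (V (Suc s\<^sub>b))" by simp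
        then have "0 < orient (pt a) (V s\<^sub>b) (V (Suc s\<^sub>b))" using eq' nn by linarith
        then show ?thesis using eq bc 3 a0 by auto
      qed
    qed
  next
    case 4
    have "c \<le> Suc s\<^sub>a * r" using abr 4 by simp
    moreover have "orient (pt a) (pt b) (pt c) = 0"
      unfolding p 4 orient_on_line orient_affine by simp
    ultimately show ?thesis using 4 by simp
  qed
  then show "0 \<le> orient (pt a) (pt b) (pt c)"
    and "orient (pt a) (pt b) (pt c) = 0 \<longleftrightarrow>
      (a div r = b div r \<and> c \<le> Suc (a div r) * r) \<or> (a = 0 \<and> b div r = k - 1)"
    unfolding s by auto
qed

lemma between: "s * r < x \<Longrightarrow> x < Suc s * r \<Longrightarrow> \<not> r dvd x"
  using r2 by (auto elim!: dvdE simp: mult.commute[of r]) (metis less_antisym mult_less_cancel2 not_less_eq mult_Suc)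

sublocale flat_weakly_convex pt "k * r" "\<lambda>x. \<not> r dvd x" "(k - 1) * r"
proof
  show "inj_on pt {..<k * r}" by (rule pt_inj)
  show "0 \<le> orient (pt a) (pt b) (pt c)" if "a < b" "b < c" "c < k * r" for a b c
    using pt_orient(1)[OF that] .
  show "\<not> r dvd x"
    if "a < b" "b < c" "c < k * r" "0 < a \<or> c \<le> (k - 1) * r" "orient (pt a) (pt b) (pt c) = 0" "a < x" "x < c"
    for a b c x
  proof -
    \<comment> \<open>The exceptional degenerate triples start at 0 and end beyond the last corner,
      which the hypothesis on a and c rules out.\<close>
    have "\<not> (a = 0 \<and> b div r = k - 1)"
    proof
      assume *: "a = 0 \<and> b div r = k - 1"
      then have "(k - 1) * r \<le> b" by (metis div_times_less_eq_dividend)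
      then show False using that * by auto
    qed
    then have "c \<le> Suc (a div r) * r" using pt_orient(2)[OF that(1-3)] that(5) by blast
    moreover have "a div r * r \<le> a" by simp
    ultimately show ?thesis using that(6,7) by (intro between[of "a div r"]) linarith+
  qed
  show "orient (pt a) (pt (Suc a)) (pt (Suc (Suc a))) = 0" if "Suc (Suc a) < k * r" "\<not> r dvd Suc a" for a
  proof -
    have "Suc a div r = a div r" using that(2) by (simp add: div_Suc dvd_eq_mod_eq_0 mod_Suc split: if_splits)
    moreover have "a < Suc (a div r) * r" using r2 by (simp add: dividend_less_div_times)
    moreover have "Suc a \<noteq> Suc (a div r) * r" using that(2) by (metis dvd_triv_right)
    ultimately show ?thesis using pt_orient(2)[of a "Suc a" "Suc (Suc a)"] that by auto
  qed
qed

lemma card_dissections_polygon: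
  "real (card (dissections pt 0 (k * r - 1))) =
    chain_count (\<lambda>x. \<not> r dvd x) 0 (k * r - 1) - chain_count (\<lambda>x. \<not> r dvd x) 0 (k * r - 2)"
proof (rule card_dissections_closed)
  have kr: "k * r = (k - 1) * r + r" using k3 by (cases k) auto
  have "2 * r \<le> (k - 1) * r" using k3 by (intro mult_le_mono1) simp
  then have big: "2 * r < k * r - 1" using kr r2 by linarith
  show "Suc (Suc ((k - 1) * r)) \<le> k * r" using kr r2 by linarith
  show "4 \<le> k * r" using big r2 by linarith
  show "orient (pt 0) (pt m) (pt (k * r - 1)) = 0 \<longleftrightarrow> (k - 1) * r \<le> m" if "0 < m" "Suc m < k * r" for m
  proof -
    have "orient (pt 0) (pt m) (pt (k * r - 1)) = 0 \<longleftrightarrow> m div r = k - 1"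
      using pt_orient(2)[of 0 m "k * r - 1"] that big by auto
    also have "\<dots> \<longleftrightarrow> (k - 1) * r \<le> m"
    proof
      assume "(k - 1) * r \<le> m"
      then have "k - 1 \<le> m div r" using r2 by (simp add: less_eq_div_iff_mult_less_eq)
      moreover have "m div r < k" using that by (intro side_less) simp
      ultimately show "m div r = k - 1" by linarith
    qed (metis div_times_less_eq_dividend)
    finally show ?thesis .
  qed
  show "\<not> r dvd x" if "(k - 1) * r < x" "x < k * r" for x
    using that k3 by (intro between[of "k - 1"]) auto
qed

end

section \<open>Maximality of dissections of boundary points\<close>

lemma interior_triangle_nonempty:
  fixes t :: "(real^2) set"
  assumes "card t = 3" "\<not> collinear t"
  shows "interior (convex hull t) \<noteq> {}"
proof -
  obtain a b c where t: "t = {a, b, c}" using assms(1) by (auto simp: card_3_iff)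
  have "\<not> affine_dependent t"
    using assms(2) affine_dependent_imp_collinear_3 unfolding t by blast
  moreover have "card t = Suc (DIM(real^2))" using assms(1) by simp
  ultimately show ?thesis using interior_convex_hull_eq_empty by blast
qed

context weakly_convex
begin

text \<open>The line through a point and its cyclic successor has all points weakly on its left and
  so supports the hull.\<close>

lemma pt_not_interior:
  assumes "2 \<le> N" "a < N"
  shows "p a \<notin> interior (convex hull (p ` {..<N}))"
proof
  assume *: "p a \<in> interior (convex hull (p ` {..<N}))"
  obtain b where b: "b < N" "b \<noteq> a" "\<And>c. c < N \<Longrightarrow> 0 \<le> orient (p a) (p b) (p c)"
  proof (cases "Suc a < N")
    case True
    have "0 \<le> orient (p a) (p (Suc a)) (p c)" if "c < N" for c
    proof (cases "c \<le> a")
      case True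
      then show ?thesis using pos_le[of c a "Suc a"] \<open>Suc a < N\<close> orient_rotate[of "p a" "p (Suc a)" "p c"] by simp
    qed (use that pos_le[of a "Suc a" c] in simp)
    then show ?thesis using that[of "Suc a"] True by simp
  next
    case False
    have "0 \<le> orient (p a) (p 0) (p c)" if "c < N" for c
      using pos_le[of 0 c a] that False assms orient_rotate2[of "p a" "p 0" "p c"] by simp
    then show ?thesis using that[of 0] False assms by simp
  qed
  have "0 < orient (p a) (p b) (p a)"
  proof (rule interior_orient_ge[OF _ _ *])
    show "p a \<noteq> p b" using neq b assms by auto
    show "0 \<le> orient (p a) (p b) x" if "x \<in> convex hull (p ` {..<N})" for x
      using hull_orient_ge[OF _ that] b(3) by blast
  qed
  then show False by simp
qed

text \<open>No point of the set is interior to the hull, so none is interior to a triangle, and the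
  open sides are free by definition.\<close>

lemma dissection_triangle_points:
  assumes "2 \<le> N" and T: "triangle_dissection (p ` {..<N}) T" "t \<in> T"
  shows "p ` {..<N} \<inter> convex hull t = t"
proof
  note D = triangle_dissectionD[OF T(1)]
  show "t \<subseteq> p ` {..<N} \<inter> convex hull t" using D(1)[OF T(2)] hull_subset[of t convex] by simp
  show "p ` {..<N} \<inter> convex hull t \<subseteq> t"
  proof
    fix x assume x: "x \<in> p ` {..<N} \<inter> convex hull t"
    obtain a b c where t: "t = {a, b, c}" using D(2)[OF T(2)] by (auto simp: card_3_iff)
    have "interior (convex hull t) \<subseteq> interior (convex hull (p ` {..<N}))"
      using D(1)[OF T(2)] by (intro interior_mono hull_mono)
    then have "x \<notin> interior (convex hull t)" using x pt_not_interior[OF assms(1)] by blast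
    moreover have "x \<in> closure (convex hull t)" using x closure_subset by blast
    ultimately have "x \<in> frontier (convex hull t)" by (simp add: frontier_def)
    also have "frontier (convex hull t) = closed_segment a b \<union> closed_segment b c \<union> closed_segment c a"
      unfolding t by (rule frontier_of_triangle) simp
    finally obtain u v where uv: "x \<in> closed_segment u v" "u \<in> t" "v \<in> t" unfolding t by blast
    then have "x \<notin> open_segment u v" using D(7)[OF T(2) uv(2,3)] x by blast
    then show "x \<in> t" using uv by (auto simp: open_segment_def)
  qed
qed

text \<open>A triangle of a refinement has its vertices among the points of a coarser triangle,
  which are only its own three, so the two agree. Conversely an interior point of a coarser triangle
  is covered by a triangle of the refinement, which overlaps it and hence equals it.\<close>

lemma triangulation_iff_dissection:
  assumes N: "2 \<le> N"
  shows "triangulation (p ` {..<N}) T \<longleftrightarrow> triangle_dissection (p ` {..<N}) T"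
proof
  assume T: "triangle_dissection (p ` {..<N}) T"
  have "T' = T" if T': "triangle_dissection (p ` {..<N}) T'" and ref: "refines T' T" for T'
  proof
    note D = triangle_dissectionD[OF T]
    show sub: "T' \<subseteq> T"
    proof
      fix t' assume t': "t' \<in> T'"
      then obtain t where t: "t \<in> T" "convex hull t' \<subseteq> convex hull t" using ref by (auto simp: refines_def)
      have "t' \<subseteq> t"
        using dissection_triangle_points[OF N T t(1)] dissection_triangle_points[OF N T' t'] t(2) by blast
      moreover have "card t' = 3" "card t = 3" using D(2) t(1) triangle_dissectionD(2)[OF T' t'] by auto
      moreover have "finite t" using \<open>card t = 3\<close> by (intro card_ge_0_finite) simp
      ultimately have "t' = t" by (simp add: card_subset_eq)
      then show "t' \<in> T" using t(1) by simp
    qed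
    show "T \<subseteq> T'"
    proof
      fix t assume t: "t \<in> T"
      obtain x where x: "x \<in> interior (convex hull t)"
        using interior_triangle_nonempty D(2,3) t by blast
      have "convex hull t \<subseteq> convex hull (p ` {..<N})" using D(1)[OF t] by (rule hull_mono)
      then obtain t' where t': "t' \<in> T'" "x \<in> convex hull t'"
        using triangle_dissectionD(4)[OF T'] x interior_subset by blast
      have "interior (convex hull t') \<noteq> {}"
        using interior_triangle_nonempty D(2,3) t' sub by blast
      then have "x \<in> closure (interior (convex hull t'))"
        using convex_closure_interior[of "convex hull t'"] t'(2) closure_subset by auto
      then have "interior (convex hull t') \<inter> interior (convex hull t) \<noteq> {}"
        using x open_interior[of "convex hull t"]
        by (metis Int_commute closure_iff_nhds_not_empty dual_order.refl)
      then show "t \<in> T'" using D(5)[of t' t] t t'(1) sub by auto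
    qed
  qed
  then show "triangulation (p ` {..<N}) T" using T by (simp add: triangulation_def)
qed (simp add: triangulation_def)

lemma num_triangulations_eq:
  assumes "3 \<le> N"
  shows "num_triangulations (p ` {..<N}) = card (dissections p 0 (N - 1))"
proof -
  have "{..<N} = {0..N - 1}" using assms by auto
  then show ?thesis
    using triangulation_iff_dissection assms by (auto simp: num_triangulations_def dissections_def)
qed

end

section \<open>Enumeration of a subdivided polygon along its boundary\<close>

lemma sorted_enumeration:
  fixes A :: "real set"
  assumes "finite A" "card A = n"
  obtains f :: "nat \<Rightarrow> real" where "f ` {..<n} = A" "\<And>i j. i < j \<Longrightarrow> j < n \<Longrightarrow> f i < f j"
proof
  let ?xs = "sorted_list_of_set A"
  have len: "length ?xs = n" using assms by simp
  have "(!) ?xs ` {..<n} = set ?xs" unfolding set_conv_nth len by auto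
  then show "(!) ?xs ` {..<n} = A" using assms by simp
  show "?xs ! i < ?xs ! j" if "i < j" "j < n" for i j
    using that len by (intro sorted_wrt_nth_less[OF strict_sorted_list_of_set]) auto
qed

text \<open>The affine parameter identifies the points inside a side with r - 1 reals in the open
  unit interval; sorting them gives the order along the boundary.\<close>

lemma subdivided_convex_polygon_enumeration:
  assumes SC: "subdivided_convex_polygon k r P" and r: "2 \<le> r"
  obtains V \<tau> where "subdivided_polygon V \<tau> k r" "subdivided_polygon.pt V \<tau> r ` {..<k * r} = P"
proof -
  obtain v where poly: "convex_polygon k v" and vP: "v ` {..<k} \<subseteq> P"
    and cover: "P \<subseteq> (\<Union>i<k. closed_segment (v i) (v (Suc i mod k)))"
    and card: "\<And>i. i < k \<Longrightarrow> card (P \<inter> open_segment (v i) (v (Suc i mod k))) = r - 1"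
    and fin: "finite P"
    using SC unfolding subdivided_convex_polygon_def by blast
  have k: "3 \<le> k" using poly by (simp add: convex_polygon_def)
  define V where "V = (\<lambda>s. v (s mod k))"
  have V: "V s = v s" "V (Suc s) = v (Suc s mod k)" if "s < k" for s using that by (simp_all add: V_def)
  have Vk: "V k = V 0" by (simp add: V_def)
  have V_pos: "0 < orient (V x) (V y) (V z)" if "x < y" "y < z" "z \<le> k" "0 < x \<or> z < k" for x y z
  proof (cases "z = k")
    case True
    then show ?thesis
      using convex_polygon_orient[OF poly, of 0 x y] that orient_rotate[of "V x" "V y" "V 0"]
      by (simp add: Vk V)
  next
    case False
    then show ?thesis using convex_polygon_orient[OF poly that(1,2)] that by (simp add: V)
  qed
  have V_nonneg: "0 \<le> orient (V x) (V y) (V z)" if "x \<le> y" "y \<le> z" "z \<le> k" for x y z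
  proof (cases "x < y \<and> y < z \<and> (0 < x \<or> z < k)")
    case True
    then show ?thesis using V_pos[of x y z] that by simp
  next
    case False
    then have "x = y \<or> y = z \<or> V x = V z" using that Vk by auto
    then show ?thesis by auto
  qed
  define f where "f = (\<lambda>s t. (1 - t) *\<^sub>R V s + t *\<^sub>R V (Suc s))"
  define A where "A = (\<lambda>s. {t. 0 < t \<and> t < 1 \<and> f s t \<in> P})"
  have V_ne: "V s \<noteq> V (Suc s)" if "s < k" for s
    using V_pos[of s "Suc s" "Suc (Suc s)"] V_pos[of "s - 1" s "Suc s"] k that
    by (cases "s = 0"; cases "Suc s = k") auto
  have A: "bij_betw (f s) (A s) (P \<inter> open_segment (v s) (v (Suc s mod k)))" if s: "s < k" for s
    unfolding bij_betw_def
  proof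
    show "inj_on (f s) (A s)"
    proof (rule inj_onI)
      fix t u assume "f s t = f s u"
      then have "(t - u) *\<^sub>R (V (Suc s) - V s) = 0" by (simp add: f_def algebra_simps)
      then show "t = u" using V_ne[OF s] by simp
    qed
    show "f s ` A s = P \<inter> open_segment (v s) (v (Suc s mod k))"
      using V_ne[OF s] V[OF s] by (auto simp: A_def f_def in_segment)
  qed
  have "\<exists>g :: nat \<Rightarrow> real. g ` {..<r - 1} = A s \<and> (\<forall>i j. i < j \<longrightarrow> j < r - 1 \<longrightarrow> g i < g j)" if s: "s < k" for s
  proof -
    have "finite (A s)" using bij_betw_finite[OF A[OF s]] fin by simp
    moreover have "card (A s) = r - 1" using bij_betw_same_card[OF A[OF s]] card[OF s] by simp
    ultimately obtain g :: "nat \<Rightarrow> real" where "g ` {..<r - 1} = A s" "\<And>i j. i < j \<Longrightarrow> j < r - 1 \<Longrightarrow> g i < g j"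
      using sorted_enumeration by blast
    then show ?thesis by blast
  qed
  then obtain g :: "nat \<Rightarrow> nat \<Rightarrow> real" where g: "\<And>s. s < k \<Longrightarrow> g s ` {..<r - 1} = A s"
    "\<And>s i j. s < k \<Longrightarrow> i < j \<Longrightarrow> j < r - 1 \<Longrightarrow> g s i < g s j"
    by metis
  define \<tau> where "\<tau> = (\<lambda>s t. if t = 0 then 0 else g s (t - 1))"
  have \<tau>A: "\<tau> s t \<in> A s" if "s < k" "0 < t" "t < r" for s t
  proof -
    have "g s (t - 1) \<in> g s ` {..<r - 1}" using that by (intro imageI) auto
    then show ?thesis unfolding g(1)[OF that(1)] using that by (simp add: \<tau>_def)
  qed
  interpret subdivided_polygon V \<tau> k r
  proof
    show "\<tau> s t < \<tau> s t'" if "s < k" "t < t'" "t' < r" for s t t'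
    proof (cases "t = 0")
      case True
      then show ?thesis using \<tau>A[of s t'] that by (simp add: A_def) (simp add: \<tau>_def)
    next
      case False
      then show ?thesis using g(2)[of s "t - 1" "t' - 1"] that by (simp add: \<tau>_def)
    qed
    show "\<tau> s t < 1" if "s < k" "t < r" for s t
      using \<tau>A[of s t] that by (cases "t = 0") (auto simp: A_def, simp add: \<tau>_def)
  qed (use k r Vk V_pos V_nonneg in \<open>auto simp: \<tau>_def\<close>)
  have pt_eq: "pt (s * r + t) = f s (\<tau> s t)" if "t < r" for s t
    using that by (simp add: pt_def f_def)
  have "pt ` {..<k * r} = P"
  proof
    show "pt ` {..<k * r} \<subseteq> P"
    proof
      fix x assume "x \<in> pt ` {..<k * r}"
      then obtain b where b: "b < k * r" "x = pt b" by blast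
      define s t where "s = b div r" and "t = b mod r"
      have st: "s < k" "t < r" "b = s * r + t" using side_less[OF b(1)] r by (auto simp: s_def t_def)
      show "x \<in> P"
      proof (cases "t = 0")
        case True
        then show ?thesis using b(2) st pt_corner[of s] vP V by auto
      next
        case False
        then show ?thesis using \<tau>A[of s t] st b(2) pt_eq[of t s] by (auto simp: A_def)
      qed
    qed
    show "P \<subseteq> pt ` {..<k * r}"
    proof
      fix x assume x: "x \<in> P"
      then obtain s where s: "s < k" "x \<in> closed_segment (v s) (v (Suc s mod k))" using cover by blast
      have corner: "v s' \<in> pt ` {..<k * r}" if "s' < k" for s'
        using that r by (intro image_eqI[of _ _ "s' * r"]) (auto simp: pt_corner V)
      show "x \<in> pt ` {..<k * r}"
      proof (cases "x \<in> open_segment (v s) (v (Suc s mod k))")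
        case True
        then have "x \<in> f s ` A s" using A[OF s(1)] x by (auto simp: bij_betw_def)
        then obtain i where i: "i < r - 1" "x = f s (g s i)" using g(1)[OF s(1)] by force
        have "x = pt (s * r + Suc i)" using i by (subst pt_eq) (auto simp: \<tau>_def)
        moreover have "s * r + Suc i < k * r"
        proof -
          have "s * r + Suc i < Suc s * r" using i by simp
          also have "\<dots> \<le> k * r" using s(1) by (intro mult_le_mono1) simp
          finally show ?thesis .
        qed
        ultimately show ?thesis by auto
      next
        case False
        then have "x = v s \<or> x = v (Suc s mod k)" using s(2) by (auto simp: open_segment_def)
        moreover have "Suc s mod k < k" using k by simp
        ultimately show ?thesis using corner s(1) by blast
      qed
    qed
  qed
  then show ?thesis using that subdivided_polygon_axioms by blast
qed

theorem num_triangulations_chain_count: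
  assumes "subdivided_convex_polygon k r P" "2 \<le> r"
  shows "real (num_triangulations P) =
    chain_count (\<lambda>x. \<not> r dvd x) 0 (k * r - 1) - chain_count (\<lambda>x. \<not> r dvd x) 0 (k * r - 2)"
proof -
  obtain V \<tau> where "subdivided_polygon V \<tau> k r" and P: "subdivided_polygon.pt V \<tau> r ` {..<k * r} = P"
    using subdivided_convex_polygon_enumeration[OF assms] .
  then interpret subdivided_polygon V \<tau> k r by simp
  have "3 * 2 \<le> k * r" using k3 assms(2) by (rule mult_le_mono)
  then show ?thesis using num_triangulations_eq card_dissections_polygon unfolding P[symmetric] by simp
qed

section \<open>Integral representation\<close>

text \<open>With x = 2 cos \<theta> these are the even moments of the semicircle law; they satisfy
  the defining recurrence of \<open>catalan\<close>.\<close>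

lemma has_integral_catalan:
  "((\<lambda>\<theta>. (4 * cos \<theta> ^ 2) ^ n * sin \<theta> ^ 2) has_integral pi / 4 * catalan n) {0..pi / 2}"
proof (induction n)
  case 0
  have "((\<lambda>\<theta>. (4 * cos \<theta> ^ 2) ^ 0 * sin \<theta> ^ 2) has_integral
      ((pi / 2 - sin (pi / 2) * cos (pi / 2)) / 2 - (0 - sin 0 * cos 0) / 2)) {0..pi / 2}"
  proof (rule fundamental_theorem_of_calculus)
    fix x :: real
    have "((\<lambda>\<theta>. (\<theta> - sin \<theta> * cos \<theta>) / 2) has_real_derivative (1 - (cos x * cos x - sin x * sin x)) / 2) (at x within {0..pi / 2})"
      by (auto intro!: derivative_eq_intros)
    also have "(1 - (cos x * cos x - sin x * sin x)) / 2 = (4 * cos x ^ 2) ^ 0 * sin x ^ 2"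
      using sin_cos_squared_add[of x] by (simp add: power2_eq_square field_simps)
    finally show "((\<lambda>\<theta>. (\<theta> - sin \<theta> * cos \<theta>) / 2) has_vector_derivative (4 * cos x ^ 2) ^ 0 * sin x ^ 2) (at x within {0..pi / 2})"
      by (simp add: has_real_derivative_iff_has_vector_derivative)
  qed simp
  then show ?case by simp
next
  case (Suc n)
  let ?f = "\<lambda>n \<theta>. (4 * cos \<theta> ^ 2) ^ n * sin \<theta> ^ 2 :: real"
  \<comment> \<open>Chosen to vanish at both ends of the interval, with a derivative that combines
    two consecutive integrands in the ratio of the Catalan recurrence.\<close>
  let ?F = "\<lambda>\<theta>. 4 ^ n * cos \<theta> ^ (2 * n + 1) * sin \<theta> ^ 3 :: real"
  have "((\<lambda>\<theta>. (real n + 2) / 2 * ?f (Suc n) \<theta> - (2 * real n + 1) * ?f n \<theta>) has_integral (?F (pi / 2) - ?F 0)) {0..pi / 2}"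
  proof (rule fundamental_theorem_of_calculus)
    fix x :: real
    have "(?F has_real_derivative 4 ^ n * ((2 * real n + 1) * cos x ^ (2 * n) * (- sin x)) * sin x ^ 3
        + 4 ^ n * cos x ^ (2 * n + 1) * (3 * sin x ^ 2 * cos x)) (at x within {0..pi / 2})"
      by (rule derivative_eq_intros refl)+ (simp add: algebra_simps)
    also have "4 ^ n * ((2 * real n + 1) * cos x ^ (2 * n) * (- sin x)) * sin x ^ 3
        + 4 ^ n * cos x ^ (2 * n + 1) * (3 * sin x ^ 2 * cos x)
      = 4 ^ n * cos x ^ (2 * n) * sin x ^ 2 * (3 * cos x ^ 2 - (2 * real n + 1) * sin x ^ 2)"
      by (simp add: algebra_simps power2_eq_square power3_eq_cube)
    also have "sin x ^ 2 = 1 - cos x ^ 2" by (rule sin_squared_eq)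
    also have "3 * cos x ^ 2 - (2 * real n + 1) * (1 - cos x ^ 2) = (2 * real n + 4) * cos x ^ 2 - (2 * real n + 1)"
      by (simp add: algebra_simps)
    also have "4 ^ n * cos x ^ (2 * n) * (1 - cos x ^ 2) * ((2 * real n + 4) * cos x ^ 2 - (2 * real n + 1))
      = (real n + 2) / 2 * ?f (Suc n) x - (2 * real n + 1) * ?f n x"
    proof -
      have q: "(4 * cos x ^ 2) ^ n = 4 ^ n * cos x ^ (2 * n)"
        by (simp add: power_mult_distrib power_mult)
      show ?thesis unfolding power_Suc q sin_squared_eq by (simp add: field_simps)
    qed
    finally show "(?F has_vector_derivative (real n + 2) / 2 * ?f (Suc n) x - (2 * real n + 1) * ?f n x) (at x within {0..pi / 2})"
      by (simp add: has_real_derivative_iff_has_vector_derivative)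
  qed simp
  then have "((\<lambda>\<theta>. (real n + 2) / 2 * ?f (Suc n) \<theta> - (2 * real n + 1) * ?f n \<theta>) has_integral 0) {0..pi / 2}"
    by simp
  from has_integral_add[OF this has_integral_mult_right[OF Suc, of "2 * real n + 1"]]
  have "((\<lambda>\<theta>. (real n + 2) / 2 * ?f (Suc n) \<theta>) has_integral (2 * real n + 1) * (pi / 4 * catalan n)) {0..pi / 2}"
    by simp
  note * = has_integral_mult_right[OF this, of "2 / (real n + 2)"]
  have cancel: "2 / (real n + 2) * ((real n + 2) / 2 * y) = y" for y
    by (simp add: field_simps)
  from *
  have "(?f (Suc n) has_integral 2 / (real n + 2) * ((2 * real n + 1) * (pi / 4 * catalan n))) {0..pi / 2}"
    unfolding cancel .
  also have "2 / (real n + 2) * ((2 * real n + 1) * (pi / 4 * catalan n)) = pi / 4 * catalan (Suc n)"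
    by (simp add: catalan.simps(2) field_simps)
  finally show ?case .
qed

text \<open>The addition theorem gives sin((t + 1) \<theta>) the Chebyshev recurrence. The factor
  sin \<theta> on the left avoids a division, so the identity holds for every \<theta>.\<close>

lemma side_poly_cos: "side_poly t (4 * cos \<theta> ^ 2) * sin \<theta> = (2 * cos \<theta>) ^ t * sin (real (Suc t) * \<theta>)"
proof (induction t "4 * cos \<theta> ^ 2" rule: side_poly.induct)
  case 2
  then show ?case using sin_double[of \<theta>] by (simp add: power2_eq_square)
next
  case (3 t)
  have "sin (real (Suc (Suc (Suc t))) * \<theta>) + sin (real (Suc t) * \<theta>) = 2 * cos \<theta> * sin (real (Suc (Suc t)) * \<theta>)"
  proof -
    have "real (Suc (Suc (Suc t))) * \<theta> = real (Suc (Suc t)) * \<theta> + \<theta>" "real (Suc t) * \<theta> = real (Suc (Suc t)) * \<theta> - \<theta>"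
      by (simp_all add: algebra_simps)
    then show ?thesis by (simp only: sin_add sin_diff) simp
  qed
  then have s: "sin (real (Suc (Suc (Suc t))) * \<theta>) = 2 * cos \<theta> * sin (real (Suc (Suc t)) * \<theta>) - sin (real (Suc t) * \<theta>)"
    by linarith
  have "side_poly (Suc (Suc t)) (4 * cos \<theta> ^ 2) * sin \<theta>
     = 4 * cos \<theta> ^ 2 * (side_poly (Suc t) (4 * cos \<theta> ^ 2) * sin \<theta> - side_poly t (4 * cos \<theta> ^ 2) * sin \<theta>)"
    by (simp add: algebra_simps)
  also have "\<dots> = 4 * cos \<theta> ^ 2 * ((2 * cos \<theta>) ^ Suc t * sin (real (Suc (Suc t)) * \<theta>) - (2 * cos \<theta>) ^ t * sin (real (Suc t) * \<theta>))"
    by (simp only: 3)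
  also have "\<dots> = (2 * cos \<theta>) ^ Suc (Suc t) * (2 * cos \<theta> * sin (real (Suc (Suc t)) * \<theta>) - sin (real (Suc t) * \<theta>))"
    by (simp add: algebra_simps power2_eq_square)
  also have "\<dots> = (2 * cos \<theta>) ^ Suc (Suc t) * sin (real (Suc (Suc (Suc t))) * \<theta>)"
    by (simp only: s)
  finally show ?case .
qed simp

text \<open>A chain of at least three edges cannot be crossed in fewer than two steps, so its
  polynomial is divisible by x^2.\<close>

lemma chain_poly_shift:
  assumes "3 \<le> D"
  shows "x ^ 2 * (\<Sum>a<D. chain_coeff fl 0 D (Suc (Suc a)) * x ^ a) = chain_poly fl D x"
proof -
  have "chain_poly fl D x = (\<Sum>n<Suc (Suc D). chain_coeff fl 0 D n * x ^ n)"
    unfolding lessThan_Suc_atMost by (rule chain_poly_eq) simp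
  also have "\<dots> = (\<Sum>a<D. chain_coeff fl 0 D (Suc (Suc a)) * x ^ Suc (Suc a))"
    using assms by (simp only: sum.lessThan_Suc_shift) simp
  also have "\<dots> = x ^ 2 * (\<Sum>a<D. chain_coeff fl 0 D (Suc (Suc a)) * x ^ a)"
    by (simp add: sum_distrib_left power2_eq_square mult_ac)
  finally show ?thesis by simp
qed

text \<open>The correction for the closing side is one more step of the coefficient recursion, taken
  at the flat point D - 1: it amounts to a chain of D edges that returns to corner 0. This step also
  moves the coefficient index up by one.\<close>

lemma chain_count_diff:
  assumes "3 \<le> D" "fl (D - 1)"
  shows "chain_count fl 0 (D - 1) - chain_count fl 0 (D - 2)
    = (\<Sum>a<D. chain_coeff fl 0 D (Suc (Suc a)) * catalan a)"
proof -
  obtain d where D: "D = Suc (Suc d)" "0 < d" using assms(1) by (metis One_nat_def Suc_le_D Suc_le_lessD numeral_3_eq_3 not_less_eq_eq Suc_le_mono)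
  show ?thesis
    using chain_count_eq[of "Suc d" D fl 0] chain_count_eq[of d D fl 0] D assms(2)
    by (simp add: sum_subtractf algebra_simps del: sum.lessThan_Suc)
qed

lemma has_integral_chain_count:
  assumes k: "3 \<le> k" and r: "2 \<le> r"
  defines "fl \<equiv> \<lambda>x. \<not> r dvd x"
  shows "((\<lambda>\<theta>. (2 * cos \<theta>) ^ (k * r - 4) * sin (real (Suc r) * \<theta>) ^ k / sin \<theta> ^ (k - 2))
    has_integral pi / 4 * (chain_count fl 0 (k * r - 1) - chain_count fl 0 (k * r - 2))) {0..pi / 2}"
proof -
  define D where "D = k * r"
  have "3 * 2 \<le> k * r" using k r by (rule mult_le_mono)
  then have D: "6 \<le> D" by (simp add: D_def)
  have "\<not> r dvd D - 1"
  proof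
    assume *: "r dvd D - 1"
    have "r dvd D" by (simp add: D_def)
    then have "r dvd D - (D - 1)" using * by (rule dvd_diff_nat)
    also have "D - (D - 1) = 1" using D by simp
    finally show False using r by simp
  qed
  then have fl: "fl (D - 1)" by (simp add: fl_def)
  define S where "S = (\<lambda>x. \<Sum>a<D. chain_coeff fl 0 D (Suc (Suc a)) * x ^ a)"
  have "((\<lambda>\<theta>. \<Sum>a<D. chain_coeff fl 0 D (Suc (Suc a)) * ((4 * cos \<theta> ^ 2) ^ a * sin \<theta> ^ 2))
      has_integral (\<Sum>a<D. chain_coeff fl 0 D (Suc (Suc a)) * (pi / 4 * catalan a))) {0..pi / 2}"
    by (intro has_integral_sum has_integral_mult_right has_integral_catalan) auto
  also have "(\<lambda>\<theta>. \<Sum>a<D. chain_coeff fl 0 D (Suc (Suc a)) * ((4 * cos \<theta> ^ 2) ^ a * sin \<theta> ^ 2))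
      = (\<lambda>\<theta>. S (4 * cos \<theta> ^ 2) * sin \<theta> ^ 2)"
    by (simp add: S_def sum_distrib_right mult.assoc)
  also have "(\<Sum>a<D. chain_coeff fl 0 D (Suc (Suc a)) * (pi / 4 * catalan a))
      = pi / 4 * (chain_count fl 0 (D - 1) - chain_count fl 0 (D - 2))"
    using chain_count_diff[of D fl] D fl by (simp add: sum_distrib_left mult_ac)
  finally have "((\<lambda>\<theta>. S (4 * cos \<theta> ^ 2) * sin \<theta> ^ 2) has_integral
      pi / 4 * (chain_count fl 0 (D - 1) - chain_count fl 0 (D - 2))) {0..pi / 2}" .
  then show ?thesis unfolding D_def[symmetric]
  \<comment> \<open>Powers of sin \<theta> and cos \<theta> cannot be cancelled at the two ends of
    the interval, which are negligible.\<close>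
  proof (rule has_integral_spike_finite[rotated 2])
    fix \<theta> :: real assume "\<theta> \<in> {0..pi / 2} - {0, pi / 2}"
    then have \<theta>: "0 < \<theta>" "\<theta> < pi / 2" by auto
    have c: "0 < cos \<theta>" "0 < sin \<theta>" using \<theta> by (auto intro: cos_gt_zero sin_gt_zero)
    define y where "y = 2 * cos \<theta>"
    have y: "0 < y" "4 * cos \<theta> ^ 2 = y ^ 2" using c by (simp_all add: y_def power_mult_distrib)
    \<comment> \<open>Division of the chain polynomial by x^2, where x = y^2, is what lowers the
      exponent kr of 2 cos \<theta> to kr - 4.\<close>
    have "y ^ 4 * S (y ^ 2) = chain_poly fl D (y ^ 2)"
      using chain_poly_shift[of D "y ^ 2" fl] D by (simp add: S_def)
    also have "\<dots> = side_poly r (y ^ 2) ^ k"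
      using chain_poly_sides[OF r, of 0 k] by (simp add: D_def fl_def)
    finally have "y ^ 4 * S (y ^ 2) * sin \<theta> ^ k = (side_poly r (y ^ 2) * sin \<theta>) ^ k"
      by (simp add: power_mult_distrib)
    also have "\<dots> = y ^ D * sin (real (Suc r) * \<theta>) ^ k"
      using side_poly_cos[of r \<theta>] unfolding y(2) by (simp add: power_mult_distrib y_def[symmetric] D_def mult.commute[of k r] power_mult)
    also have "y ^ D = y ^ 4 * y ^ (D - 4)" using D by (simp flip: power_add)
    finally have 1: "S (y ^ 2) * sin \<theta> ^ k = y ^ (D - 4) * sin (real (Suc r) * \<theta>) ^ k" using y(1) by simp
    have "sin \<theta> ^ (k - 2 + 2) = sin \<theta> ^ (k - 2) * sin \<theta> ^ 2" by (rule power_add)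
    moreover have "k - 2 + 2 = k" using k by simp
    ultimately have "sin \<theta> ^ k = sin \<theta> ^ (k - 2) * sin \<theta> ^ 2" by metis
    with 1 have "S (y ^ 2) * sin \<theta> ^ 2 = y ^ (D - 4) * sin (real (Suc r) * \<theta>) ^ k / sin \<theta> ^ (k - 2)"
      using c by (simp add: field_simps)
    then show "(2 * cos \<theta>) ^ (D - 4) * sin (real (Suc r) * \<theta>) ^ k / sin \<theta> ^ (k - 2) = S (4 * cos \<theta> ^ 2) * sin \<theta> ^ 2"
      unfolding y(2) y_def by simp
  qed simp
qed

section \<open>Asymptotics of the integral\<close>

lemma second_mean_value_antimono:
  fixes f g :: "real \<Rightarrow> real"
  assumes f: "f integrable_on {a..b}" and "a \<le> b"
    and g: "\<And>x y. a \<le> x \<Longrightarrow> x \<le> y \<Longrightarrow> y \<le> b \<Longrightarrow> g y \<le> g x"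
  obtains c where "c \<in> {a..b}"
    "((\<lambda>x. g x * f x) has_integral (g a * integral {a..c} f + g b * integral {c..b} f)) {a..b}"
proof -
  obtain c where c: "c \<in> {a..b}"
    "((\<lambda>x. - g x * f x) has_integral (- g a * integral {a..c} f + - g b * integral {c..b} f)) {a..b}"
    using second_mean_value_theorem_full[OF f \<open>a \<le> b\<close>, of "\<lambda>x. - g x"] g by auto
  from has_integral_neg[OF c(2)] show ?thesis using c(1) by (intro that[of c]) (auto simp: add.commute)
qed

text \<open>
  The second mean value theorem controls the tail of the weighted integral uniformly in \<open>n\<close>, so
  \<open>f\<close> need not be absolutely integrable.
\<close>
lemma integral_monotone_weight_tendsto:
  fixes f :: "real \<Rightarrow> real" and h :: "nat \<Rightarrow> real \<Rightarrow> real"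
  assumes cont: "continuous_on UNIV f"
    and L: "((\<lambda>x. integral {0..x} f) \<longlongrightarrow> L) at_top"
    and B: "filterlim B at_top sequentially"
    and h: "eventually (\<lambda>n. (\<forall>x y. 0 \<le> x \<longrightarrow> x \<le> y \<longrightarrow> y \<le> B n \<longrightarrow> h n y \<le> h n x) \<and>
      (\<forall>x. 0 \<le> x \<longrightarrow> x \<le> B n \<longrightarrow> 0 \<le> h n x \<and> h n x \<le> 1)) sequentially"
    and lim: "\<And>x. 0 \<le> x \<Longrightarrow> (\<lambda>n. h n x) \<longlonglongrightarrow> 1"
  shows "(\<lambda>n. integral {0..B n} (\<lambda>x. h n x * f x)) \<longlonglongrightarrow> L"
proof (rule tendstoI)
  fix e :: real assume e: "0 < e"
  define F where "F = (\<lambda>x. integral {0..x} f)"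
  have int: "f integrable_on {a..b}" for a b
    by (rule integrable_continuous_real) (rule continuous_on_subset[OF cont], simp)
  have F_diff: "integral {a..b} f = F b - F a" if "0 \<le> a" "a \<le> b" for a b
    using Henstock_Kurzweil_Integration.integral_combine[OF that int[of 0 b]] by (simp add: F_def)
  \<comment> \<open>Six shares: one for the weighted integral up to A against F A, one for F A
    against L, and two for each of the two differences of F in the tail.\<close>
  define d where "d = e / 6"
  have d: "0 < d" using e by (simp add: d_def)
  obtain A0 where A0: "\<And>x. A0 \<le> x \<Longrightarrow> \<bar>F x - L\<bar> < d"
    using tendstoD[OF L d] by (auto simp: eventually_at_top_linorder dist_real_def F_def)
  define A where "A = max 0 A0"
  have A: "0 \<le> A" "\<And>x. A \<le> x \<Longrightarrow> \<bar>F x - L\<bar> < d" using A0 by (auto simp: A_def)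
  obtain n0 where n0: "\<And>n x y. n0 \<le> n \<Longrightarrow> 0 \<le> x \<Longrightarrow> x \<le> y \<Longrightarrow> y \<le> B n \<Longrightarrow> h n y \<le> h n x"
      "\<And>n x. n0 \<le> n \<Longrightarrow> 0 \<le> x \<Longrightarrow> x \<le> B n \<Longrightarrow> 0 \<le> h n x \<and> h n x \<le> 1" "\<And>n. n0 \<le> n \<Longrightarrow> A \<le> B n"
    using eventually_conj[OF h filterlim_at_top[THEN iffD1, OF B, rule_format, of A]]
    unfolding eventually_sequentially by blast
  \<comment> \<open>Integrability of the product comes from the monotonicity of the weight, through
    the second mean value theorem.\<close>
  have hint: "(\<lambda>x. h n x * f x) integrable_on {a..b}" if H: "n0 \<le> n" "0 \<le> a" "b \<le> B n" for n a b
  proof (cases "a \<le> b")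
    case True
    obtain c where "c \<in> {a..b}" "((\<lambda>x. h n x * f x) has_integral (h n a * integral {a..c} f + h n b * integral {c..b} f)) {a..b}"
    proof (rule second_mean_value_antimono[OF int True, of "h n"])
      show "h n y \<le> h n x" if "a \<le> x" "x \<le> y" "y \<le> b" for x y
        using that H by (intro n0(1)) auto
    qed (rule that)
    then show ?thesis by blast
  qed (simp add: integrable_on_empty)
  \<comment> \<open>The shift by \<open>n0\<close> makes the bounds on the weights hold for every
    index, as dominated convergence demands.\<close>
  have "(\<lambda>n. integral {0..A} (\<lambda>x. h (n + n0) x * f x)) \<longlonglongrightarrow> integral {0..A} f"
  proof (rule dominated_convergence(2))
    show "(\<lambda>x. h (n + n0) x * f x) integrable_on {0..A}" for n
      using n0(3)[of "n + n0"] by (intro hint) auto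
    show "(\<lambda>x. \<bar>f x\<bar>) integrable_on {0..A}"
      by (intro integrable_continuous_real continuous_intros continuous_on_subset[OF cont]) simp
    show "norm (h (n + n0) x * f x) \<le> \<bar>f x\<bar>" if "x \<in> {0..A}" for n x
      using n0(2)[of "n + n0" x] n0(3)[of "n + n0"] that
      by (simp add: abs_mult mult_left_le_one_le)
    show "(\<lambda>n. h (n + n0) x * f x) \<longlonglongrightarrow> f x" if "x \<in> {0..A}" for x
      using tendsto_mult_right[OF LIMSEQ_ignore_initial_segment[OF lim, of x n0], of "f x"] that by simp
  qed
  then have "(\<lambda>n. integral {0..A} (\<lambda>x. h n x * f x)) \<longlonglongrightarrow> F A"
    unfolding F_def by (rule LIMSEQ_offset)
  from tendstoD[OF this d]
  have "eventually (\<lambda>n. \<bar>integral {0..A} (\<lambda>x. h n x * f x) - F A\<bar> < d) sequentially"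
    by (simp add: dist_real_def)
  moreover have "eventually (\<lambda>n. n0 \<le> n) sequentially" by (rule eventually_ge_at_top)
  ultimately show "eventually (\<lambda>n. dist (integral {0..B n} (\<lambda>x. h n x * f x)) L < e) sequentially"
  proof eventually_elim
    case (elim n)
    note n = n0(1)[OF elim(2)] n0(2)[OF elim(2)] n0(3)[OF elim(2)]
    obtain c where c: "c \<in> {A..B n}" "((\<lambda>x. h n x * f x) has_integral
        (h n A * integral {A..c} f + h n (B n) * integral {c..B n} f)) {A..B n}"
    proof (rule second_mean_value_antimono[OF int n(3), of "h n"])
      show "h n y \<le> h n x" if "A \<le> x" "x \<le> y" "y \<le> B n" for x y
        using that A(1) by (intro n(1)) auto
    qed (rule that)
    have "integral {0..B n} (\<lambda>x. h n x * f x) = integral {0..A} (\<lambda>x. h n x * f x) + integral {A..B n} (\<lambda>x. h n x * f x)"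
      using Henstock_Kurzweil_Integration.integral_combine[OF A(1) n(3) hint[OF elim(2)]] by simp
    also have "integral {A..B n} (\<lambda>x. h n x * f x) = h n A * (F c - F A) + h n (B n) * (F (B n) - F c)"
      using integral_unique[OF c(2)] F_diff A(1) c(1) by simp
    finally have eq: "integral {0..B n} (\<lambda>x. h n x * f x) =
      integral {0..A} (\<lambda>x. h n x * f x) + (h n A * (F c - F A) + h n (B n) * (F (B n) - F c))" .
    have Fc: "\<bar>F c - L\<bar> < d" "\<bar>F A - L\<bar> < d" "\<bar>F (B n) - L\<bar> < d" using A(2) c(1) n(3) by auto
    have "\<bar>h n A * (F c - F A)\<bar> \<le> \<bar>F c - F A\<bar>" "\<bar>h n (B n) * (F (B n) - F c)\<bar> \<le> \<bar>F (B n) - F c\<bar>"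
      using n(2)[of A] n(2)[of "B n"] n(3) A(1) by (simp_all add: abs_mult mult_left_le_one_le)
    then show ?case unfolding eq dist_real_def using elim(1) Fc d_def by linarith
  qed
qed

section \<open>Convergence and positivity of the limit integral\<close>

definition osc :: "nat \<Rightarrow> real \<Rightarrow> real" where
  "osc k u = sin (2 * u) ^ k / u ^ (k - 2)"

text \<open>Only k - 2 of the sine factors are paired with u; the two left over make the bound
  vanish at 0, which gives continuity there.\<close>

lemma osc_bound:
  assumes "2 \<le> k"
  shows "\<bar>osc k u\<bar> \<le> 2 ^ (k - 2) * sin (2 * u) ^ 2"
proof (cases "u = 0")
  case False
  have k: "k = (k - 2) + 2" using assms by simp
  have "\<bar>osc k u\<bar> = (\<bar>sin (2 * u)\<bar> / \<bar>u\<bar>) ^ (k - 2) * sin (2 * u) ^ 2"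
    by (subst (1) k) (simp add: osc_def power_add abs_mult power_abs power_divide power2_eq_square)
  also have "\<bar>sin (2 * u)\<bar> / \<bar>u\<bar> \<le> 2"
    using abs_sin_x_le_abs_x[of "2 * u"] False by (simp add: divide_le_eq)
  then have "(\<bar>sin (2 * u)\<bar> / \<bar>u\<bar>) ^ (k - 2) * sin (2 * u) ^ 2 \<le> 2 ^ (k - 2) * sin (2 * u) ^ 2"
    by (intro mult_right_mono power_mono) auto
  finally show ?thesis .
qed (use assms in \<open>simp add: osc_def power_0_left\<close>)

text \<open>At u = 0 the quotient evaluates to 0, for k > 2 by the convention for division by zero;
  this is also its limit.\<close>

lemma continuous_on_osc:
  assumes "2 \<le> k"
  shows "continuous_on UNIV (osc k)"
proof -
  have "isCont (osc k) u" for u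
  proof (cases "u = 0")
    case True
    have "((\<lambda>u. 2 ^ (k - 2) * sin (2 * u) ^ 2) \<longlongrightarrow> 2 ^ (k - 2) * sin (2 * 0) ^ 2) (at (0 :: real))"
      by (intro tendsto_intros)
    then have "(osc k \<longlongrightarrow> 0) (at 0)"
      using osc_bound[OF assms] by (intro Lim_null_comparison[of "osc k"]) auto
    then show ?thesis using True assms by (simp add: isCont_def osc_def power_0_left)
  next
    case False
    have "isCont (\<lambda>u. sin (2 * u) ^ k / u ^ (k - 2)) u" using False by (intro continuous_intros) auto
    then show ?thesis by (simp add: osc_def[abs_def])
  qed
  then show ?thesis by (simp add: continuous_at_imp_continuous_on)
qed

lemma osc_integrable: "2 \<le> k \<Longrightarrow> osc k integrable_on {a..b}"
  by (rule integrable_continuous_real) (rule continuous_on_subset[OF continuous_on_osc], auto)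

lemma osc_even: "2 \<le> k \<Longrightarrow> osc k (- u) = osc k u"
  by (auto simp: osc_def power_minus[of "sin (2 * u)"] power_minus[of u] minus_one_power_iff)

lemma integral_sin_cubed_bound:
  assumes "a \<le> b"
  shows "\<bar>integral {a..b} (\<lambda>u. sin (2 * u) ^ 3)\<bar> \<le> (4 / 3 :: real)"
proof -
  define G where "G = (\<lambda>u :: real. 1 / 6 * cos (2 * u) ^ 3 - 1 / 2 * cos (2 * u))"
  have "((\<lambda>u. sin (2 * u) ^ 3) has_integral (G b - G a)) {a..b}"
  proof (rule fundamental_theorem_of_calculus[OF assms])
    fix x
    have "(G has_real_derivative (sin (2 * x) * (1 - cos (2 * x) ^ 2))) (at x within {a..b})"
      unfolding G_def by (auto intro!: derivative_eq_intros simp: algebra_simps power2_eq_square)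
    also have "sin (2 * x) * (1 - cos (2 * x) ^ 2) = sin (2 * x) ^ 3"
      using sin_squared_eq[of "2 * x"] by (simp add: power2_eq_square power3_eq_cube)
    finally show "(G has_vector_derivative sin (2 * x) ^ 3) (at x within {a..b})"
      by (simp add: has_real_derivative_iff_has_vector_derivative)
  qed
  moreover have "\<bar>G x\<bar> \<le> 2 / 3" for x
  proof -
    have "\<bar>cos (2 * x)\<bar> \<le> 1" by simp
    moreover from this have "\<bar>cos (2 * x) ^ 3\<bar> \<le> 1" unfolding power_abs by (intro power_le_one) auto
    ultimately show ?thesis unfolding G_def by linarith
  qed
  then have "\<bar>G a\<bar> \<le> 2 / 3" "\<bar>G b\<bar> \<le> 2 / 3" by blast+
  then have "\<bar>G b - G a\<bar> \<le> 4 / 3" by linarith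
  ultimately show ?thesis by (simp only: integral_unique)
qed

text \<open>For k = 3 the bounded integrals of sin^3 meet the decreasing factor 1 / u, as in
  Dirichlet's test; for k \<ge> 4 the integrand is at most 1 / u^2. The constant 3 covers 8 / 3 in
  the first case.\<close>

lemma osc_tail:
  assumes k: "3 \<le> k" and ab: "1 \<le> a" "a \<le> b"
  shows "\<bar>integral {a..b} (osc k)\<bar> \<le> 3 / a"
proof (cases "k = 3")
  case True
  have "(\<lambda>u :: real. sin (2 * u) ^ 3) integrable_on {a..b}"
    by (intro integrable_continuous_real continuous_intros)
  then obtain c where c: "c \<in> {a..b}" "((\<lambda>x. 1 / x * sin (2 * x) ^ 3) has_integral
      (1 / a * integral {a..c} (\<lambda>u. sin (2 * u) ^ 3) + 1 / b * integral {c..b} (\<lambda>u. sin (2 * u) ^ 3))) {a..b}"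
    by (rule second_mean_value_antimono[of _ _ _ "\<lambda>x. 1 / x"]) (use ab in \<open>auto intro!: divide_left_mono\<close>)
  have "\<bar>integral {a..b} (osc k)\<bar> = \<bar>1 / a * integral {a..c} (\<lambda>u. sin (2 * u) ^ 3) + 1 / b * integral {c..b} (\<lambda>u. sin (2 * u) ^ 3)\<bar>"
    using integral_unique[OF c(2)] True by (simp add: osc_def[abs_def])
  also have "\<dots> \<le> \<bar>1 / a * integral {a..c} (\<lambda>u. sin (2 * u) ^ 3)\<bar> + \<bar>1 / b * integral {c..b} (\<lambda>u. sin (2 * u) ^ 3)\<bar>"
    by (rule abs_triangle_ineq)
  also have "\<dots> \<le> 1 / a * (4 / 3) + 1 / a * (4 / 3)"
    unfolding abs_mult using c(1) ab
    by (intro add_mono mult_mono integral_sin_cubed_bound) (auto intro!: divide_left_mono)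
  also have "\<dots> \<le> 3 / a" using ab by (simp add: field_simps)
  finally show ?thesis .
next
  case False
  have "((\<lambda>u :: real. 1 / u ^ 2) has_integral (- 1 / b - (- 1 / a))) {a..b}"
  proof (rule fundamental_theorem_of_calculus[OF ab(2)])
    fix x assume "x \<in> {a..b}"
    then have "x \<noteq> 0" using ab by auto
    then have "((\<lambda>x. - 1 / x) has_real_derivative 1 / x ^ 2) (at x within {a..b})"
      by (auto intro!: derivative_eq_intros simp: power2_eq_square)
    then show "((\<lambda>x. - 1 / x) has_vector_derivative 1 / x ^ 2) (at x within {a..b})"
      by (simp add: has_real_derivative_iff_has_vector_derivative)
  qed
  moreover have "norm (osc k u) \<le> 1 / u ^ 2" if "u \<in> {a..b}" for u
  proof -
    have u: "1 \<le> u" using that ab by auto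
    have "\<bar>sin (2 * u)\<bar> ^ k \<le> 1" by (intro power_le_one) auto
    moreover have "u ^ 2 \<le> u ^ (k - 2)" using u k False by (intro power_increasing) auto
    ultimately show ?thesis using u by (auto simp: osc_def abs_mult power_abs intro!: frac_le)
  qed
  ultimately have "norm (integral {a..b} (osc k)) \<le> integral {a..b} (\<lambda>u :: real. 1 / u ^ 2)"
    using osc_integrable[of k a b] k by (intro integral_norm_bound_integral) auto
  also have "\<dots> = - 1 / b - (- 1 / a)"
    using \<open>(_ has_integral _) {a..b}\<close> by (rule integral_unique)
  also have "\<dots> \<le> 3 / a" using ab by (simp add: field_simps)
  finally show ?thesis by simp
qed

lemma osc_integral_diff:
  assumes "2 \<le> k" "0 \<le> a" "a \<le> b"
  shows "integral {0..b} (osc k) - integral {0..a} (osc k) = integral {a..b} (osc k)"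
  using Henstock_Kurzweil_Integration.integral_combine[OF assms(2,3) osc_integrable[OF assms(1)]] by simp

text \<open>The tail bound makes the values at integers a Cauchy sequence and then controls the
  distance of every large real argument from their limit.\<close>

lemma osc_improper_integral:
  assumes k: "3 \<le> k"
  obtains L where "((\<lambda>x. integral {0..x} (osc k)) \<longlongrightarrow> L) at_top"
proof -
  define F where "F = (\<lambda>x. integral {0..x} (osc k))"
  have F: "\<bar>F b - F a\<bar> \<le> 3 / a" if "1 \<le> a" "a \<le> b" for a b
    using osc_tail[OF k that] osc_integral_diff[of k a b] k that by (simp add: F_def)
  have "Cauchy (\<lambda>n. F (real (Suc n)))"
  proof (rule metric_CauchyI)
    fix e :: real assume "0 < e"
    obtain M :: nat where M: "3 / e < real M" using reals_Archimedean2 by blast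
    have *: "\<bar>F (real (Suc n)) - F (real (Suc m))\<bar> < e" if "M \<le> m" "m \<le> n" for m n
    proof -
      have "\<bar>F (real (Suc n)) - F (real (Suc m))\<bar> \<le> 3 / real (Suc m)" using that by (intro F) auto
      also have "3 / e < real (Suc m)" using M that by linarith
      then have "3 / real (Suc m) < e" using \<open>0 < e\<close> by (simp add: field_simps)
      finally show ?thesis .
    qed
    show "\<exists>M. \<forall>m\<ge>M. \<forall>n\<ge>M. dist (F (real (Suc m))) (F (real (Suc n))) < e"
    proof (intro exI allI impI)
      fix m n assume "M \<le> m" "M \<le> n"
      then show "dist (F (real (Suc m))) (F (real (Suc n))) < e"
        using *[of m n] *[of n m] by (cases "m \<le> n") (auto simp: dist_real_def abs_minus_commute)
    qed
  qed
  then obtain L where L: "(\<lambda>n. F (real (Suc n))) \<longlonglongrightarrow> L" using Cauchy_convergent convergentD by blast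
  have "\<bar>F x - L\<bar> \<le> 3 / x" if x: "1 \<le> x" for x
  proof -
    have "(\<lambda>n. \<bar>F (real (Suc n)) - F x\<bar>) \<longlonglongrightarrow> \<bar>L - F x\<bar>" by (intro tendsto_intros L)
    moreover have "\<forall>n\<ge>nat \<lceil>x\<rceil>. \<bar>F (real (Suc n)) - F x\<bar> \<le> 3 / x"
    proof (intro allI impI)
      fix n assume "nat \<lceil>x\<rceil> \<le> n"
      then have "x \<le> real (Suc n)" by linarith
      then show "\<bar>F (real (Suc n)) - F x\<bar> \<le> 3 / x" by (rule F[OF x])
    qed
    ultimately have "\<bar>L - F x\<bar> \<le> 3 / x" by (rule LIMSEQ_le_const2[OF _ exI])
    then show ?thesis by (simp add: abs_minus_commute)
  qed
  then have "eventually (\<lambda>x. norm (F x - L) \<le> 3 / x) at_top"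
    by (intro eventually_mono[OF eventually_ge_at_top[of 1]]) simp
  moreover have "((\<lambda>x :: real. 3 / x) \<longlongrightarrow> 0) at_top"
    by (intro tendsto_divide_0[OF tendsto_const] filterlim_at_top_imp_at_infinity filterlim_ident)
  ultimately have "((\<lambda>x. F x - L) \<longlongrightarrow> 0) at_top" by (rule Lim_null_comparison)
  then have "(F \<longlongrightarrow> L) at_top" by (rule LIM_zero_cancel)
  then show ?thesis using that by (simp add: F_def[abs_def])
qed

text \<open>The gauge integral over the line is a limit over boxes containing large balls, so
  convergence at each end is enough even without absolute integrability. Both halves give L because
  k and k - 2 have the same parity.\<close>

lemma osc_has_integral_UNIV:
  assumes k: "2 \<le> k" and L: "((\<lambda>x. integral {0..x} (osc k)) \<longlongrightarrow> L) at_top"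
  shows "(osc k has_integral 2 * L) UNIV"
  unfolding has_integral'[of "osc k"]
proof (intro allI impI)
  fix e :: real assume e: "0 < e"
  define F where "F = (\<lambda>x. integral {0..x} (osc k))"
  obtain B0 where B0: "\<And>x. B0 \<le> x \<Longrightarrow> \<bar>F x - L\<bar> < e / 2"
    using tendstoD[OF L, of "e / 2"] e by (auto simp: eventually_at_top_linorder dist_real_def F_def)
  define B where "B = max 1 B0"
  have B: "0 < B" "\<And>x. B \<le> x \<Longrightarrow> \<bar>F x - L\<bar> < e / 2" using B0 by (auto simp: B_def)
  show "\<exists>B>0. \<forall>a b. ball 0 B \<subseteq> cbox a b \<longrightarrow>
    (\<exists>z. ((\<lambda>x. if x \<in> UNIV then osc k x else 0) has_integral z) (cbox a b) \<and> norm (z - 2 * L) < e)"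
  proof (rule exI[of _ B], intro conjI allI impI)
    fix a b :: real assume "ball 0 B \<subseteq> cbox a b"
    then have "closure {- B<..<B} \<subseteq> {a..b}"
      by (intro closure_minimal) (auto simp: ball_eq_greaterThanLessThan)
    then have ab: "B \<le> - a" "B \<le> b" using B(1) by (auto simp: closure_greaterThanLessThan)
    have "(osc k has_integral F (- a)) {0..- a}" "(osc k has_integral F b) {0..b}"
      unfolding F_def using osc_integrable[OF k] by (auto intro: integrable_integral)
    moreover from this have "((\<lambda>x. osc k (- x)) has_integral F (- a)) {- (- a)..- 0}"
      by (simp only: has_integral_reflect_real)
    then have "(osc k has_integral F (- a)) {a..0}" using osc_even[OF k] by simp
    ultimately have "(osc k has_integral (F (- a) + F b)) {a..b}"
      using ab B(1) by (intro has_integral_combine[of a 0 b]) auto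
    moreover have "\<bar>F (- a) + F b - 2 * L\<bar> < e" using B(2)[OF ab(1)] B(2)[OF ab(2)] by linarith
    ultimately show "\<exists>z. ((\<lambda>x. if x \<in> UNIV then osc k x else 0) has_integral z) (cbox a b) \<and> norm (z - 2 * L) < e"
      by auto
  qed (rule B(1))
qed

text \<open>
  The lobes of the integrand over \<open>[n\<pi>, n\<pi> + \<pi>/2]\<close> and \<open>[n\<pi> + \<pi>/2, (n+1)\<pi>]\<close> differ only by a
  sign and by the damping, so each pair contributes a positive amount.
\<close>
lemma osc_pair:
  assumes "2 \<le> k" "0 \<le> u" "u \<le> pi / 2"
  shows "0 \<le> osc k (real n * pi + u) + osc k (real n * pi + pi / 2 + u)"
proof -
  define s where "s = sin (2 * u)"
  define v where "v = real n * pi + u"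
  have s: "0 \<le> s" unfolding s_def using assms by (intro sin_ge_zero) auto
  have v: "0 \<le> v" using assms by (simp add: v_def)
  have sv: "sin (2 * v) = s" "sin (2 * (v + pi / 2)) = - s"
  proof -
    have "2 * v = 2 * u + real (2 * n) * pi" "2 * (v + pi / 2) = 2 * u + real (2 * n) * pi + pi"
      by (simp_all add: v_def algebra_simps)
    then show "sin (2 * v) = s" "sin (2 * (v + pi / 2)) = - s"
      by (simp_all only: sin_add) (simp_all add: s_def)
  qed
  have "- (s ^ k / (v + pi / 2) ^ (k - 2)) \<le> (- s) ^ k / (v + pi / 2) ^ (k - 2)"
    using s v by (auto simp: power_minus[of s] minus_one_power_iff intro!: order_trans[of _ 0] divide_nonneg_nonneg)
  moreover have "s ^ k / (v + pi / 2) ^ (k - 2) \<le> s ^ k / v ^ (k - 2)" if "v \<noteq> 0"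
  proof -
    have "0 < v" "0 < v + pi / 2" using v that pi_gt_zero by linarith+
    then show ?thesis
      using s by (intro divide_left_mono power_mono mult_pos_pos zero_less_power zero_le_power) auto
  qed
  moreover have "s = 0" if "v = 0"
    using that sv(1) by simp
  ultimately have "0 \<le> s ^ k / v ^ (k - 2) + (- s) ^ k / (v + pi / 2) ^ (k - 2)"
    using assms(1) by (cases "v = 0") (auto simp: power_0_left)
  then show ?thesis unfolding osc_def v_def[symmetric] using sv by (simp add: v_def add_ac)
qed

text \<open>Paired lobes make the integral up to multiples of \<pi> nondecreasing, and the first
  pair is strictly positive. Positivity is what permits dividing by the limit later.\<close>

lemma osc_limit_pos:
  assumes k: "3 \<le> k" and L: "((\<lambda>x. integral {0..x} (osc k)) \<longlongrightarrow> L) at_top"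
  shows "0 < L"
proof -
  have k2: "2 \<le> k" using k by simp
  define F where "F = (\<lambda>x. integral {0..x} (osc k))"
  define g where "g = (\<lambda>n u. osc k (real n * pi + u) + osc k (real n * pi + pi / 2 + u))"
  have cont: "continuous_on {0..pi / 2} (g n)" for n
    unfolding g_def
    by (intro continuous_on_add continuous_on_compose2[OF continuous_on_osc[OF k2]] continuous_intros) auto
  have step: "F (real (Suc n) * pi) - F (real n * pi) = integral {0..pi / 2} (g n)" for n
  proof -
    have shift: "integral {c..c + pi / 2} (osc k) = integral {0..pi / 2} (\<lambda>u. osc k (c + u))" for c
      using integral_shift_Icc_real[of 0 "pi / 2" "osc k" c] by (simp add: o_def add.commute)
    have int: "(\<lambda>u. osc k (c + u)) integrable_on {0..pi / 2}" for c
      by (intro integrable_continuous_real continuous_on_compose2[OF continuous_on_osc[OF k2]] continuous_intros) auto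
    have "F (real (Suc n) * pi) - F (real n * pi) = integral {real n * pi..real n * pi + pi} (osc k)"
      unfolding F_def using osc_integral_diff[OF k2, of "real n * pi" "real (Suc n) * pi"]
      by (simp add: algebra_simps)
    also have "\<dots> = integral {real n * pi..real n * pi + pi / 2} (osc k)
        + integral {real n * pi + pi / 2..real n * pi + pi / 2 + pi / 2} (osc k)"
      using Henstock_Kurzweil_Integration.integral_combine[of "real n * pi" "real n * pi + pi / 2" "real n * pi + pi" "osc k"]
        osc_integrable[OF k2] by (simp add: add.commute[of pi])
    also have "\<dots> = integral {0..pi / 2} (g n)"
      unfolding shift g_def by (intro integral_add[symmetric] int)
    finally show ?thesis .
  qed
  have g_nonneg: "0 \<le> g n u" if "u \<in> {0..pi / 2}" for n u
    using osc_pair[OF k2, of u n] that by (simp add: g_def)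
  have mono: "F pi \<le> F (real (Suc n) * pi)" for n
  proof (induction n)
    case (Suc n)
    have "0 \<le> integral {0..pi / 2} (g (Suc n))"
      using g_nonneg by (intro integral_nonneg integrable_continuous_real cont) auto
    then show ?case using step[of "Suc n"] Suc by linarith
  qed simp
  have "0 < F pi"
  proof -
    have "0 \<le> integral {0..pi / 2} (g 0)"
      using g_nonneg by (intro integral_nonneg integrable_continuous_real cont) auto
    moreover have "integral {0..pi / 2} (g 0) \<noteq> 0"
    proof
      assume *: "integral {0..pi / 2} (g 0) = 0"
      have "(g 0 has_integral integral {0..pi / 2} (g 0)) {0..pi / 2}"
        by (intro integrable_integral integrable_continuous_real cont)
      then have "(g 0 has_integral 0) (cbox 0 (pi / 2))" unfolding * by simp
      \<comment> \<open>A continuous nonnegative function with integral 0 vanishes; it is tested at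
        the peak \<pi> / 4 of the lobe, where the sines are 1 and -1.\<close>
      then have "g 0 (pi / 4) = 0"
        by (intro has_integral_0_cbox_imp_0[of 0 "pi / 2" "g 0" "pi / 4"])
          (use cont g_nonneg in \<open>auto simp: box_real pi_gt_zero[unfolded not_le[symmetric]]\<close>)
      then have eq: "1 / (pi / 4) ^ (k - 2) + (- 1) ^ k / (3 * pi / 4) ^ (k - 2) = 0"
      proof -
        have "2 * (pi / 2 + pi / 4) = pi / 2 + pi" by simp
        then have "sin (2 * (pi / 2 + pi / 4)) = - 1" by (simp only: sin_periodic_pi sin_pi_half)
        moreover have "pi / 2 + pi / 4 = 3 * pi / 4" by simp
        ultimately have "osc k (pi / 2 + pi / 4) = (- 1) ^ k / (3 * pi / 4) ^ (k - 2)"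
          by (simp only: osc_def)
        moreover have "osc k (pi / 4) = 1 / (pi / 4) ^ (k - 2)" by (simp add: osc_def)
        moreover have "g 0 (pi / 4) = osc k (pi / 4) + osc k (pi / 2 + pi / 4)" by (simp add: g_def)
        ultimately show ?thesis using \<open>g 0 (pi / 4) = 0\<close> by simp
      qed
      have "(pi / 4) ^ (k - 2) < (3 * pi / 4) ^ (k - 2)"
        using k by (intro power_strict_mono) auto
      then have "1 / (3 * pi / 4) ^ (k - 2) < 1 / (pi / 4) ^ (k - 2)"
        by (intro divide_strict_left_mono) auto
      moreover have "\<bar>(- 1) ^ k / (3 * pi / 4) ^ (k - 2)\<bar> = 1 / (3 * pi / 4) ^ (k - 2)"
        by (simp add: abs_mult power_abs)
      ultimately show False using eq by linarith
    qed
    ultimately show ?thesis using step[of 0] by (simp add: F_def)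
  qed
  moreover have "F pi \<le> L"
  proof (rule LIMSEQ_le_const)
    have "filterlim (\<lambda>n. real (Suc n) * pi) at_top sequentially"
      by (intro filterlim_at_top_mult_tendsto_pos[OF tendsto_const] pi_gt_zero
          filterlim_compose[OF filterlim_real_sequentially] filterlim_Suc)
    then show "(\<lambda>n. F (real (Suc n) * pi)) \<longlonglongrightarrow> L"
      using filterlim_compose[OF L] by (simp add: F_def)
  qed (use mono in blast)
  ultimately show ?thesis by simp
qed

section \<open>The decreasing weight\<close>

definition xcot :: "real \<Rightarrow> real" where
  "xcot x = (if x = 0 then 1 else x * cos x / sin x)"

text \<open>The bound 1 amounts to x cos x \<le> sin x; the difference has derivative x sin
  x.\<close>

lemma xcot_le_1:
  assumes "0 \<le> x" "x \<le> pi / 2"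
  shows "xcot x \<le> 1" "0 \<le> xcot x"
proof -
  have c: "0 \<le> cos x" using assms by (intro cos_ge_zero) auto
  have s: "0 < sin x" if "x \<noteq> 0" using assms that by (intro sin_gt_zero) auto
  have "0 \<le> sin x - x * cos x"
  proof -
    have "sin 0 - 0 * cos 0 \<le> sin x - x * cos x"
    proof (rule DERIV_nonneg_imp_nondecreasing[OF assms(1)])
      fix t assume "0 \<le> t" "t \<le> x"
      then have "0 \<le> t * sin t" using assms by (intro mult_nonneg_nonneg sin_ge_zero) auto
      then show "\<exists>y. ((\<lambda>x. sin x - x * cos x) has_real_derivative y) (at t) \<and> 0 \<le> y"
        by (intro exI[of _ "t * sin t"]) (auto intro!: derivative_eq_intros)
    qed
    then show ?thesis by simp
  qed
  then show "xcot x \<le> 1" "0 \<le> xcot x" using s c assms by (auto simp: xcot_def divide_le_eq)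
qed

text \<open>The numerator of the derivative is sin t cos t - t, which is half of sin(2 t) - 2
  t.\<close>

lemma xcot_antimono:
  assumes "0 \<le> x" "x \<le> y" "y \<le> pi / 2"
  shows "xcot y \<le> xcot x"
proof (cases "x = 0")
  case True
  then show ?thesis using xcot_le_1[of y] assms by (simp add: xcot_def)
next
  case False
  have "y * cos y / sin y \<le> x * cos x / sin x"
  proof (rule DERIV_nonpos_imp_nonincreasing[OF assms(2)])
    fix t assume t: "x \<le> t" "t \<le> y"
    then have s: "0 < sin t" using assms False by (intro sin_gt_zero) auto
    have "sin t * cos t \<le> t"
      using sin_x_le_x[of "2 * t"] assms t by (simp add: sin_double)
    then have "(sin t * cos t - t) / sin t ^ 2 \<le> 0" by (intro divide_nonpos_nonneg) auto
    moreover have "((\<lambda>t. t * cos t / sin t) has_real_derivative (sin t * cos t - t) / sin t ^ 2) (at t)"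
    proof -
      have "((\<lambda>t. t * cos t / sin t) has_real_derivative
          ((cos t - t * sin t) * sin t - t * cos t * cos t) / (sin t * sin t)) (at t)"
        using s by (auto intro!: derivative_eq_intros)
      also have "(cos t - t * sin t) * sin t - t * cos t * cos t = sin t * cos t - t * (sin t ^ 2 + cos t ^ 2)"
        by (simp add: power2_eq_square algebra_simps
            del: sin_cos_squared_add sin_cos_squared_add2 sin_cos_squared_add3)
      also have "sin t ^ 2 + cos t ^ 2 = 1" by simp
      finally show ?thesis by (simp add: power2_eq_square)
    qed
    ultimately show "\<exists>y. ((\<lambda>t. t * cos t / sin t) has_real_derivative y) (at t) \<and> y \<le> 0" by blast
  qed
  then show ?thesis using False assms by (simp add: xcot_def)
qed

lemma xcot_tendsto: "(xcot \<longlongrightarrow> 1) (at 0)"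
proof -
  have "((\<lambda>x :: real. sin x / x) \<longlongrightarrow> 1) (at 0)"
    using DERIV_sin[of "0 :: real"] by (simp add: DERIV_def)
  moreover have "((\<lambda>x :: real. cos x) \<longlongrightarrow> cos 0) (at 0)" by (intro tendsto_intros)
  ultimately have "((\<lambda>x :: real. cos x / (sin x / x)) \<longlongrightarrow> cos 0 / 1) (at 0)"
    by (intro tendsto_divide) auto
  then have "((\<lambda>x :: real. cos x / (sin x / x)) \<longlongrightarrow> 1) (at 0)" by simp
  moreover have "eventually (\<lambda>x. cos x / (sin x / x) = xcot x) (at 0)"
    by (auto simp: eventually_at_filter xcot_def)
  ultimately show ?thesis by (rule Lim_transform_eventually)
qed

text \<open>The factor x / sin x produced by the substitution increases. Pairing each of its j
  copies with a cosine turns it into x cot x, which decreases, as the second mean value argument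
  requires; the remaining n cosines decrease anyway.\<close>

definition weight :: "nat \<Rightarrow> nat \<Rightarrow> real \<Rightarrow> real" where
  "weight n j x = cos x ^ n * xcot x ^ j"

lemma weight_antimono:
  assumes "0 \<le> x" "x \<le> y" "y \<le> pi / 2"
  shows "weight n j y \<le> weight n j x"
proof -
  have "cos y \<le> cos x" using assms pi_gt_zero by (intro cos_monotone_0_pi_le) auto
  moreover have "0 \<le> cos y" using assms by (intro cos_ge_zero) auto
  ultimately show ?thesis unfolding weight_def
    using assms xcot_antimono[OF assms] xcot_le_1[of y]
    by (intro mult_mono power_mono zero_le_power) auto
qed

lemma weight_bounds:
  assumes "0 \<le> x" "x \<le> pi / 2"
  shows "0 \<le> weight n j x" "weight n j x \<le> 1"
proof -
  have "0 \<le> cos x" using assms by (intro cos_ge_zero) auto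
  then show "0 \<le> weight n j x" unfolding weight_def
    using xcot_le_1[OF assms] by (intro mult_nonneg_nonneg zero_le_power) auto
  show "weight n j x \<le> 1"
    using weight_antimono[of 0 x n j] assms by (simp add: weight_def xcot_def)
qed

text \<open>Bernoulli's inequality and 1 - x^2 / 2 \<le> cos x bound the cosine power below by 1 - p
  x^2 / 2, so it tends to 1 as soon as p x^2 tends to 0.\<close>

lemma weight_tendsto:
  assumes x: "\<And>n. x n \<noteq> 0" "x \<longlonglongrightarrow> 0" and p: "(\<lambda>n. real (p n) * x n ^ 2) \<longlonglongrightarrow> 0"
  shows "(\<lambda>n. weight (p n) j (x n)) \<longlonglongrightarrow> 1"
proof -
  have "(\<lambda>n. xcot (x n)) \<longlonglongrightarrow> 1"
    using x by (intro filterlim_compose[OF xcot_tendsto]) (auto simp: filterlim_at)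
  moreover have "(\<lambda>n. cos (x n) ^ p n) \<longlonglongrightarrow> 1"
  proof (rule tendsto_sandwich)
    have "eventually (\<lambda>n. \<bar>x n\<bar> < pi / 2) sequentially"
      using tendstoD[OF x(2), of "pi / 2"] by (simp add: dist_real_def)
    then show "eventually (\<lambda>n. 1 - real (p n) * x n ^ 2 / 2 \<le> cos (x n) ^ p n) sequentially"
    proof eventually_elim
      case (elim n)
      have "0 \<le> cos (x n)" using elim by (intro cos_ge_zero) auto
      have "1 - x n ^ 2 / 2 \<le> cos (x n)"
      proof -
        have "cos (x n) = 1 - 2 * sin (x n / 2) ^ 2" using cos_double_sin[of "x n / 2"] by simp
        moreover have "sin (x n / 2) ^ 2 \<le> (x n / 2) ^ 2"
          using abs_sin_x_le_abs_x[of "x n / 2"] by (intro abs_le_square_iff[THEN iffD1]) auto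
        ultimately show ?thesis by (simp add: power_divide)
      qed
      then have "real (p n) * (1 - x n ^ 2 / 2) \<le> real (p n) * cos (x n)" by (rule mult_left_mono) simp
      then have "1 - real (p n) * x n ^ 2 / 2 \<le> 1 + real (p n) * (cos (x n) - 1)"
        by (simp add: algebra_simps)
      also have "\<dots> \<le> (1 + (cos (x n) - 1)) ^ p n"
        using \<open>0 \<le> cos (x n)\<close> by (intro Bernoulli_inequality) simp
      finally show ?case by simp
    qed
    show "eventually (\<lambda>n. cos (x n) ^ p n \<le> 1) sequentially"
    proof (rule eventuallyI)
      fix n
      have "\<bar>cos (x n) ^ p n\<bar> \<le> 1" unfolding power_abs by (intro power_le_one) auto
      then show "cos (x n) ^ p n \<le> 1" by simp
    qed
    have "(\<lambda>n. 1 - real (p n) * x n ^ 2 / 2) \<longlonglongrightarrow> 1 - 0 / 2" by (intro tendsto_intros p) simp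
    then show "(\<lambda>n. 1 - real (p n) * x n ^ 2 / 2) \<longlonglongrightarrow> 1" by simp
  qed simp
  ultimately have "(\<lambda>n. cos (x n) ^ p n * xcot (x n) ^ j) \<longlonglongrightarrow> 1 * 1 ^ j" by (intro tendsto_intros)
  then show ?thesis by (simp add: weight_def)
qed

section \<open>Substitution and passage to the limit\<close>

lemma has_integral_weight_osc:
  assumes k: "3 \<le> k" and r: "2 \<le> r"
  defines "m \<equiv> 2 / real (Suc r)"
  defines "T \<equiv> chain_count (\<lambda>x. \<not> r dvd x) 0 (k * r - 1) - chain_count (\<lambda>x. \<not> r dvd x) 0 (k * r - 2)"
  shows "((\<lambda>u. weight (k * r - k - 2) (k - 2) (m * u) * osc k u) has_integral
     pi / 4 * T * m ^ (k - 3) / 2 ^ (k * r - 4)) {0..pi / 2 / m}"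
proof -
  have m: "0 < m" by (simp add: m_def)
  obtain j where j: "k = j + 3" using k le_Suc_ex[of 3 k] by (auto simp: add.commute)
  have "k * 2 \<le> k * r" using r by (intro mult_le_mono2)
  \<comment> \<open>Of the kr - 4 cosines, k - 2 are spent on the factors x cot x.\<close>
  then have exp: "k * r - 4 = (k * r - k - 2) + (k - 2)" using k by linarith
  have *: "((\<lambda>u. (2 * cos (m * u)) ^ (k * r - 4) * sin (real (Suc r) * (m * u)) ^ k / sin (m * u) ^ (k - 2))
      has_integral (1 / \<bar>m\<bar>) *\<^sub>R (pi / 4 * T)) ((\<lambda>x. x / m) ` {0..pi / 2})"
    unfolding T_def using m by (intro has_integral_stretch_real[OF has_integral_chain_count[OF k r]]) auto
  have img: "(\<lambda>x. x / m) ` {0..pi / 2} = {0..pi / 2 / m}" using m by simp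
  \<comment> \<open>The reason for m = 2 / (r + 1): the fast sine no longer depends on r.\<close>
  have eq: "real (Suc r) * (m * u) = 2 * u" for u unfolding m_def by (simp add: field_simps)
  have "((\<lambda>u. (2 * cos (m * u)) ^ (k * r - 4) * sin (2 * u) ^ k / sin (m * u) ^ (k - 2))
      has_integral (1 / m) * (pi / 4 * T)) {0..pi / 2 / m}" using *[unfolded img eq] m by simp
  \<comment> \<open>The power of m normalises the sines in the denominator, and the 1 / m of the
    substitution lowers its exponent to k - 3; the power of 2 strips the cosines of their
    factors.\<close>
  from has_integral_mult_right[OF this, of "m ^ (k - 2) / 2 ^ (k * r - 4)"]
  have "((\<lambda>u. m ^ (k - 2) / 2 ^ (k * r - 4) * ((2 * cos (m * u)) ^ (k * r - 4) * sin (2 * u) ^ k / sin (m * u) ^ (k - 2)))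
      has_integral m ^ (k - 2) / 2 ^ (k * r - 4) * (1 / m * (pi / 4 * T))) {0..pi / 2 / m}" .
  also have "m ^ (k - 2) / 2 ^ (k * r - 4) * (1 / m * (pi / 4 * T)) = pi / 4 * T * m ^ (k - 3) / 2 ^ (k * r - 4)"
    using m by (simp add: j field_simps)
  finally show ?thesis
  proof (rule has_integral_spike_finite[rotated 2])
    fix u assume "u \<in> {0..pi / 2 / m} - {0}"
    then have u: "0 < m * u" "m * u \<le> pi / 2" using m by (auto simp: field_simps)
    have "0 < sin (m * u)" using u by (intro sin_gt_zero) auto
    moreover have "0 < u" using u m by (simp add: zero_less_mult_iff)
    ultimately show "weight (k * r - k - 2) (k - 2) (m * u) * osc k u =
        m ^ (k - 2) / 2 ^ (k * r - 4) * ((2 * cos (m * u)) ^ (k * r - 4) * sin (2 * u) ^ k / sin (m * u) ^ (k - 2))"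
      using m unfolding weight_def osc_def xcot_def power_mult_distrib power_divide exp power_add
      by (simp add: field_simps)
  qed simp
qed

text \<open>The number of cosines grows at most like kr while the squared argument decays like 1 /
  r^2, so the weight tends to 1 pointwise; the upper limit of integration is \<pi> (r + 1) /
  4.\<close>

lemma weight_osc_integral_tendsto:
  assumes k: "3 \<le> k" and L: "((\<lambda>x. integral {0..x} (osc k)) \<longlongrightarrow> L) at_top"
  shows "(\<lambda>r. integral {0..pi / 2 / (2 / real (Suc r))}
      (\<lambda>u. weight (k * r - k - 2) (k - 2) (2 / real (Suc r) * u) * osc k u)) \<longlonglongrightarrow> L"
proof (rule integral_monotone_weight_tendsto[OF _ L])
  show "continuous_on UNIV (osc k)" using k by (intro continuous_on_osc) simp
  have "filterlim (\<lambda>r. pi / 4 * real (Suc r)) at_top sequentially"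
    by (intro filterlim_tendsto_pos_mult_at_top[OF tendsto_const]
        filterlim_compose[OF filterlim_real_sequentially] filterlim_Suc) simp
  then show "filterlim (\<lambda>r. pi / 2 / (2 / real (Suc r))) at_top sequentially" by (simp add: mult.commute)
  have B: "0 \<le> 2 / real (Suc r) * x \<and> 2 / real (Suc r) * x \<le> pi / 2"
    if "0 \<le> x" "x \<le> pi / 2 / (2 / real (Suc r))" for r x
    using that by (simp add: field_simps)
  show "eventually (\<lambda>r. (\<forall>x y. 0 \<le> x \<longrightarrow> x \<le> y \<longrightarrow> y \<le> pi / 2 / (2 / real (Suc r)) \<longrightarrow>
        weight (k * r - k - 2) (k - 2) (2 / real (Suc r) * y) \<le> weight (k * r - k - 2) (k - 2) (2 / real (Suc r) * x)) \<and>
      (\<forall>x. 0 \<le> x \<longrightarrow> x \<le> pi / 2 / (2 / real (Suc r)) \<longrightarrow>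
        0 \<le> weight (k * r - k - 2) (k - 2) (2 / real (Suc r) * x) \<and> weight (k * r - k - 2) (k - 2) (2 / real (Suc r) * x) \<le> 1)) sequentially"
  proof (intro always_eventually allI conjI impI)
    fix r x y assume xy: "0 \<le> x" "x \<le> y" "y \<le> pi / 2 / (2 / real (Suc r))"
    show "weight (k * r - k - 2) (k - 2) (2 / real (Suc r) * y) \<le> weight (k * r - k - 2) (k - 2) (2 / real (Suc r) * x)"
      using B[of x r] B[of y r] xy by (intro weight_antimono mult_left_mono) auto
  next
    fix r x assume x: "0 \<le> x" "x \<le> pi / 2 / (2 / real (Suc r))"
    show "0 \<le> weight (k * r - k - 2) (k - 2) (2 / real (Suc r) * x)"
      "weight (k * r - k - 2) (k - 2) (2 / real (Suc r) * x) \<le> 1"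
      using B[OF x] by (auto intro: weight_bounds)
  qed
  fix u :: real assume u: "0 \<le> u"
  show "(\<lambda>r. weight (k * r - k - 2) (k - 2) (2 / real (Suc r) * u)) \<longlonglongrightarrow> 1"
  \<comment> \<open>\<open>weight_tendsto\<close> requires nonzero arguments, since it uses the
    punctured limit of \<open>xcot\<close> at 0.\<close>
  proof (cases "u = 0")
    case True
    then show ?thesis by (simp add: weight_def xcot_def)
  next
    case False
    show ?thesis
    proof (rule weight_tendsto)
      show "2 / real (Suc r) * u \<noteq> 0" for r using False by simp
      have inv: "(\<lambda>r. 1 / real (Suc r)) \<longlonglongrightarrow> 0"
        using LIMSEQ_inverse_real_of_nat by (simp add: inverse_eq_divide)
      from tendsto_mult_right[OF this, of "2 * u"]
      show "(\<lambda>r. 2 / real (Suc r) * u) \<longlonglongrightarrow> 0" by (simp add: mult_ac)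
      show "(\<lambda>r. real (k * r - k - 2) * (2 / real (Suc r) * u) ^ 2) \<longlonglongrightarrow> 0"
      proof (rule Lim_null_comparison)
        show "eventually (\<lambda>r. norm (real (k * r - k - 2) * (2 / real (Suc r) * u) ^ 2) \<le> 4 * real k * u ^ 2 * (1 / real (Suc r))) sequentially"
        proof (rule always_eventually, rule allI)
          fix r
          have "k * r - k - 2 \<le> k * r" by linarith
          also have "\<dots> \<le> k * Suc r" by simp
          finally have "real (k * r - k - 2) \<le> real (k * Suc r)" by (rule of_nat_mono)
          then have "real (k * r - k - 2) * (2 / real (Suc r) * u) ^ 2 \<le> real (k * Suc r) * (2 / real (Suc r) * u) ^ 2"
            by (intro mult_right_mono) auto
          also have "\<dots> = 4 * real k * u ^ 2 * (1 / real (Suc r))"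
          proof -
            define s where "s = real (Suc r)"
            have "s \<noteq> 0" by (simp add: s_def)
            then show ?thesis unfolding of_nat_mult s_def[symmetric] by (simp add: power2_eq_square)
          qed
          finally show "norm (real (k * r - k - 2) * (2 / real (Suc r) * u) ^ 2) \<le> 4 * real k * u ^ 2 * (1 / real (Suc r))"
            by simp
        qed
        show "(\<lambda>r. 4 * real k * u ^ 2 * (1 / real (Suc r))) \<longlonglongrightarrow> 0"
          using tendsto_mult_left[OF inv, of "4 * real k * u ^ 2"] by simp
      qed
    qed
  qed
qed

theorem theorem6p2:
  fixes k :: nat and SC :: "nat \<Rightarrow> (real^2) set"
  assumes "k \<ge> 3"
    and "\<And>r. r \<ge> 1 \<Longrightarrow> subdivided_convex_polygon k r (SC r)"
  shows "(\<lambda>r. real (num_triangulations (SC r))) \<sim>[at_top]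
         (\<lambda>r. 2 ^ ((r - 1) * k) * real r ^ (k - 3) / pi *
              integral UNIV (\<lambda>u::real. sin (2 * u) ^ k / u ^ (k - 2)))"
proof -
  note k = assms(1)
  obtain L where L: "((\<lambda>x. integral {0..x} (osc k)) \<longlongrightarrow> L) at_top" using osc_improper_integral[OF k] .
  have "0 < L" using osc_limit_pos[OF k L] .
  have J: "integral UNIV (\<lambda>u::real. sin (2 * u) ^ k / u ^ (k - 2)) = 2 * L"
    using osc_has_integral_UNIV[OF _ L] k by (intro integral_unique) (simp add: osc_def[abs_def])
  define K where "K = (\<lambda>r. integral {0..pi / 2 / (2 / real (Suc r))}
      (\<lambda>u. weight (k * r - k - 2) (k - 2) (2 / real (Suc r) * u) * osc k u))"
  define g where "g = (\<lambda>r. 2 ^ ((r - 1) * k) * real r ^ (k - 3) / pi * (2 * L))"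
  \<comment> \<open>This ratio is exact; only the integrals \<open>K r\<close> and the replacement
    of r + 1 by r are asymptotic.\<close>
  have ratio: "real (num_triangulations (SC r)) / g r = K r / L * (real (Suc r) / real r) ^ (k - 3)" if r: "2 \<le> r" for r
  proof -
    define T where "T = real (num_triangulations (SC r))"
    have "subdivided_convex_polygon k r (SC r)" using r by (intro assms(2)) simp
    then have "K r = pi / 4 * T * (2 / real (Suc r)) ^ (k - 3) / 2 ^ (k * r - 4)"
      unfolding K_def T_def num_triangulations_chain_count[OF _ r]
      using integral_unique[OF has_integral_weight_osc[OF k r]] by (simp add: num_triangulations_chain_count r)
    then have T: "T = K r * 4 / pi * 2 ^ (k * r - 4) * real (Suc r) ^ (k - 3) / 2 ^ (k - 3)"
      by (simp add: power_divide field_simps)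
    \<comment> \<open>Powers of two: 2^(kr - 4) from the doubled cosines against 2^(k - 3) from the
      stretch. One factor 2 of the constant 4 / \<pi> completes the exponent, the other matches the
      integral 2 L.\<close>
    have "Suc (k * r - 4) = (k - 3) + (r - 1) * k"
    proof -
      obtain j q where "k = j + 3" "r = q + 2" using k r le_Suc_ex[of 3 k] le_Suc_ex[of 2 r] by (auto simp: add.commute)
      then show ?thesis by (simp add: algebra_simps)
    qed
    then have "2 * 2 ^ (k * r - 4) = (2 :: real) ^ ((k - 3) + (r - 1) * k)" by (metis power_Suc)
    then have Y: "(2 :: real) ^ ((r - 1) * k) = 2 * 2 ^ (k * r - 4) / 2 ^ (k - 3)"
      by (simp add: power_add)
    have "0 < real r ^ (k - 3)" using r by simp
    then show ?thesis using \<open>0 < L\<close> unfolding g_def Y T_def[symmetric] T power_divide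
      by (simp add: divide_simps)
  qed
  have "(\<lambda>r. K r / L * (real (Suc r) / real r) ^ (k - 3)) \<longlonglongrightarrow> L / L * 1 ^ (k - 3)"
  proof (intro tendsto_intros)
    show "K \<longlonglongrightarrow> L" unfolding K_def by (rule weight_osc_integral_tendsto[OF k L])
    show "L \<noteq> 0" using \<open>0 < L\<close> by simp
    show "(\<lambda>r. real (Suc r) / real r) \<longlonglongrightarrow> 1" by (rule LIMSEQ_Suc_n_over_n)
  qed
  then have lim: "(\<lambda>r. K r / L * (real (Suc r) / real r) ^ (k - 3)) \<longlonglongrightarrow> 1" using \<open>0 < L\<close> by simp
  have "(\<lambda>r. real (num_triangulations (SC r)) / g r) \<longlonglongrightarrow> 1"
    using lim by (rule Lim_transform_eventually)
      (use ratio in \<open>auto intro!: eventually_mono[OF eventually_ge_at_top[of 2]]\<close>)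
  then show ?thesis unfolding J g_def[symmetric] by (rule asymp_equivI')
qed

end
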